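(* Let $(M,L)$ be a Finsler manifold. There exists a unique regular connection $D^{\circ}$ on $\pi^{-1}(TM)$ such that: (a) $D^{\circ}_{h^{\circ}X}L=0$ for all $X\in\mathfrak{X}(\mathcal{T}M)$, where $h^{\circ}$ is the horizontal projector of $D^{\circ}$; (b) $D^{\circ}$ is torsion-free: $\mathbf{T}^{\circ}=0$; (c) the (v)hv-torsion tensor $\widehat{P}^{\circ}$ of $D^{\circ}$ vanishes: $\widehat{P}^{\circ}(\overline{X},\overline{Y})=0$ for all $\overline{X},\overline{Y}\in\mathfrak{X}(\pi(M))$. (This connection is called the Berwald connection associated with $(M,L)$.)
   Context: Pullback formalism. $M$ is a real $C^\infty$ manifold of finite dimension; all objects are $C^\infty$. $\pi_M:TM\to M$ is the tangent bundle, $\pi:\mathcal{T}M\to M$ its open subbundle of nonzero tangent vectors, and $\pi^{-1}(TM)\to\mathcal{T}M$ is the pullback of $TM$ by $\pi$ (fibre over $u$: pairs $(u,v)$ with $v\in T_{\pi(u)}M$). $\mathfrak{X}(\mathcal{T}M)$ denotes the vector fields on $\mathcal{T}M$, and $\mathfrak{X}(\pi(M))$ the smooth sections of $\pi^{-1}(TM)$, written with bars. The fundamental section is $\overline{\eta}(u)=(u,u)$. The bundle morphisms $\rho:T(\mathcal{T}M)\to\pi^{-1}(TM)$ and $\gamma:\pi^{-1}(TM)\to T(\mathcal{T}M)$ are $\rho(X)=(u,d\pi(X))$ for $X\in T_u(\mathcal{T}M)$ and $\gamma(u,v)=\frac{d}{dt}\big|_{t=0}(u+tv)$; the image of $\gamma$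 is $\ker\rho=V(\mathcal{T}M)$, the vertical bundle. Regular connections. For a linear connection $D$ on the vector bundle $\pi^{-1}(TM)$, the connection map is $K(X)=D_X\overline{\eta}$, and the horizontal space at $u$ is $H_u(\mathcal{T}M)=\{X\in T_u(\mathcal{T}M):K(X)=0\}$. $D$ is regular if $T_u(\mathcal{T}M)=V_u(\mathcal{T}M)\oplus H_u(\mathcal{T}M)$ for all $u\in\mathcal{T}M$. Then $\rho|_{H(\mathcal{T}M)}$ is an isomorphism onto $\pi^{-1}(TM)$, with inverse $\beta:=(\rho|_{H(\mathcal{T}M)})^{-1}$ (the horizontal map of $D$), and the horizontal projector of $D$ is $h=\beta\circ\rho$. For a function $f$ on $\mathcal{T}M$, $D_Xf$ means $X\cdot f$. Torsion and curvature. For $X,Y,Z\in\mathfrak{X}(\mathcal{T}M)$: $\mathbf{T}(X,Y)=D_X\rho Y-D_Y\rho X-\rho[X,Y]$ and $\mathbf{K}(X,Y)\rho Z=-D_XD_Y\rho Z+D_YD_X\rho Z+D_{[X,Y]}\rho Z$. The (v)hv-torsion is $\widehat{P}(\overline{X},\overline{Y})=\mathbf{K}(\beta\overline{X},\gamma\overline{Y})\overline{\eta}$. The superscript $\circ$ indicates the objects attached to $D^{\circ}$. Finsler structure. $(M,L)$ is a Finsler manifold: $L:TM\to\mathbb{R}$ is continuous, $C^\infty$ and positive on $\mathcal{T}M$, positively homogeneous of degree 1 on fibres, and the fibrewise Hessian of $E:=\frac12L^2$ on $\mathcal{T}M$ is positive definite. *)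

theory Defs
  imports "HOL-Analysis.Analysis" "HOL-Library.Function_Algebras"
begin

section \<open>Functions as a real vector space, smooth maps\<close>

instantiation "fun" :: (type, real_vector) real_vector
begin

definition scaleR_fun :: "real \<Rightarrow> ('a \<Rightarrow> 'b) \<Rightarrow> 'a \<Rightarrow> 'b"
  where "scaleR_fun a f = (\<lambda>x. a *\<^sub>R f x)"

instance
  by standard (auto simp: scaleR_fun_def fun_eq_iff algebra_simps)

end

text \<open>The following two notions are meant for open \<open>S\<close>. In finite dimension, continuity of all
  iterated directional derivatives up to order \<open>k\<close> is the usual \<open>C\<^sup>k\<close> condition.\<close>

primrec Ck_on :: "nat \<Rightarrow> 'a::euclidean_space set \<Rightarrow> ('a \<Rightarrow> 'b::real_normed_vector) \<Rightarrow> bool" where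
  "Ck_on 0 S f \<longleftrightarrow> continuous_on S f"
| "Ck_on (Suc k) S f \<longleftrightarrow> (\<forall>x\<in>S. f differentiable (at x)) \<and>
     (\<forall>v. Ck_on k S (\<lambda>x. frechet_derivative f (at x) v))"

definition smooth_on :: "'a::euclidean_space set \<Rightarrow> ('a \<Rightarrow> 'b::real_normed_vector) \<Rightarrow> bool"
  where "smooth_on S f \<longleftrightarrow> (\<forall>k. Ck_on k S f)"


section \<open>Manifolds\<close>

text \<open>A manifold is given by an indexed family of charts with values in the model space \<open>'e\<close>;
  its underlying set is the union of the chart domains and its topology is the one
  determined by the charts.\<close>

record ('i, 'p, 'e) atlas =
  indices :: "'i set"
  chart_dom :: "'i \<Rightarrow> 'p set"
  chart_map :: "'i \<Rightarrow> 'p \<Rightarrow> 'e"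

definition points :: "('i, 'p, 'e) atlas \<Rightarrow> 'p set"
  where "points A = (\<Union>i\<in>indices A. chart_dom A i)"

definition charts_at :: "('i, 'p, 'e) atlas \<Rightarrow> 'p \<Rightarrow> 'i set"
  where "charts_at A p = {i \<in> indices A. p \<in> chart_dom A i}"

definition chart_inv :: "('i, 'p, 'e) atlas \<Rightarrow> 'i \<Rightarrow> 'e \<Rightarrow> 'p"
  where "chart_inv A i = inv_into (chart_dom A i) (chart_map A i)"

definition smooth_atlas :: "('i, 'p, 'e::euclidean_space) atlas \<Rightarrow> bool" where
  "smooth_atlas A \<longleftrightarrow>
     (\<forall>i\<in>indices A. inj_on (chart_map A i) (chart_dom A i) \<and>
        open (chart_map A i ` chart_dom A i)) \<and>
     (\<forall>i\<in>indices A. \<forall>j\<in>indices A.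
        open (chart_map A i ` (chart_dom A i \<inter> chart_dom A j)) \<and>
        smooth_on (chart_map A i ` (chart_dom A i \<inter> chart_dom A j))
          (chart_map A j \<circ> chart_inv A i))"

definition atlas_topology :: "('i, 'p, 'e::euclidean_space) atlas \<Rightarrow> 'p topology" where
  "atlas_topology A = topology (\<lambda>S. S \<subseteq> points A \<and>
     (\<forall>i\<in>indices A. open (chart_map A i ` (S \<inter> chart_dom A i))))"

lemma openin_atlas_topology:
  assumes "smooth_atlas A"
  shows "openin (atlas_topology A) S \<longleftrightarrow>
    S \<subseteq> points A \<and> (\<forall>i\<in>indices A. open (chart_map A i ` (S \<inter> chart_dom A i)))"
proof -
  have "istopology (\<lambda>S. S \<subseteq> points A \<and>
      (\<forall>i\<in>indices A. open (chart_map A i ` (S \<inter> chart_dom A i))))"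
    unfolding istopology_def
  proof (intro conjI allI impI ballI)
    fix S T i
    assume S: "S \<subseteq> points A \<and> (\<forall>i\<in>indices A. open (chart_map A i ` (S \<inter> chart_dom A i)))"
      and T: "T \<subseteq> points A \<and> (\<forall>i\<in>indices A. open (chart_map A i ` (T \<inter> chart_dom A i)))"
    show "S \<inter> T \<subseteq> points A"
      using S by blast
    assume i: "i \<in> indices A"
    have "inj_on (chart_map A i) (chart_dom A i)"
      using assms i unfolding smooth_atlas_def by blast
    then have "chart_map A i ` (S \<inter> T \<inter> chart_dom A i) =
        chart_map A i ` (S \<inter> chart_dom A i) \<inter> chart_map A i ` (T \<inter> chart_dom A i)"
      unfolding inj_on_def by blast
    then show "open (chart_map A i ` (S \<inter> T \<inter> chart_dom A i))"
      using S T i by (simp add: open_Int)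
  next
    fix \<K> i
    assume K: "\<forall>S\<in>\<K>. S \<subseteq> points A \<and>
      (\<forall>i\<in>indices A. open (chart_map A i ` (S \<inter> chart_dom A i)))"
    show "\<Union>\<K> \<subseteq> points A"
      using K by blast
    assume i: "i \<in> indices A"
    have "chart_map A i ` (\<Union>\<K> \<inter> chart_dom A i) =
        (\<Union>S\<in>\<K>. chart_map A i ` (S \<inter> chart_dom A i))"
      by blast
    then show "open (chart_map A i ` (\<Union>\<K> \<inter> chart_dom A i))"
      using K i by auto
  qed
  then show ?thesis
    unfolding atlas_topology_def by (simp add: topology_inverse')
qed

definition second_countable_space :: "'p topology \<Rightarrow> bool" where
  "second_countable_space T \<longleftrightarrow> (\<exists>\<B>. countable \<B> \<and> (\<forall>V\<in>\<B>. openin T V) \<and>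
     (\<forall>U x. openin T U \<and> x \<in> U \<longrightarrow> (\<exists>V\<in>\<B>. x \<in> V \<and> V \<subseteq> U)))"

definition smooth_manifold :: "('i, 'p, 'e::euclidean_space) atlas \<Rightarrow> bool" where
  "smooth_manifold A \<longleftrightarrow> smooth_atlas A \<and>
     Hausdorff_space (atlas_topology A) \<and> second_countable_space (atlas_topology A)"

definition smooth_fun :: "('i, 'p, 'e::euclidean_space) atlas \<Rightarrow> ('p \<Rightarrow> real) \<Rightarrow> bool" where
  "smooth_fun A f \<longleftrightarrow>
     (\<forall>i\<in>indices A. smooth_on (chart_map A i ` chart_dom A i) (f \<circ> chart_inv A i))"


section \<open>Tangent vectors and vector fields\<close>

text \<open>A tangent vector at \<open>p\<close> is the family of its component vectors in the charts around \<open>p\<close>,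
  related by the differentials of the coordinate changes. Components in charts that do
  not contain \<open>p\<close> are set to \<open>0\<close>, so that \<open>T\<^sub>pM\<close> is a linear subspace of \<open>'i \<Rightarrow> 'e\<close>.\<close>

definition tangent_space :: "('i, 'p, 'e::euclidean_space) atlas \<Rightarrow> 'p \<Rightarrow> ('i \<Rightarrow> 'e) set" where
  "tangent_space A p = {v.
     (\<forall>i. i \<notin> charts_at A p \<longrightarrow> v i = 0) \<and>
     (\<forall>i\<in>charts_at A p. \<forall>j\<in>charts_at A p.
        v j = frechet_derivative (chart_map A j \<circ> chart_inv A i) (at (chart_map A i p)) (v i))}"

definition vector_fields :: "('i, 'p, 'e::euclidean_space) atlas \<Rightarrow> ('p \<Rightarrow> 'i \<Rightarrow> 'e) set" where
  "vector_fields A = {X.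
     (\<forall>p\<in>points A. X p \<in> tangent_space A p) \<and> (\<forall>p. p \<notin> points A \<longrightarrow> X p = 0) \<and>
     (\<forall>i\<in>indices A. smooth_on (chart_map A i ` chart_dom A i) (\<lambda>x. X (chart_inv A i x) i))}"

text \<open>Derivative \<open>w \<cdot> f\<close> of a function along \<open>w \<in> T\<^sub>pM\<close>, computed in any chart around \<open>p\<close>.\<close>

definition fun_deriv ::
  "('i, 'p, 'e::euclidean_space) atlas \<Rightarrow> ('p \<Rightarrow> real) \<Rightarrow> 'p \<Rightarrow> ('i \<Rightarrow> 'e) \<Rightarrow> real" where
  "fun_deriv A f p w = (let i = (SOME i. i \<in> charts_at A p) in
     frechet_derivative (f \<circ> chart_inv A i) (at (chart_map A i p)) (w i))"

text \<open>Differential at \<open>p\<close> of a map \<open>F\<close> between manifolds, computed in any chart around \<open>p\<close>.\<close>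

definition differential ::
  "('i, 'p, 'e::euclidean_space) atlas \<Rightarrow> ('j, 'q, 'f::euclidean_space) atlas \<Rightarrow> ('p \<Rightarrow> 'q) \<Rightarrow>
   'p \<Rightarrow> ('i \<Rightarrow> 'e) \<Rightarrow> 'j \<Rightarrow> 'f" where
  "differential A B F p w = (\<lambda>j. if j \<in> charts_at B (F p) then
     (let i = (SOME i. i \<in> charts_at A p) in
       frechet_derivative (chart_map B j \<circ> F \<circ> chart_inv A i) (at (chart_map A i p)) (w i))
     else 0)"

definition velocity :: "('i, 'p, 'e::euclidean_space) atlas \<Rightarrow> (real \<Rightarrow> 'p) \<Rightarrow> 'i \<Rightarrow> 'e" where
  "velocity A c = (\<lambda>i. if i \<in> charts_at A (c 0)
     then vector_derivative (chart_map A i \<circ> c) (at 0) else 0)"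

text \<open>\<open>[X, Y]\<close>: in each chart, the derivative of \<open>Y\<close> along \<open>X\<close> minus that of \<open>X\<close> along \<open>Y\<close>.\<close>

definition lie_bracket ::
  "('i, 'p, 'e::euclidean_space) atlas \<Rightarrow> ('p \<Rightarrow> 'i \<Rightarrow> 'e) \<Rightarrow> ('p \<Rightarrow> 'i \<Rightarrow> 'e) \<Rightarrow> 'p \<Rightarrow> 'i \<Rightarrow> 'e"
  where
  "lie_bracket A X Y = (\<lambda>p i. if i \<in> charts_at A p then
     frechet_derivative (\<lambda>x. Y (chart_inv A i x) i) (at (chart_map A i p)) (X p i) -
     frechet_derivative (\<lambda>x. X (chart_inv A i x) i) (at (chart_map A i p)) (Y p i)
     else 0)"


section \<open>The tangent bundle and the slit tangent bundle\<close>

type_synonym ('i, 'p, 'e) tangent_point = "'p \<times> ('i \<Rightarrow> 'e)"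

definition tangent_bundle ::
  "('i, 'p, 'e::euclidean_space) atlas \<Rightarrow> ('i, ('i, 'p, 'e) tangent_point, 'e \<times> 'e) atlas" where
  "tangent_bundle A = \<lparr> indices = indices A,
     chart_dom = (\<lambda>i. {u. fst u \<in> chart_dom A i \<and> snd u \<in> tangent_space A (fst u)}),
     chart_map = (\<lambda>i u. (chart_map A i (fst u), snd u i)) \<rparr>"

definition slit_bundle ::
  "('i, 'p, 'e::euclidean_space) atlas \<Rightarrow> ('i, ('i, 'p, 'e) tangent_point, 'e \<times> 'e) atlas" where
  "slit_bundle A = (tangent_bundle A)
     \<lparr> chart_dom := (\<lambda>i. {u \<in> chart_dom (tangent_bundle A) i. snd u \<noteq> 0}) \<rparr>"


section \<open>Finsler structures\<close>

definition fibre_hessian ::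
  "(('i, 'p, 'e::real_vector) tangent_point \<Rightarrow> real) \<Rightarrow> ('i, 'p, 'e) tangent_point \<Rightarrow>
   ('i \<Rightarrow> 'e) \<Rightarrow> ('i \<Rightarrow> 'e) \<Rightarrow> real" where
  "fibre_hessian E u v w =
     deriv (\<lambda>s. deriv (\<lambda>t. E (fst u, snd u + s *\<^sub>R v + t *\<^sub>R w)) 0) 0"

definition finsler ::
  "('i, 'p, 'e::euclidean_space) atlas \<Rightarrow> (('i, 'p, 'e) tangent_point \<Rightarrow> real) \<Rightarrow> bool" where
  "finsler A L \<longleftrightarrow>
     continuous_map (atlas_topology (tangent_bundle A)) euclideanreal L \<and>
     smooth_fun (slit_bundle A) L \<and>
     (\<forall>u\<in>points (slit_bundle A). L u > 0) \<and>
     (\<forall>u\<in>points (tangent_bundle A). \<forall>a>0. L (fst u, a *\<^sub>R snd u) = a * L u) \<and>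
     (\<forall>u\<in>points (slit_bundle A). \<forall>v\<in>tangent_space A (fst u). v \<noteq> 0 \<longrightarrow>
        fibre_hessian (\<lambda>u. (L u)\<^sup>2 / 2) u v v > 0)"


section \<open>The pullback bundle\<close>

text \<open>The element \<open>(u, v)\<close> of the pullback bundle is represented by \<open>v\<close>, its base point \<open>u\<close>
  being passed separately.\<close>

type_synonym ('i, 'p, 'e) pb_section = "('i, 'p, 'e) tangent_point \<Rightarrow> 'i \<Rightarrow> 'e"

definition pb_sections :: "('i, 'p, 'e::euclidean_space) atlas \<Rightarrow> ('i, 'p, 'e) pb_section set" where
  "pb_sections A = {Y.
     (\<forall>u\<in>points (slit_bundle A). Y u \<in> tangent_space A (fst u)) \<and>
     (\<forall>u. u \<notin> points (slit_bundle A) \<longrightarrow> Y u = 0) \<and>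
     (\<forall>i\<in>indices A. smooth_on (chart_map (slit_bundle A) i ` chart_dom (slit_bundle A) i)
        (\<lambda>z. Y (chart_inv (slit_bundle A) i z) i))}"

definition rho :: "('i, 'p, 'e::euclidean_space) atlas \<Rightarrow> ('i, 'p, 'e) tangent_point \<Rightarrow>
    ('i \<Rightarrow> 'e \<times> 'e) \<Rightarrow> 'i \<Rightarrow> 'e"
  where "rho A u w = differential (slit_bundle A) A fst u w"

definition gamma :: "('i, 'p, 'e::euclidean_space) atlas \<Rightarrow> ('i, 'p, 'e) tangent_point \<Rightarrow>
    ('i \<Rightarrow> 'e) \<Rightarrow> 'i \<Rightarrow> 'e \<times> 'e"
  where "gamma A u v = velocity (slit_bundle A) (\<lambda>t. (fst u, snd u + t *\<^sub>R v))"

text \<open>Action on sections of a morphism \<open>F\<close> of vector bundles over the slit tangent bundle.\<close>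

definition on_sections :: "('i, 'p, 'e::euclidean_space) atlas \<Rightarrow>
    (('i, 'p, 'e) tangent_point \<Rightarrow> 'v \<Rightarrow> 'w::zero) \<Rightarrow>
    (('i, 'p, 'e) tangent_point \<Rightarrow> 'v) \<Rightarrow> ('i, 'p, 'e) tangent_point \<Rightarrow> 'w"
  where "on_sections A F X = (\<lambda>u. if u \<in> points (slit_bundle A) then F u (X u) else 0)"

definition eta :: "('i, 'p, 'e::euclidean_space) atlas \<Rightarrow> ('i, 'p, 'e) pb_section"
  where "eta A = (\<lambda>u. if u \<in> points (slit_bundle A) then snd u else 0)"


section \<open>Connections on the pullback bundle\<close>

text \<open>\<open>D u w Y\<close> is the covariant derivative at \<open>u\<close> of the section \<open>Y\<close> along the vector \<open>w\<close>
  tangent to the slit tangent bundle at \<open>u\<close>. It is set to \<open>0\<close> for all other arguments, so that a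
  connection is determined by its values on genuine tangent vectors and sections.\<close>

type_synonym ('i, 'p, 'e) pb_connection =
  "('i, 'p, 'e) tangent_point \<Rightarrow> ('i \<Rightarrow> 'e \<times> 'e) \<Rightarrow> ('i, 'p, 'e) pb_section \<Rightarrow> 'i \<Rightarrow> 'e"

definition cov_deriv :: "('i, 'p, 'e) pb_connection \<Rightarrow>
    (('i, 'p, 'e) tangent_point \<Rightarrow> 'i \<Rightarrow> 'e \<times> 'e) \<Rightarrow>
    ('i, 'p, 'e) pb_section \<Rightarrow> ('i, 'p, 'e) pb_section"
  where "cov_deriv D X Y = (\<lambda>u. D u (X u) Y)"

definition linear_connection ::
  "('i, 'p, 'e::euclidean_space) atlas \<Rightarrow> ('i, 'p, 'e) pb_connection \<Rightarrow> bool" where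
  "linear_connection A D \<longleftrightarrow>
     (\<forall>u w Y. \<not> (u \<in> points (slit_bundle A) \<and> w \<in> tangent_space (slit_bundle A) u \<and>
        Y \<in> pb_sections A) \<longrightarrow> D u w Y = 0) \<and>
     (\<forall>u\<in>points (slit_bundle A). \<forall>Y\<in>pb_sections A.
        \<forall>w\<in>tangent_space (slit_bundle A) u. \<forall>w'\<in>tangent_space (slit_bundle A) u. \<forall>a b.
        D u (a *\<^sub>R w + b *\<^sub>R w') Y = a *\<^sub>R D u w Y + b *\<^sub>R D u w' Y) \<and>
     (\<forall>u\<in>points (slit_bundle A). \<forall>w\<in>tangent_space (slit_bundle A) u.
        \<forall>Y\<in>pb_sections A. \<forall>Z\<in>pb_sections A. D u w (Y + Z) = D u w Y + D u w Z) \<and>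
     (\<forall>u\<in>points (slit_bundle A). \<forall>w\<in>tangent_space (slit_bundle A) u.
        \<forall>f. \<forall>Y\<in>pb_sections A. smooth_fun (slit_bundle A) f \<longrightarrow>
        D u w (\<lambda>u'. f u' *\<^sub>R Y u') =
          fun_deriv (slit_bundle A) f u w *\<^sub>R Y u + f u *\<^sub>R D u w Y) \<and>
     (\<forall>X\<in>vector_fields (slit_bundle A). \<forall>Y\<in>pb_sections A. cov_deriv D X Y \<in> pb_sections A)"

definition vertical_space :: "('i, 'p, 'e::euclidean_space) atlas \<Rightarrow>
    ('i, 'p, 'e) tangent_point \<Rightarrow> ('i \<Rightarrow> 'e \<times> 'e) set"
  where "vertical_space A u = {w \<in> tangent_space (slit_bundle A) u. rho A u w = 0}"

definition connection_map :: "('i, 'p, 'e::euclidean_space) atlas \<Rightarrow> ('i, 'p, 'e) pb_connection \<Rightarrow>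
    ('i, 'p, 'e) tangent_point \<Rightarrow> ('i \<Rightarrow> 'e \<times> 'e) \<Rightarrow> 'i \<Rightarrow> 'e"
  where "connection_map A D u w = D u w (eta A)"

definition horizontal_space :: "('i, 'p, 'e::euclidean_space) atlas \<Rightarrow> ('i, 'p, 'e) pb_connection \<Rightarrow>
    ('i, 'p, 'e) tangent_point \<Rightarrow> ('i \<Rightarrow> 'e \<times> 'e) set"
  where "horizontal_space A D u =
    {w \<in> tangent_space (slit_bundle A) u. connection_map A D u w = 0}"

definition regular_connection ::
  "('i, 'p, 'e::euclidean_space) atlas \<Rightarrow> ('i, 'p, 'e) pb_connection \<Rightarrow> bool" where
  "regular_connection A D \<longleftrightarrow> linear_connection A D \<and>
     (\<forall>u\<in>points (slit_bundle A).
        tangent_space (slit_bundle A) u =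
          {v + w | v w. v \<in> vertical_space A u \<and> w \<in> horizontal_space A D u} \<and>
        vertical_space A u \<inter> horizontal_space A D u = {0})"

definition beta :: "('i, 'p, 'e::euclidean_space) atlas \<Rightarrow> ('i, 'p, 'e) pb_connection \<Rightarrow>
    ('i, 'p, 'e) tangent_point \<Rightarrow> ('i \<Rightarrow> 'e) \<Rightarrow> 'i \<Rightarrow> 'e \<times> 'e"
  where "beta A D u = the_inv_into (horizontal_space A D u) (rho A u)"

definition horizontal_projector :: "('i, 'p, 'e::euclidean_space) atlas \<Rightarrow>
    ('i, 'p, 'e) pb_connection \<Rightarrow> ('i, 'p, 'e) tangent_point \<Rightarrow> ('i \<Rightarrow> 'e \<times> 'e) \<Rightarrow> 'i \<Rightarrow> 'e \<times> 'e"
  where "horizontal_projector A D u = beta A D u \<circ> rho A u"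

definition torsion :: "('i, 'p, 'e::euclidean_space) atlas \<Rightarrow> ('i, 'p, 'e) pb_connection \<Rightarrow>
    (('i, 'p, 'e) tangent_point \<Rightarrow> 'i \<Rightarrow> 'e \<times> 'e) \<Rightarrow>
    (('i, 'p, 'e) tangent_point \<Rightarrow> 'i \<Rightarrow> 'e \<times> 'e) \<Rightarrow> ('i, 'p, 'e) pb_section" where
  "torsion A D X Y =
     cov_deriv D X (on_sections A (rho A) Y) - cov_deriv D Y (on_sections A (rho A) X)
     - on_sections A (rho A) (lie_bracket (slit_bundle A) X Y)"

text \<open>The argument \<open>Z\<close> is a section of the pullback bundle, that is \<open>\<rho>\<close> of some vector field.
  Note the sign convention.\<close>

definition curvature :: "('i, 'p, 'e::euclidean_space) atlas \<Rightarrow> ('i, 'p, 'e) pb_connection \<Rightarrow>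
    (('i, 'p, 'e) tangent_point \<Rightarrow> 'i \<Rightarrow> 'e \<times> 'e) \<Rightarrow>
    (('i, 'p, 'e) tangent_point \<Rightarrow> 'i \<Rightarrow> 'e \<times> 'e) \<Rightarrow>
    ('i, 'p, 'e) pb_section \<Rightarrow> ('i, 'p, 'e) pb_section" where
  "curvature A D X Y Z =
     - cov_deriv D X (cov_deriv D Y Z) + cov_deriv D Y (cov_deriv D X Z)
     + cov_deriv D (lie_bracket (slit_bundle A) X Y) Z"

definition vhv_torsion :: "('i, 'p, 'e::euclidean_space) atlas \<Rightarrow> ('i, 'p, 'e) pb_connection \<Rightarrow>
    ('i, 'p, 'e) pb_section \<Rightarrow> ('i, 'p, 'e) pb_section \<Rightarrow> ('i, 'p, 'e) pb_section" where
  "vhv_torsion A D X Y =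
     curvature A D (on_sections A (beta A D) X) (on_sections A (gamma A) Y) (eta A)"

end

theory Submission
  imports Defs
begin

text \<open>
  In a chart the points of the slit tangent bundle are pairs \<open>(x, y)\<close> with \<open>y \<noteq> 0\<close>, and a linear
  connection on the pullback bundle reads \<open>D\<^bsub>(\<xi>,\<zeta>)\<^esub> Y = dY(\<xi>, \<zeta>) + Q(x, y)((\<xi>, \<zeta>), Y)\<close>. Testing the
  torsion on fields with constant coefficients shows that it vanishes if and only if
  \<open>Q((\<xi>, \<zeta>), \<eta>) = \<Gamma>(\<xi>, \<eta>)\<close> with \<open>\<Gamma>\<close> symmetric (\<open>torsion_zero\<close>, \<open>torsion_symmetry\<close>). Put
  \<open>N(\<xi>) = \<Gamma>(\<xi>, y)\<close>. The horizontal vectors are the pairs \<open>(\<xi>, - N(\<xi>))\<close>, so that a torsion-free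
  connection is regular. With \<open>E = L\<^sup>2 / 2\<close> condition (a) becomes \<open>E\<^sub>x(\<xi>) = E\<^sub>y(N(\<xi>))\<close>
  (\<open>fun_deriv_L_horizontal\<close>), and a computation of \<open>[\<beta>X, \<gamma>Y]\<close> turns condition (c) into
  \<open>\<partial>\<^sub>y N(\<xi>)(\<eta>) = \<Gamma>(\<xi>, \<eta>)\<close> (\<open>vhv_torsion_apply\<close>).

  Uniqueness in a chart (\<open>berwald_unique\<close>). Differentiate (a) along the fibre, antisymmetrize, and use that
  \<open>E\<close> is homogeneous of degree two. The vector \<open>S = N(y)\<close> then satisfies
  \<open>E\<^sub>y\<^sub>y(S, \<eta>) = E\<^sub>x\<^sub>y(y, \<eta>) - E\<^sub>x(\<eta>)\<close>. As \<open>E\<^sub>y\<^sub>y\<close> is positive definite, this Euler-Lagrange equation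
  determines \<open>S\<close>, and by symmetry of \<open>\<Gamma>\<close> the vertical derivative of \<open>S\<close> is \<open>2 N\<close>. Hence \<open>\<Gamma>\<close> is half the
  vertical Hessian of \<open>S\<close>.

  Existence in a chart. Conversely, let \<open>S\<close> be the solution of the Euler-Lagrange equation. It is smooth and
  homogeneous of degree two, and half its vertical Hessian satisfies (c) by Euler's identity and (a) by
  differentiating \<open>E\<^sub>y(S) = E\<^sub>x(y)\<close> along the fibre (\<open>horizontal_energy\<close>).

  Globally, existence needs that the coefficients \<open>\<Gamma>\<close> obtained in two charts are related by the
  transformation rule of Christoffel symbols. The equation for \<open>S\<close> shows that \<open>S\<close> transforms like a spray
  (\<open>spray_change\<close>), and two vertical derivatives of that rule give the rule for \<open>\<Gamma>\<close> (\<open>berwald_change\<close>).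
  Uniqueness needs that a connection, which acts on global sections only, has a coordinate
  expression at all. If \<open>\<phi>\<close> is a cutoff function on the base manifold with \<open>\<phi> = 1\<close> near the base point, then
  \<open>D\<^sub>w Y = D\<^sub>w(\<phi>\<^sup>2 Y)\<close>, and \<open>\<phi>\<^sup>2 Y = \<Sum>\<^sub>a (\<phi> Y\<^sup>a) (\<phi> e\<^sub>a)\<close> is a combination of global sections with global
  coefficient functions (\<open>local_expansion\<close>).
\<close>

section \<open>Smooth maps between Euclidean spaces\<close>

abbreviation FD :: "('a::real_normed_vector \<Rightarrow> 'b::real_normed_vector) \<Rightarrow> 'a \<Rightarrow> 'a \<Rightarrow> 'b"
  where "FD f x \<equiv> frechet_derivative f (at x)"

lemma FD_eqI: "(f has_derivative f') (at x) \<Longrightarrow> FD f x = f'"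
  using frechet_derivative_at by metis

lemma FD_works: "f differentiable at x \<Longrightarrow> (f has_derivative FD f x) (at x)"
  using frechet_derivative_works by blast

lemma FD_cong:
  assumes "open S" "x \<in> S" "\<And>y. y \<in> S \<Longrightarrow> f y = g y"
  shows "FD f x = FD g x"
proof -
  have "(f has_derivative f') (at x) \<longleftrightarrow> (g has_derivative f') (at x)" for f'
    using assms by (metis has_derivative_transform_within_open)
  then show ?thesis by (simp add: frechet_derivative_def)
qed

lemma differentiable_cong:
  assumes "open S" "x \<in> S" "\<And>y. y \<in> S \<Longrightarrow> f y = g y"
  shows "f differentiable at x \<longleftrightarrow> g differentiable at x"
  using assms unfolding differentiable_def by (metis has_derivative_transform_within_open)

lemma Ck_on_cong:
  assumes "open S" "\<And>y. y \<in> S \<Longrightarrow> f y = g y" "Ck_on k S f"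
  shows "Ck_on k S g"
  using assms(2,3)
proof (induction k arbitrary: f g)
  case 0
  then show ?case by (simp cong: continuous_on_cong)
next
  case (Suc k)
  have "g differentiable at x" if "x \<in> S" for x
    using Suc.prems that differentiable_cong[OF assms(1) that] by auto
  moreover have "Ck_on k S (\<lambda>x. FD g x v)" for v
  proof (rule Suc.IH)
    show "Ck_on k S (\<lambda>x. FD f x v)" using Suc.prems by simp
    show "FD f y v = FD g y v" if "y \<in> S" for y
      using FD_cong[OF assms(1) that Suc.prems(1)] by simp
  qed
  ultimately show ?case by simp
qed

lemma Ck_on_Suc_imp: "Ck_on (Suc k) S f \<Longrightarrow> Ck_on k S f"
proof (induction k arbitrary: f)
  case 0
  then show ?case
    by (auto intro!: continuous_at_imp_continuous_on differentiable_imp_continuous_within)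
qed auto

lemma Ck_on_subset: "Ck_on k S f \<Longrightarrow> T \<subseteq> S \<Longrightarrow> Ck_on k T f"
  by (induction k arbitrary: f) (auto intro: continuous_on_subset)

lemma Ck_on_local:
  assumes "\<And>x. x \<in> S \<Longrightarrow> \<exists>T. open T \<and> x \<in> T \<and> Ck_on k T f"
  shows "Ck_on k S f"
  using assms
proof (induction k arbitrary: f)
  case 0
  show ?case
  proof (simp, rule continuous_at_imp_continuous_on, rule ballI)
    fix x assume "x \<in> S"
    with 0 obtain T where "open T" "x \<in> T" "continuous_on T f" by auto
    then show "isCont f x" using continuous_on_eq_continuous_at by blast
  qed
next
  case (Suc k)
  have "f differentiable at x" if "x \<in> S" for x
    using Suc.prems[OF that] by auto
  moreover have "Ck_on k S (\<lambda>x. FD f x v)" for v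
    using Suc.prems by (intro Suc.IH) fastforce
  ultimately show ?case by simp
qed

lemma Ck_on_const: "Ck_on k S (\<lambda>x. c)"
  by (induction k arbitrary: c) auto

lemma Ck_on_bounded_linear_comp:
  assumes "bounded_linear L" "open S" "Ck_on k S f"
  shows "Ck_on k S (\<lambda>x. L (f x))"
  using assms(3)
proof (induction k arbitrary: f)
  case 0
  then show ?case using bounded_linear.continuous_on[OF assms(1)] by simp
next
  case (Suc k)
  have D: "((\<lambda>x. L (f x)) has_derivative (\<lambda>v. L (FD f x v))) (at x)" if "x \<in> S" for x
    using Suc.prems that by (intro bounded_linear.has_derivative[OF assms(1)] FD_works) auto
  have "Ck_on k S (\<lambda>x. FD (\<lambda>x. L (f x)) x v)" for v
    by (rule Ck_on_cong[OF assms(2), where f="\<lambda>x. L (FD f x v)"])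
       (use D Suc in \<open>auto simp: FD_eqI[OF D]\<close>)
  with D show ?case by (auto simp: differentiable_def)
qed

lemma Ck_on_id: "open S \<Longrightarrow> Ck_on k S (\<lambda>x. x)"
  by (cases k) (auto intro: Ck_on_const)

lemma Ck_on_add:
  assumes "open S" "Ck_on k S f" "Ck_on k S g"
  shows "Ck_on k S (\<lambda>x. f x + g x)"
  using assms(2,3)
proof (induction k arbitrary: f g)
  case 0
  then show ?case by (auto intro: continuous_on_add)
next
  case (Suc k)
  have D: "((\<lambda>x. f x + g x) has_derivative (\<lambda>v. FD f x v + FD g x v)) (at x)" if "x \<in> S" for x
    using Suc.prems that by (intro has_derivative_add FD_works) auto
  have "Ck_on k S (\<lambda>x. FD (\<lambda>x. f x + g x) x v)" for v
    by (rule Ck_on_cong[OF assms(1), where f="\<lambda>x. FD f x v + FD g x v"])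
       (use D Suc in \<open>auto simp: FD_eqI[OF D]\<close>)
  with D show ?case by (auto simp: differentiable_def)
qed

text \<open>By the product rule the derivative is a sum of two products of functions of class \<open>C\<^sup>k\<close>, so that the
  class is closed under products by induction.\<close>
lemma Ck_on_bilinear:
  assumes "bounded_bilinear B" "open S" "Ck_on k S f" "Ck_on k S g"
  shows "Ck_on k S (\<lambda>x. B (f x) (g x))"
  using assms(3,4)
proof (induction k arbitrary: f g)
  case 0
  then show ?case using bounded_bilinear.continuous_on[OF assms(1)] by auto
next
  case (Suc k)
  have D: "((\<lambda>x. B (f x) (g x)) has_derivative (\<lambda>v. B (f x) (FD g x v) + B (FD f x v) (g x))) (at x)"
    if "x \<in> S" for x
    using Suc.prems that by (intro bounded_bilinear.FDERIV[OF assms(1)] FD_works) auto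
  have fg: "Ck_on k S f" "Ck_on k S g"
    using Suc.prems Ck_on_Suc_imp by blast+
  have "Ck_on k S (\<lambda>x. FD (\<lambda>x. B (f x) (g x)) x v)" for v
    by (rule Ck_on_cong[OF assms(2), where f="\<lambda>x. B (f x) (FD g x v) + B (FD f x v) (g x)"])
       (use D Suc fg in \<open>auto simp: FD_eqI[OF D] intro!: Ck_on_add[OF assms(2)]\<close>)
  with D show ?case by (auto simp: differentiable_def)
qed

lemma Ck_on_sum:
  assumes "open S" "\<And>i. i \<in> I \<Longrightarrow> Ck_on k S (f i)"
  shows "Ck_on k S (\<lambda>x. \<Sum>i\<in>I. f i x)"
  using assms(2)
  by (induction I rule: infinite_finite_induct) (auto intro: Ck_on_const Ck_on_add[OF assms(1)])

lemma FD_basis_expand: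
  fixes f :: "'a::euclidean_space \<Rightarrow> 'b::real_normed_vector"
  assumes "f differentiable at x"
  shows "FD f x v = (\<Sum>b\<in>Basis. (v \<bullet> b) *\<^sub>R FD f x b)"
proof -
  interpret linear "FD f x" using assms linear_frechet_derivative by blast
  have "FD f x v = FD f x (\<Sum>b\<in>Basis. (v \<bullet> b) *\<^sub>R b)" by (simp add: euclidean_representation)
  then show ?thesis by (simp add: sum scale)
qed

text \<open>The chain rule contains derivatives of \<open>f\<close> in the moving direction \<open>g'(x) v\<close>. Expanding that direction in
  a basis leaves derivatives in constant directions, to which the induction hypothesis applies.\<close>
lemma Ck_on_compose:
  fixes f :: "'b::euclidean_space \<Rightarrow> 'c::real_normed_vector"
    and g :: "'a::euclidean_space \<Rightarrow> 'b"
  assumes "open S" "Ck_on k T f" "Ck_on k S g" "g ` S \<subseteq> T"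
  shows "Ck_on k S (\<lambda>x. f (g x))"
  using assms(2,3)
proof (induction k arbitrary: f)
  case 0
  then show ?case using assms(4) continuous_on_compose2 by fastforce
next
  case (Suc k)
  have D: "((\<lambda>x. f (g x)) has_derivative (\<lambda>v. FD f (g x) (FD g x v))) (at x)" if "x \<in> S" for x
  proof -
    have "g x \<in> T" using assms(4) that by blast
    then have "(g has_derivative FD g x) (at x)" "(f has_derivative FD f (g x)) (at (g x))"
      using Suc.prems that by (auto intro!: FD_works)
    from diff_chain_at[OF this] show ?thesis by (simp add: o_def)
  qed
  have E: "FD f (g x) (FD g x v) = (\<Sum>b\<in>Basis. (FD g x v \<bullet> b) *\<^sub>R FD f (g x) b)" if "x \<in> S" for x v
    by (rule FD_basis_expand) (use Suc.prems that assms(4) in \<open>auto simp: image_subset_iff\<close>)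
  have "Ck_on k S (\<lambda>x. FD (\<lambda>x. f (g x)) x v)" for v
  proof (rule Ck_on_cong[OF assms(1), where f="\<lambda>x. \<Sum>b\<in>Basis. (FD g x v \<bullet> b) *\<^sub>R FD f (g x) b"])
    show "(\<Sum>b\<in>Basis. (FD g x v \<bullet> b) *\<^sub>R FD f (g x) b) = FD (\<lambda>x. f (g x)) x v" if "x \<in> S" for x
      unfolding FD_eqI[OF D[OF that]] E[OF that] ..
    have "Ck_on k S (\<lambda>x. FD f (g x) b)" for b
      using Suc.prems Ck_on_Suc_imp[OF Suc.prems(2)] by (intro Suc.IH) auto
    then show "Ck_on k S (\<lambda>x. \<Sum>b\<in>Basis. (FD g x v \<bullet> b) *\<^sub>R FD f (g x) b)"
      using Suc.prems
      by (intro Ck_on_sum assms(1) Ck_on_bilinear[OF bounded_bilinear_scaleR]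
          Ck_on_bounded_linear_comp[OF bounded_linear_inner_left]) auto
  qed
  with D show ?case by (auto simp: differentiable_def)
qed

lemma smooth_onD: "smooth_on S f \<Longrightarrow> x \<in> S \<Longrightarrow> f differentiable at x"
  unfolding smooth_on_def by (metis Ck_on.simps(2))

lemma smooth_on_FD: "smooth_on S f \<Longrightarrow> smooth_on S (\<lambda>x. FD f x v)"
  unfolding smooth_on_def by (metis Ck_on.simps(2))

lemma smooth_on_has_derivative: "smooth_on S f \<Longrightarrow> x \<in> S \<Longrightarrow> (f has_derivative FD f x) (at x)"
  by (rule FD_works) (rule smooth_onD)

lemma smooth_on_continuous: "smooth_on S f \<Longrightarrow> continuous_on S f"
  unfolding smooth_on_def by (metis Ck_on.simps(1))

lemma smooth_on_cong:
  "open S \<Longrightarrow> (\<And>y. y \<in> S \<Longrightarrow> f y = g y) \<Longrightarrow> smooth_on S f \<Longrightarrow> smooth_on S g"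
  unfolding smooth_on_def using Ck_on_cong by blast

lemma smooth_on_subset: "smooth_on S f \<Longrightarrow> T \<subseteq> S \<Longrightarrow> smooth_on T f"
  unfolding smooth_on_def using Ck_on_subset by blast

lemma smooth_on_local:
  assumes "\<And>x. x \<in> S \<Longrightarrow> \<exists>T. open T \<and> x \<in> T \<and> smooth_on T f"
  shows "smooth_on S f"
  unfolding smooth_on_def by (intro allI Ck_on_local) (use assms smooth_on_def in metis)

lemma smooth_on_const [simp]: "smooth_on S (\<lambda>x. c)"
  by (simp add: smooth_on_def Ck_on_const)

lemma smooth_on_id [simp]: "open S \<Longrightarrow> smooth_on S (\<lambda>x. x)"
  by (simp add: smooth_on_def Ck_on_id)

lemma smooth_on_linear_comp:
  "bounded_linear L \<Longrightarrow> open S \<Longrightarrow> smooth_on S f \<Longrightarrow> smooth_on S (\<lambda>x. L (f x))"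
  by (simp add: smooth_on_def Ck_on_bounded_linear_comp)

lemma smooth_on_add:
  "open S \<Longrightarrow> smooth_on S f \<Longrightarrow> smooth_on S g \<Longrightarrow> smooth_on S (\<lambda>x. f x + g x)"
  by (simp add: smooth_on_def Ck_on_add)

lemma smooth_on_bilinear:
  "bounded_bilinear B \<Longrightarrow> open S \<Longrightarrow> smooth_on S f \<Longrightarrow> smooth_on S g \<Longrightarrow> smooth_on S (\<lambda>x. B (f x) (g x))"
  by (simp add: smooth_on_def Ck_on_bilinear)

lemmas smooth_on_scaleR = smooth_on_bilinear[OF bounded_bilinear_scaleR]
lemmas smooth_on_mult = smooth_on_bilinear[OF bounded_bilinear_mult]
lemmas smooth_on_inner = smooth_on_bilinear[OF bounded_bilinear_inner]
lemmas smooth_on_minus = smooth_on_linear_comp[OF bounded_linear_minus[OF bounded_linear_ident]]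
lemmas smooth_on_fst = smooth_on_linear_comp[OF bounded_linear_fst]
lemmas smooth_on_snd = smooth_on_linear_comp[OF bounded_linear_snd]

lemma smooth_on_diff:
  "open S \<Longrightarrow> smooth_on S f \<Longrightarrow> smooth_on S g \<Longrightarrow> smooth_on S (\<lambda>x. f x - g x)"
  using smooth_on_add[of S f "\<lambda>x. - g x"] smooth_on_minus[of S g] by simp

lemma smooth_on_sum:
  "open S \<Longrightarrow> (\<And>i. i \<in> I \<Longrightarrow> smooth_on S (f i)) \<Longrightarrow> smooth_on S (\<lambda>x. \<Sum>i\<in>I. f i x)"
  by (simp add: smooth_on_def Ck_on_sum)

lemma smooth_on_compose:
  fixes f :: "'b::euclidean_space \<Rightarrow> 'c::real_normed_vector"
    and g :: "'a::euclidean_space \<Rightarrow> 'b"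
  assumes "open S" "smooth_on T f" "smooth_on S g" "g ` S \<subseteq> T"
  shows "smooth_on S (\<lambda>x. f (g x))"
  using assms Ck_on_compose unfolding smooth_on_def by blast

lemma smooth_on_Pair:
  assumes "open S" "smooth_on S f" "smooth_on S g"
  shows "smooth_on S (\<lambda>x. (f x, g x))"
proof -
  have "bounded_linear (\<lambda>x. (x, 0))" "bounded_linear (\<lambda>x. (0, x))"
    by (auto intro: bounded_linear_Pair bounded_linear_ident bounded_linear_zero)
  then have "smooth_on S (\<lambda>x. (f x, 0) + (0, g x))"
    using assms by (intro smooth_on_add smooth_on_linear_comp[where L="\<lambda>x. (x, 0)"]
        smooth_on_linear_comp[where L="\<lambda>x. (0, x)"]) auto
  then show ?thesis by simp
qed

lemma smooth_on_FD_moving: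
  fixes f :: "'b::euclidean_space \<Rightarrow> 'c::real_normed_vector"
    and g :: "'a::euclidean_space \<Rightarrow> 'b"
  assumes "open S" "smooth_on T f" "smooth_on S g" "g ` S \<subseteq> T" "smooth_on S c"
  shows "smooth_on S (\<lambda>x. FD f (g x) (c x))"
proof (rule smooth_on_cong[OF assms(1)])
  show "(\<Sum>b\<in>Basis. (c x \<bullet> b) *\<^sub>R FD f (g x) b) = FD f (g x) (c x)" if "x \<in> S" for x
    using FD_basis_expand[of f "g x" "c x"] assms that smooth_onD by (metis image_subset_iff)
  have "smooth_on S (\<lambda>x. FD f (g x) b)" for b
    by (rule smooth_on_compose[OF assms(1) smooth_on_FD[OF assms(2)] assms(3,4)])
  then show "smooth_on S (\<lambda>x. \<Sum>b\<in>Basis. (c x \<bullet> b) *\<^sub>R FD f (g x) b)"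
    using assms by (intro smooth_on_sum smooth_on_scaleR smooth_on_inner) auto
qed

text \<open>Smoothness is a statement about derivatives in constant directions, whereas the formulas for
  connections differentiate in directions that depend on the point. This product rule is the basic tool of
  all coordinate computations below; the coefficient of the second derivative is frozen at \<open>z\<close>.\<close>
lemma has_derivative_FD_moving:
  fixes f :: "'b::euclidean_space \<Rightarrow> 'c::real_normed_vector"
    and \<phi> :: "'a::real_normed_vector \<Rightarrow> 'b"
  assumes "open T" "smooth_on T f" "\<phi> z \<in> T"
    and \<phi>: "(\<phi> has_derivative \<phi>') (at z)" and c: "(c has_derivative c') (at z)"
  shows "((\<lambda>x. FD f (\<phi> x) (c x)) has_derivative
    (\<lambda>w. FD (\<lambda>p. FD f p (c z)) (\<phi> z) (\<phi>' w) + FD f (\<phi> z) (c' w))) (at z)"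
proof -
  let ?G = "\<lambda>b. FD (\<lambda>p. FD f p b) (\<phi> z)"
  have b: "((\<lambda>x. FD f (\<phi> x) b) has_derivative (\<lambda>w. ?G b (\<phi>' w))) (at z)" for b
    using diff_chain_at[OF \<phi>, of "\<lambda>p. FD f p b" "?G b"]
      smooth_on_has_derivative[OF smooth_on_FD[OF assms(2)] assms(3)] by (simp add: o_def)
  have "FD (\<lambda>p. FD f p (c z)) (\<phi> z) = FD (\<lambda>p. \<Sum>b\<in>Basis. (c z \<bullet> b) *\<^sub>R FD f p b) (\<phi> z)"
    by (rule FD_cong[OF assms(1,3)]) (use FD_basis_expand assms smooth_onD in metis)
  also have "\<dots> = (\<lambda>w. \<Sum>b\<in>Basis. (c z \<bullet> b) *\<^sub>R ?G b w)"
    by (rule FD_eqI) (intro has_derivative_sum has_derivative_scaleR_right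
        smooth_on_has_derivative[OF smooth_on_FD[OF assms(2)] assms(3)])
  finally have 1: "?G (c z) = (\<lambda>w. \<Sum>b\<in>Basis. (c z \<bullet> b) *\<^sub>R ?G b w)" .
  have "((\<lambda>x. \<Sum>b\<in>Basis. (c x \<bullet> b) *\<^sub>R FD f (\<phi> x) b) has_derivative
     (\<lambda>w. \<Sum>b\<in>Basis. (c z \<bullet> b) *\<^sub>R ?G b (\<phi>' w) + (c' w \<bullet> b) *\<^sub>R FD f (\<phi> z) b)) (at z)"
    by (intro has_derivative_sum has_derivative_scaleR b has_derivative_inner_left c)
  also have "(\<lambda>w. \<Sum>b\<in>Basis. (c z \<bullet> b) *\<^sub>R ?G b (\<phi>' w) + (c' w \<bullet> b) *\<^sub>R FD f (\<phi> z) b) =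
     (\<lambda>w. ?G (c z) (\<phi>' w) + FD f (\<phi> z) (c' w))"
    unfolding 1 sum.distrib
    using FD_basis_expand[OF smooth_onD[OF assms(2,3)], symmetric] by simp
  finally have 2: "((\<lambda>x. \<Sum>b\<in>Basis. (c x \<bullet> b) *\<^sub>R FD f (\<phi> x) b) has_derivative
     (\<lambda>w. ?G (c z) (\<phi>' w) + FD f (\<phi> z) (c' w))) (at z)" .
  have "isCont \<phi> z" using \<phi> has_derivative_continuous by blast
  then have "\<forall>\<^sub>F x in nhds z. \<phi> x \<in> T"
    using assms(1,3) by (simp add: continuous_at_open eventually_nhds)
  then obtain U where U: "open U" "z \<in> U" "\<forall>x\<in>U. \<phi> x \<in> T"
    unfolding eventually_nhds by blast
  show ?thesis
    by (rule has_derivative_transform_within_open[OF 2 U(1,2)])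
       (use U(3) FD_basis_expand assms(2) smooth_onD in metis)
qed

text \<open>Two applications of the mean value theorem, first along \<open>v\<close> and then along \<open>w\<close>. The second
  difference is symmetric in \<open>v\<close> and \<open>w\<close>, which gives the theorem of Schwarz in the limit \<open>h \<rightarrow> 0\<close>.\<close>
lemma mixed_difference_eq:
  fixes f :: "'a::euclidean_space \<Rightarrow> real"
  assumes "smooth_on S f" "h > 0"
    and sq: "\<forall>s\<in>{0..h}. \<forall>t\<in>{0..h}. x + s *\<^sub>R v + t *\<^sub>R w \<in> S"
  shows "\<exists>s t. 0 < s \<and> s < h \<and> 0 < t \<and> t < h \<and>
    f (x + h *\<^sub>R v + h *\<^sub>R w) - f (x + h *\<^sub>R v) - f (x + h *\<^sub>R w) + f x =
      h * h * FD (\<lambda>p. FD f p v) (x + s *\<^sub>R v + t *\<^sub>R w) w"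
proof -
  have lin: "FD g p (r *\<^sub>R u) = r * FD g p u" if "smooth_on S g" "p \<in> S" for g :: "'a \<Rightarrow> real" and p r u
    using linear_frechet_derivative[OF smooth_onD[OF that]] by (simp add: linear_scale)
  have D: "((\<lambda>s. g (p s)) has_real_derivative FD g (p s) u) (at s)"
    if "smooth_on S g" "p s \<in> S" "(p has_derivative (\<lambda>r. r *\<^sub>R u)) (at s)"
    for g :: "'a \<Rightarrow> real" and p s u
    using diff_chain_at[OF that(3) smooth_on_has_derivative[OF that(1,2)]] lin[OF that(1,2)]
    by (simp add: has_field_derivative_def o_def mult_commute_abs)
  have line1: "((\<lambda>s. x + s *\<^sub>R v + t *\<^sub>R w) has_derivative (\<lambda>r. r *\<^sub>R v)) (at s)" for s t
    by (auto intro!: derivative_eq_intros)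
  have line2: "((\<lambda>t. x + s *\<^sub>R v + t *\<^sub>R w) has_derivative (\<lambda>r. r *\<^sub>R w)) (at t)" for s t
    by (auto intro!: derivative_eq_intros)
  let ?\<phi> = "\<lambda>s. f (x + s *\<^sub>R v + h *\<^sub>R w) - f (x + s *\<^sub>R v + 0 *\<^sub>R w)"
  have d1: "(?\<phi> has_real_derivative FD f (x + s *\<^sub>R v + h *\<^sub>R w) v - FD f (x + s *\<^sub>R v + 0 *\<^sub>R w) v) (at s)"
    if "0 \<le> s" "s \<le> h" for s
    using that \<open>h > 0\<close> by (intro DERIV_diff D[OF assms(1) _ line1] bspec[OF bspec[OF sq]]) auto
  have "\<exists>s>0. s < h \<and> ?\<phi> h - ?\<phi> 0 =
      (h - 0) * (FD f (x + s *\<^sub>R v + h *\<^sub>R w) v - FD f (x + s *\<^sub>R v + 0 *\<^sub>R w) v)"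
    by (rule MVT2[OF \<open>h > 0\<close>]) (rule d1)
  then obtain s where s: "0 < s" "s < h" and 1: "?\<phi> h - ?\<phi> 0 =
      (h - 0) * (FD f (x + s *\<^sub>R v + h *\<^sub>R w) v - FD f (x + s *\<^sub>R v + 0 *\<^sub>R w) v)"
    by (elim exE conjE) (rule that)
  have d2: "((\<lambda>t. FD f (x + s *\<^sub>R v + t *\<^sub>R w) v) has_real_derivative
      FD (\<lambda>p. FD f p v) (x + s *\<^sub>R v + t *\<^sub>R w) w) (at t)"
    if "0 \<le> t" "t \<le> h" for t
    using s that by (intro D[OF smooth_on_FD[OF assms(1)] _ line2] bspec[OF bspec[OF sq]]) auto
  have "\<exists>t>0. t < h \<and> FD f (x + s *\<^sub>R v + h *\<^sub>R w) v - FD f (x + s *\<^sub>R v + 0 *\<^sub>R w) v =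
      (h - 0) * FD (\<lambda>p. FD f p v) (x + s *\<^sub>R v + t *\<^sub>R w) w"
    by (rule MVT2[OF \<open>h > 0\<close>]) (rule d2)
  then obtain t where t: "0 < t" "t < h" and 2: "FD f (x + s *\<^sub>R v + h *\<^sub>R w) v - FD f (x + s *\<^sub>R v + 0 *\<^sub>R w) v =
      (h - 0) * FD (\<lambda>p. FD f p v) (x + s *\<^sub>R v + t *\<^sub>R w) w"
    by (elim exE conjE) (rule that)
  have "f (x + h *\<^sub>R v + h *\<^sub>R w) - f (x + h *\<^sub>R v) - f (x + h *\<^sub>R w) + f x =
      h * h * FD (\<lambda>p. FD f p v) (x + s *\<^sub>R v + t *\<^sub>R w) w"
    using 1[unfolded 2] by simp
  with s t show ?thesis by blast
qed

lemma FD_FD_commute_real: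
  fixes f :: "'a::euclidean_space \<Rightarrow> real"
  assumes "open S" "smooth_on S f" "x \<in> S"
  shows "FD (\<lambda>p. FD f p v) x w = FD (\<lambda>p. FD f p w) x v"
proof (rule ccontr)
  let ?A = "\<lambda>p. FD (\<lambda>p. FD f p v) p w" and ?B = "\<lambda>p. FD (\<lambda>p. FD f p w) p v"
  assume ne: "?A x \<noteq> ?B x"
  define e where "e = \<bar>?A x - ?B x\<bar> / 2"
  have "e > 0" using ne by (simp add: e_def)
  have "isCont ?A x" "isCont ?B x"
    using assms smooth_on_continuous[OF smooth_on_FD[OF smooth_on_FD[OF assms(2)]]]
    by (auto simp: continuous_on_eq_continuous_at)
  then obtain d1 d2 where d1: "d1 > 0" "\<And>p. dist p x < d1 \<Longrightarrow> dist (?A p) (?A x) < e"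
    and d2: "d2 > 0" "\<And>p. dist p x < d2 \<Longrightarrow> dist (?B p) (?B x) < e"
    using \<open>e > 0\<close> unfolding continuous_at_eps_delta by (metis dist_norm)
  obtain d3 where d3: "d3 > 0" "ball x d3 \<subseteq> S" using assms openE by blast
  define d where "d = min d1 (min d2 d3)"
  define q where "q = norm v + norm w + 1"
  define h where "h = d / q / 2"
  have d: "d > 0" using d1 d2 d3 by (simp add: d_def)
  have q: "q > 0" by (simp add: q_def add_nonneg_pos)
  have h: "h > 0" using d q by (simp add: h_def)
  have near: "dist (x + s *\<^sub>R v + t *\<^sub>R w) x < d" if "0 \<le> s" "s \<le> h" "0 \<le> t" "t \<le> h" for s t
  proof -
    have "dist (x + s *\<^sub>R v + t *\<^sub>R w) x \<le> s * norm v + t * norm w"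
      using that norm_triangle_ineq[of "s *\<^sub>R v" "t *\<^sub>R w"] by (simp add: dist_norm add.assoc)
    also have "\<dots> \<le> h * norm v + h * norm w"
      using that by (intro add_mono mult_right_mono) auto
    also have "\<dots> \<le> h * q" using h by (simp add: algebra_simps q_def)
    also have "\<dots> = d / 2" using q by (simp add: h_def)
    also have "\<dots> < d" using d by simp
    finally show ?thesis .
  qed
  then have sq: "\<forall>s\<in>{0..h}. \<forall>t\<in>{0..h}. x + s *\<^sub>R v + t *\<^sub>R w \<in> S"
    using d3 by (force simp: d_def dist_commute)
  from mixed_difference_eq[OF assms(2) h sq]
  obtain s t where st: "0 < s" "s < h" "0 < t" "t < h"
    and 1: "f (x + h *\<^sub>R v + h *\<^sub>R w) - f (x + h *\<^sub>R v) - f (x + h *\<^sub>R w) + f x =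
      h * h * ?A (x + s *\<^sub>R v + t *\<^sub>R w)"
    by (elim exE conjE) (rule that)
  have "x + s *\<^sub>R w + t *\<^sub>R v = x + t *\<^sub>R v + s *\<^sub>R w" for s t
    by (simp only: add_ac)
  with sq have sq': "\<forall>s\<in>{0..h}. \<forall>t\<in>{0..h}. x + s *\<^sub>R w + t *\<^sub>R v \<in> S"
    by metis
  from mixed_difference_eq[OF assms(2) h sq']
  obtain s' t' where st': "0 < s'" "s' < h" "0 < t'" "t' < h"
    and 2: "f (x + h *\<^sub>R w + h *\<^sub>R v) - f (x + h *\<^sub>R w) - f (x + h *\<^sub>R v) + f x =
      h * h * ?B (x + s' *\<^sub>R w + t' *\<^sub>R v)"
    by (elim exE conjE) (rule that)
  have eq: "x + h *\<^sub>R w + h *\<^sub>R v = x + h *\<^sub>R v + h *\<^sub>R w"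
    "x + s' *\<^sub>R w + t' *\<^sub>R v = x + t' *\<^sub>R v + s' *\<^sub>R w" by (simp_all add: add_ac)
  have "h * h * ?A (x + s *\<^sub>R v + t *\<^sub>R w) = h * h * ?B (x + t' *\<^sub>R v + s' *\<^sub>R w)"
    using 1 2 unfolding eq by linarith
  then have AB: "?A (x + s *\<^sub>R v + t *\<^sub>R w) = ?B (x + t' *\<^sub>R v + s' *\<^sub>R w)"
    using h by (metis mult_eq_0_iff mult_left_cancel less_irrefl)
  have "dist (x + s *\<^sub>R v + t *\<^sub>R w) x < d1" "dist (x + t' *\<^sub>R v + s' *\<^sub>R w) x < d2"
    using near[of s t] near[of t' s'] st st' unfolding d_def by linarith+
  from d1(2)[OF this(1)] d2(2)[OF this(2)]
  have "\<bar>?A x - ?B x\<bar> < e + e" unfolding AB dist_real_def by linarith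
  then show False by (simp add: e_def)
qed

lemma FD_FD_commute:
  fixes f :: "'a::euclidean_space \<Rightarrow> 'b::euclidean_space"
  assumes "open S" "smooth_on S f" "x \<in> S"
  shows "FD (\<lambda>p. FD f p v) x w = FD (\<lambda>p. FD f p w) x v"
proof (rule euclidean_eqI)
  fix b :: 'b
  have 1: "FD (\<lambda>p. g p \<bullet> b) p = (\<lambda>w. FD g p w \<bullet> b)" if "smooth_on S g" "p \<in> S" for p and g :: "'a \<Rightarrow> 'b"
    by (rule FD_eqI) (intro has_derivative_inner_left smooth_on_has_derivative[OF that])
  have 2: "FD (\<lambda>p. FD (\<lambda>p. f p \<bullet> b) p v) x w = FD (\<lambda>p. FD f p v) x w \<bullet> b" for v w
  proof -
    have "FD (\<lambda>p. FD (\<lambda>p. f p \<bullet> b) p v) x = FD (\<lambda>p. FD f p v \<bullet> b) x"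
      by (rule FD_cong[OF assms(1,3)]) (simp add: 1[OF assms(2)])
    then show ?thesis unfolding 1[OF smooth_on_FD[OF assms(2)] assms(3)] by simp
  qed
  have "smooth_on S (\<lambda>p. f p \<bullet> b)" using assms by (intro smooth_on_inner) auto
  from FD_FD_commute_real[OF assms(1) this assms(3), of v w]
  show "FD (\<lambda>p. FD f p v) x w \<bullet> b = FD (\<lambda>p. FD f p w) x v \<bullet> b" by (simp add: 2)
qed

section \<open>Bump functions\<close>

text \<open>The family of all \<open>t\<^bsup>-n\<^esup> exp(-1/t)\<close>, extended by zero, is closed under differentiation up to linear
  combinations. Smoothness of its members is therefore a single induction.\<close>
definition flat :: "nat \<Rightarrow> real \<Rightarrow> real"
  where "flat n t = (if t > 0 then inverse t ^ n * exp (- inverse t) else 0)"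

text \<open>The term of order \<open>n + 2\<close> of the exponential series bounds \<open>exp(1/t)\<close> from below. The order is chosen
  such that the difference quotient at \<open>0\<close> still tends to zero.\<close>
lemma flat_bound: "\<bar>flat n t\<bar> \<le> fact (n + 2) * t\<^sup>2"
proof (cases "t > 0")
  case True
  let ?m = "n + 2" and ?x = "inverse t"
  have "?x ^ ?m / fact ?m \<le> exp ?x"
    using sum_le_suminf[OF summable_exp_generic[of ?x], of "{?m}"] True
    by (simp add: exp_def divide_inverse mult.commute)
  then have "?x ^ ?m \<le> fact ?m * exp ?x"
    by (simp only: pos_divide_le_eq fact_gt_zero mult.commute)
  from mult_right_mono[OF this, of "exp (- ?x)"]
  have "?x ^ ?m * exp (- ?x) \<le> fact ?m * (exp ?x * exp (- ?x))"
    by (simp only: mult.assoc exp_ge_zero simp_thms)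
  then have "?x ^ ?m * exp (- ?x) \<le> fact ?m"
    by (simp only: exp_minus_inverse mult_1_right)
  then have "?x ^ ?m * exp (- ?x) * t\<^sup>2 \<le> fact ?m * t\<^sup>2"
    by (rule mult_right_mono) simp
  moreover have "?x ^ ?m * t\<^sup>2 = ?x ^ n"
    using True by (simp add: power_add power2_eq_square field_simps)
  ultimately have "?x ^ n * exp (- ?x) \<le> fact ?m * t\<^sup>2"
    by (metis mult.assoc mult.commute)
  then show ?thesis
    using True by (simp only: flat_def if_True abs_mult power_abs abs_inverse abs_of_pos abs_exp_cancel)
qed (simp add: flat_def)

lemma flat_has_derivative:
  "(flat n has_real_derivative flat (n + 2) t - real n * flat (n + 1) t) (at t)"
proof (cases t "0::real" rule: linorder_cases)
  case less
  have "((\<lambda>t. 0) has_real_derivative 0) (at t)" by simp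
  then have "(flat n has_real_derivative 0) (at t)"
    by (rule DERIV_cong_ev[THEN iffD1, rotated -1])
       (use less eventually_nhds_in_open[of "{..<0}" t] in \<open>auto elim!: eventually_mono simp: flat_def\<close>)
  then show ?thesis using less by (simp add: flat_def)
next
  case greater
  have p: "real n * inverse t ^ (n - Suc 0) * inverse t = real n * inverse t ^ n"
    by (cases n) auto
  have "((\<lambda>t. inverse t ^ n * exp (- inverse t)) has_real_derivative
     inverse t ^ n * (exp (- inverse t) * (inverse t * inverse t)) -
     real n * inverse t ^ (n - Suc 0) * inverse t * inverse t * exp (- inverse t)) (at t)"
    using greater by (auto intro!: derivative_eq_intros simp: algebra_simps)
  then have "((\<lambda>t. inverse t ^ n * exp (- inverse t)) has_real_derivative
     flat (n + 2) t - real n * flat (n + 1) t) (at t)"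
    unfolding p using greater by (simp add: flat_def algebra_simps)
  then show ?thesis
    by (rule DERIV_cong_ev[THEN iffD1, rotated -1])
       (use greater eventually_nhds_in_open[of "{0<..}" t] in \<open>auto elim!: eventually_mono simp: flat_def\<close>)
next
  case equal
  have lim: "((\<lambda>h. fact (n + 2) * \<bar>h\<bar>) \<longlongrightarrow> 0) (at (0::real))"
    by (auto intro!: tendsto_eq_intros)
  have "norm (flat n h / h) \<le> fact (n + 2) * \<bar>h\<bar>" for h
  proof (cases "h = 0")
    case False
    have "\<bar>flat n h\<bar> \<le> fact (n + 2) * \<bar>h\<bar> * \<bar>h\<bar>"
      using flat_bound[of n h] by (simp only: power2_eq_square abs_mult_self_eq mult.assoc)
    moreover have "\<bar>h\<bar> > 0" using False by simp
    ultimately show ?thesis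
      unfolding real_norm_def abs_divide by (metis pos_divide_le_eq)
  qed simp
  then have "((\<lambda>h. flat n h / h) \<longlongrightarrow> 0) (at 0)"
    by (intro Lim_null_comparison[OF always_eventually lim] allI)
  then show ?thesis using equal by (simp add: DERIV_def flat_def)
qed

lemma Ck_on_flat: "Ck_on k UNIV (flat n)"
proof (induction k arbitrary: n)
  case 0
  have "isCont (flat n) t" for t using flat_has_derivative DERIV_isCont by blast
  then show ?case by (simp add: continuous_at_imp_continuous_on)
next
  case (Suc k)
  have D: "(flat n has_derivative (\<lambda>v. (flat (n + 2) t - real n * flat (n + 1) t) * v)) (at t)" for t
    using flat_has_derivative[of n t] unfolding has_field_derivative_def by simp
  have "Ck_on k UNIV (\<lambda>t. flat (n + 2) t + - (real n * flat (n + 1) t))"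
    using Suc by (intro Ck_on_add Ck_on_bilinear[OF bounded_bilinear_mult] Ck_on_const
        Ck_on_bounded_linear_comp[OF bounded_linear_minus[OF bounded_linear_ident]]) auto
  then have "Ck_on k UNIV (\<lambda>t. FD (flat n) t v)" for v
    unfolding FD_eqI[OF D] by (intro Ck_on_bilinear[OF bounded_bilinear_mult] Ck_on_const) auto
  with D show ?case by (auto simp: differentiable_def)
qed

lemma smooth_on_flat: "smooth_on UNIV (flat n)"
  by (simp add: smooth_on_def Ck_on_flat)

lemma smooth_on_inverse: "smooth_on (- {0}) (inverse :: real \<Rightarrow> real)"
proof -
  have "Ck_on k (- {0}) (inverse :: real \<Rightarrow> real)" for k
  proof (induction k)
    case 0
    show ?case by (auto intro!: continuous_intros)
  next
    case (Suc k)
    have D: "(inverse has_derivative (\<lambda>v. - (inverse x * v * inverse x))) (at x)" if "x \<in> - {0}" for x :: real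
      using that by (intro has_derivative_inverse') auto
    have "Ck_on k (- {0}) (\<lambda>x::real. - (inverse x * v * inverse x))" for v
      using Suc by (intro Ck_on_bilinear[OF bounded_bilinear_mult] Ck_on_const
        Ck_on_bounded_linear_comp[OF bounded_linear_minus[OF bounded_linear_ident]]) auto
    then have "Ck_on k (- {0}) (\<lambda>x::real. FD inverse x v)" for v
      by (rule Ck_on_cong[rotated -1]) (auto simp: FD_eqI[OF D])
    with D show ?case by (auto simp: differentiable_def)
  qed
  then show ?thesis by (simp add: smooth_on_def)
qed

lemma exists_bump:
  fixes x0 :: "'a::euclidean_space"
  assumes "r > 0"
  obtains \<phi> :: "'a \<Rightarrow> real" where "smooth_on UNIV \<phi>" "\<And>x. x \<in> ball x0 r \<Longrightarrow> \<phi> x = 1"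
    "\<And>x. x \<notin> cball x0 (2 * r) \<Longrightarrow> \<phi> x = 0"
proof
  define a where "a x = (x - x0) \<bullet> (x - x0)" for x :: 'a
  have a: "a x = (dist x0 x)\<^sup>2" for x
    by (simp add: a_def dist_norm norm_minus_commute[of x0] power2_norm_eq_inner)
  define p where "p x = flat 0 ((2 * r)\<^sup>2 - a x)" for x
  define q where "q x = flat 0 (a x - r\<^sup>2)" for x
  \<comment> \<open>the two functions have no common zero, since \<open>r < 2 r\<close>\<close>
  define \<phi> where "\<phi> x = p x * inverse (p x + q x)" for x
  have pos: "p x + q x > 0" for x
  proof -
    have "r\<^sup>2 < (2 * r)\<^sup>2" using assms by (simp add: power2_eq_square)
    then have "a x < (2 * r)\<^sup>2 \<or> r\<^sup>2 < a x" by linarith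
    then show ?thesis unfolding p_def q_def flat_def by (auto intro: add_pos_nonneg add_nonneg_pos)
  qed
  have sa: "smooth_on UNIV a" unfolding a_def
    by (intro smooth_on_inner smooth_on_diff) auto
  have sp: "smooth_on UNIV p" unfolding p_def using sa
    by (intro smooth_on_compose[OF _ smooth_on_flat] smooth_on_diff) auto
  have sq: "smooth_on UNIV q" unfolding q_def using sa
    by (intro smooth_on_compose[OF _ smooth_on_flat] smooth_on_diff) auto
  have "smooth_on UNIV (\<lambda>x. inverse (p x + q x))"
    by (rule smooth_on_compose[OF _ smooth_on_inverse])
       (use sp sq pos in \<open>auto intro!: smooth_on_add simp: less_imp_neq[THEN not_sym]\<close>)
  with sp show "smooth_on UNIV \<phi>" unfolding \<phi>_def by (intro smooth_on_mult) auto
  show "\<phi> x = 1" if "x \<in> ball x0 r" for x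
  proof -
    have "a x < r\<^sup>2" using that assms unfolding a by (auto intro: power_strict_mono)
    then have "q x = 0" by (simp add: q_def flat_def)
    with pos[of x] show ?thesis by (simp add: \<phi>_def)
  qed
  show "\<phi> x = 0" if "x \<notin> cball x0 (2 * r)" for x
  proof -
    have "a x > (2 * r)\<^sup>2" using that assms unfolding a by (intro power_strict_mono) auto
    then show ?thesis by (simp add: \<phi>_def p_def flat_def)
  qed
qed

section \<open>Linear systems with smooth coefficients\<close>

text \<open>Continuity of the scalar factor suffices, because both factors vanish at \<open>z\<close>. In the next lemmas this
  removes the error term of a solution that is so far only known to be continuous.\<close>
lemma has_derivative_null_product:
  fixes c :: "'a::real_normed_vector \<Rightarrow> real" and d :: "'a \<Rightarrow> 'b::real_normed_vector"
  assumes "isCont c z" "c z = 0" "(d has_derivative d') (at z)" "d z = 0"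
  shows "((\<lambda>x. c x *\<^sub>R d x) has_derivative (\<lambda>v. 0)) (at z)"
  unfolding has_derivative_at_alt
proof (intro conjI allI impI)
  show "bounded_linear (\<lambda>v::'a. 0::'b)" by simp
  fix e :: real assume "e > 0"
  have "bounded_linear d'" using assms(3) has_derivative_bounded_linear by blast
  then obtain K where K: "K > 0" "\<And>h. norm (d' h) \<le> norm h * K"
    using bounded_linear.pos_bounded by blast
  obtain \<delta>1 where \<delta>1: "\<delta>1 > 0"
    "\<And>y. norm (y - z) < \<delta>1 \<Longrightarrow> norm (d y - d z - d' (y - z)) \<le> 1 * norm (y - z)"
    using assms(3) unfolding has_derivative_at_alt by (metis zero_less_one)
  obtain \<delta>2 where \<delta>2: "\<delta>2 > 0" "\<And>y. dist y z < \<delta>2 \<Longrightarrow> dist (c y) (c z) < e / (K + 1)"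
    using assms(1) K \<open>e > 0\<close> unfolding continuous_at_eps_delta
    by (metis add_pos_pos divide_pos_pos zero_less_one)
  have "norm (c y *\<^sub>R d y - c z *\<^sub>R d z - 0) \<le> e * norm (y - z)" if "norm (y - z) < min \<delta>1 \<delta>2" for y
  proof -
    have "norm (d y) \<le> norm (d y - d z - d' (y - z)) + norm (d' (y - z))"
      using norm_triangle_ineq[of "d y - d z - d' (y - z)" "d' (y - z)"] assms(4) by simp
    also have "\<dots> \<le> norm (y - z) * (K + 1)"
      using \<delta>1(2)[of y] K(2)[of "y - z"] that by (simp add: algebra_simps)
    finally have "norm (d y) \<le> norm (y - z) * (K + 1)" .
    moreover have "\<bar>c y\<bar> \<le> e / (K + 1)"
      using \<delta>2(2)[of y] that assms(2) by (simp add: dist_norm)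
    ultimately have "\<bar>c y\<bar> * norm (d y) \<le> e / (K + 1) * (norm (y - z) * (K + 1))"
      using K \<open>e > 0\<close> by (intro mult_mono) auto
    then show ?thesis using K(1) assms(2,4) by simp
  qed
  then show "\<exists>d'>0. \<forall>y. norm (y - z) < d' \<longrightarrow> norm (c y *\<^sub>R d y - c z *\<^sub>R d z - 0) \<le> e * norm (y - z)"
    using \<delta>1(1) \<delta>2(1) by (intro exI[of _ "min \<delta>1 \<delta>2"]) auto
qed

text \<open>The spray of a Finsler structure is the solution of a linear system whose matrix is the fibre Hessian.
  The system has the same number of equations and unknowns, and injectivity makes it uniquely solvable.\<close>
locale linear_system =
  fixes \<Omega> :: "'z::euclidean_space set" and A :: "'z \<Rightarrow> 'e::euclidean_space \<Rightarrow> 'e"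
  assumes open_\<Omega>: "open \<Omega>" and lin: "\<And>z. z \<in> \<Omega> \<Longrightarrow> linear (A z)"
    and inj: "\<And>z. z \<in> \<Omega> \<Longrightarrow> inj (A z)" and smooth: "\<And>v. smooth_on \<Omega> (\<lambda>z. A z v)"
begin

lemma expand: "z \<in> \<Omega> \<Longrightarrow> A z v = (\<Sum>b\<in>Basis. (v \<bullet> b) *\<^sub>R A z b)"
proof -
  assume "z \<in> \<Omega>"
  then interpret linear "A z" by (rule lin)
  have "A z v = A z (\<Sum>b\<in>Basis. (v \<bullet> b) *\<^sub>R b)" by (simp add: euclidean_representation)
  then show ?thesis by (simp add: sum scale)
qed

text \<open>The matrix at \<open>z0\<close> is bounded below, hence so are the matrices nearby, with half the constant.\<close>
lemma isCont_solution:
  assumes "z0 \<in> \<Omega>" "isCont b z0" and s: "\<And>z. z \<in> \<Omega> \<Longrightarrow> A z (s z) = b z"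
  shows "isCont s z0"
proof -
  obtain m where m: "m > 0" "\<And>v. m * norm v \<le> norm (A z0 v)"
    using linear_inj_bounded_below_pos[OF lin inj] assms(1) by (metis mult.commute)
  define r where "r z = b z - A z (s z0)" for z
  define \<eta> where "\<eta> z = (\<Sum>c\<in>Basis. norm (A z c - A z0 c))" for z
  have cA: "isCont (\<lambda>z. A z v) z0" for v
    using smooth_on_continuous[OF smooth] open_\<Omega> assms(1) by (simp add: continuous_on_eq_continuous_at)
  have "isCont \<eta> z0" unfolding \<eta>_def using cA by (intro continuous_intros) auto
  then have "(\<eta> \<longlongrightarrow> \<eta> z0) (at z0)" by (simp add: isCont_def)
  then have ev1: "\<forall>\<^sub>F z in at z0. \<eta> z < m / 2"
    by (rule order_tendstoD(2)) (use m in \<open>simp add: \<eta>_def\<close>)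
  have ev2: "\<forall>\<^sub>F z in at z0. z \<in> \<Omega>"
    using open_\<Omega> assms(1) eventually_at_in_open' by blast
  have "isCont r z0" unfolding r_def using cA assms(2) by (intro continuous_intros)
  then have r: "(r \<longlongrightarrow> 0) (at z0)"
    using s[OF assms(1)] by (simp add: isCont_def r_def)
  have "\<forall>\<^sub>F z in at z0. norm (s z - s z0) \<le> 2 / m * norm (r z)"
    using ev1 ev2
  proof eventually_elim
    case (elim z)
    interpret z: linear "A z" using elim lin by blast
    interpret z0: linear "A z0" using assms(1) lin by blast
    let ?d = "s z - s z0"
    have "A z0 ?d = r z - (A z ?d - A z0 ?d)"
      using s[OF elim(2)] by (simp add: r_def z.diff)
    moreover have "norm (A z ?d - A z0 ?d) \<le> \<eta> z * norm ?d"
    proof -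
      have "A z ?d - A z0 ?d = (\<Sum>c\<in>Basis. (?d \<bullet> c) *\<^sub>R (A z c - A z0 c))"
        using expand[OF elim(2), of ?d] expand[OF assms(1), of ?d]
        by (simp add: sum_subtractf scaleR_diff_right)
      also have "norm \<dots> \<le> (\<Sum>c\<in>Basis. norm ?d * norm (A z c - A z0 c))"
        by (intro sum_norm_le) (auto intro!: mult_right_mono Basis_le_norm)
      finally show ?thesis by (simp add: \<eta>_def sum_distrib_left mult.commute)
    qed
    ultimately have "m * norm ?d \<le> norm (r z) + \<eta> z * norm ?d"
      using m(2)[of ?d] norm_triangle_ineq4[of "r z" "A z ?d - A z0 ?d"] by simp
    moreover have "\<eta> z * norm ?d \<le> m / 2 * norm ?d"
      using elim(1) by (intro mult_right_mono) auto
    ultimately have "m / 2 * norm ?d \<le> norm (r z)" by simp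
    then show ?case using m(1) by (simp add: field_simps)
  qed
  then have "((\<lambda>z. s z - s z0) \<longlongrightarrow> 0) (at z0)"
    by (rule Lim_null_comparison) (use m(1) in \<open>auto intro!: tendsto_eq_intros r\<close>)
  then show ?thesis by (simp add: isCont_def LIM_zero_iff)
qed

text \<open>If \<open>B\<close> is the inverse of \<open>A z0\<close>, then
  \<open>s z - s z0 = B (b z - A z (s z0)) - B ((A z - A z0) (s z - s z0))\<close>. The first term is differentiable, and
  the second has derivative zero at \<open>z0\<close> because \<open>s\<close> is continuous there.\<close>
lemma differentiable_solution:
  assumes "z0 \<in> \<Omega>" "b differentiable at z0" and s: "\<And>z. z \<in> \<Omega> \<Longrightarrow> A z (s z) = b z"
  shows "s differentiable at z0"
    "A z0 (FD s z0 w) = FD b z0 w - (\<Sum>c\<in>Basis. (s z0 \<bullet> c) *\<^sub>R FD (\<lambda>z. A z c) z0 w)"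
proof -
  obtain B where B: "linear B" "B \<circ> A z0 = id"
    using linear_injective_left_inverse[OF lin inj] assms(1) by blast
  interpret B: bounded_linear B using B(1) linear_conv_bounded_linear by blast
  define r where "r z = b z - A z (s z0)" for z
  have dA: "((\<lambda>z. A z v) has_derivative FD (\<lambda>z. A z v) z0) (at z0)" for v
    using smooth_on_has_derivative[OF smooth assms(1)] .
  have dr: "(r has_derivative (\<lambda>w. FD b z0 w - FD (\<lambda>z. A z (s z0)) z0 w)) (at z0)"
    unfolding r_def by (intro has_derivative_diff dA FD_works assms)
  have cs: "isCont s z0"
    using isCont_solution[OF assms(1) _ s] assms(2) differentiable_imp_continuous_within by blast
  have "((\<lambda>z. \<Sum>c\<in>Basis. ((s z - s z0) \<bullet> c) *\<^sub>R (A z c - A z0 c)) has_derivative (\<lambda>v. \<Sum>c\<in>(Basis::'e set). 0)) (at z0)"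
  proof (intro has_derivative_sum has_derivative_null_product[where d'="\<lambda>w. FD (\<lambda>z. A z _) z0 w - 0"])
    show "isCont (\<lambda>z. (s z - s z0) \<bullet> c) z0" for c using cs by (intro continuous_intros)
    show "((\<lambda>z. A z c - A z0 c) has_derivative (\<lambda>w. FD (\<lambda>z. A z c) z0 w - 0)) (at z0)" for c
      by (intro has_derivative_diff dA has_derivative_const)
  qed auto
  then have n: "((\<lambda>z. B (\<Sum>c\<in>Basis. ((s z - s z0) \<bullet> c) *\<^sub>R (A z c - A z0 c))) has_derivative (\<lambda>v. B 0)) (at z0)"
    by (intro B.has_derivative) simp
  have D: "((\<lambda>z. s z0 + B (r z) - B (\<Sum>c\<in>Basis. ((s z - s z0) \<bullet> c) *\<^sub>R (A z c - A z0 c))) has_derivative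
      (\<lambda>w. 0 + B (FD b z0 w - FD (\<lambda>z. A z (s z0)) z0 w) - B 0)) (at z0)"
    by (intro has_derivative_diff has_derivative_add has_derivative_const n B.has_derivative dr)
  have "(s has_derivative (\<lambda>w. 0 + B (FD b z0 w - FD (\<lambda>z. A z (s z0)) z0 w) - B 0)) (at z0)"
  proof (rule has_derivative_transform_within_open[OF D open_\<Omega> assms(1)])
    fix z assume z: "z \<in> \<Omega>"
    interpret z: linear "A z" using z lin by blast
    interpret z0: linear "A z0" using assms(1) lin by blast
    let ?d = "s z - s z0"
    have "(\<Sum>c\<in>Basis. (?d \<bullet> c) *\<^sub>R (A z c - A z0 c)) = A z ?d - A z0 ?d"
      using expand[OF z, of ?d] expand[OF assms(1), of ?d]
      by (simp add: sum_subtractf scaleR_diff_right)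
    then have "r z - (\<Sum>c\<in>Basis. (?d \<bullet> c) *\<^sub>R (A z c - A z0 c)) = A z0 ?d"
      using s[OF z] by (simp add: r_def z.diff)
    then have "B (r z) - B (\<Sum>c\<in>Basis. (?d \<bullet> c) *\<^sub>R (A z c - A z0 c)) = ?d"
      unfolding B.diff[symmetric] using B(2) by (simp add: fun_eq_iff)
    then show "s z0 + B (r z) - B (\<Sum>c\<in>Basis. (?d \<bullet> c) *\<^sub>R (A z c - A z0 c)) = s z" by (simp add: algebra_simps)
  qed
  then show diff: "s differentiable at z0" by (auto simp: differentiable_def)
  have "((\<lambda>z. \<Sum>c\<in>Basis. (s z \<bullet> c) *\<^sub>R A z c) has_derivative
     (\<lambda>w. \<Sum>c\<in>Basis. (s z0 \<bullet> c) *\<^sub>R FD (\<lambda>z. A z c) z0 w + (FD s z0 w \<bullet> c) *\<^sub>R A z0 c)) (at z0)"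
    by (intro has_derivative_sum has_derivative_scaleR dA has_derivative_inner_left FD_works diff)
  then have "(b has_derivative
     (\<lambda>w. \<Sum>c\<in>Basis. (s z0 \<bullet> c) *\<^sub>R FD (\<lambda>z. A z c) z0 w + (FD s z0 w \<bullet> c) *\<^sub>R A z0 c)) (at z0)"
    by (rule has_derivative_transform_within_open[OF _ open_\<Omega> assms(1)])
       (use s expand in metis)
  from FD_eqI[OF this] show "A z0 (FD s z0 w) = FD b z0 w - (\<Sum>c\<in>Basis. (s z0 \<bullet> c) *\<^sub>R FD (\<lambda>z. A z c) z0 w)"
    unfolding expand[OF assms(1), of "FD s z0 w"] by (simp add: sum.distrib)
qed

text \<open>The derivative of a solution solves a system with the same matrix, whose right-hand side involves the
  solution itself but only derivatives of the data.\<close>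
lemma Ck_on_solution:
  assumes "Ck_on k \<Omega> b" and s: "\<And>z. z \<in> \<Omega> \<Longrightarrow> A z (s z) = b z"
  shows "Ck_on k \<Omega> s"
  using assms
proof (induction k arbitrary: b s)
  case 0
  then have "isCont b z" if "z \<in> \<Omega>" for z
    using open_\<Omega> that by (simp add: continuous_on_eq_continuous_at)
  then show ?case
    using isCont_solution[OF _ _ 0(2)] by (simp add: continuous_at_imp_continuous_on)
next
  case (Suc k)
  have bd: "b differentiable at z" if "z \<in> \<Omega>" for z using Suc.prems(1) that by simp
  note * = differentiable_solution[OF _ bd Suc.prems(2)]
  have "Ck_on k \<Omega> s" by (rule Suc.IH[OF Ck_on_Suc_imp[OF Suc.prems(1)] Suc.prems(2)])
  then have "Ck_on k \<Omega> (\<lambda>z. \<Sum>c\<in>Basis. (s z \<bullet> c) *\<^sub>R FD (\<lambda>z. A z c) z w)" for w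
    using smooth_on_FD[OF smooth] open_\<Omega> unfolding smooth_on_def
    by (intro Ck_on_sum Ck_on_bilinear[OF bounded_bilinear_scaleR]
      Ck_on_bounded_linear_comp[OF bounded_linear_inner_left]) auto
  from Ck_on_bounded_linear_comp[OF bounded_linear_minus[OF bounded_linear_ident] open_\<Omega> this]
  have "Ck_on k \<Omega> (\<lambda>z. FD b z w + - (\<Sum>c\<in>Basis. (s z \<bullet> c) *\<^sub>R FD (\<lambda>z. A z c) z w))" for w
    using Suc.prems(1) by (intro Ck_on_add open_\<Omega>) auto
  then have "Ck_on k \<Omega> (\<lambda>z. FD s z w)" for w
    by (rule Suc.IH) (simp add: *(2))
  with *(1) show ?case by simp
qed

lemma smooth_on_solution:
  "smooth_on \<Omega> b \<Longrightarrow> (\<And>z. z \<in> \<Omega> \<Longrightarrow> A z (s z) = b z) \<Longrightarrow> smooth_on \<Omega> s"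
  unfolding smooth_on_def using Ck_on_solution by blast

end

section \<open>Spray and Berwald coefficients in a chart\<close>

lemma linear_FD: "smooth_on S f \<Longrightarrow> x \<in> S \<Longrightarrow> linear (FD f x)"
  using linear_frechet_derivative smooth_onD by blast

lemma FD_moving_direction:
  fixes f :: "'a::euclidean_space \<Rightarrow> 'b::real_normed_vector"
  assumes "open S" "smooth_on S f" "z \<in> S" "(c has_derivative c') (at z)"
  shows "FD (\<lambda>p. FD f p (c p)) z w = FD (\<lambda>p. FD f p (c z)) z w + FD f z (c' w)"
  using FD_eqI[OF has_derivative_FD_moving[OF assms(1,2) _ has_derivative_ident assms(4)]] assms(3)
  by simp

text \<open>Derivative of Euler's identity. In particular, if \<open>f\<close> is homogeneous of degree \<open>k\<close> in \<open>y\<close>, then its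
  derivatives along the base are of degree \<open>k\<close> and its derivatives along the fibre of degree \<open>k - 1\<close>.\<close>
lemma FD_homogeneous:
  fixes f :: "'e::euclidean_space \<times> 'e \<Rightarrow> 'b::euclidean_space"
  assumes "open \<Omega>" "smooth_on \<Omega> f" "z \<in> \<Omega>"
    and hom: "\<And>p. p \<in> \<Omega> \<Longrightarrow> FD f p (0, snd p) = k *\<^sub>R f p"
  shows "FD (\<lambda>p. FD f p w) z (0, snd z) = k *\<^sub>R FD f z w - FD f z (0, snd w)"
proof -
  have "((\<lambda>p::'e \<times> 'e. (0::'e, snd p)) has_derivative (\<lambda>w. (0, snd w))) (at z)"
    by (auto intro!: derivative_eq_intros)
  from FD_moving_direction[OF assms(1-3) this, of w]
  have "FD (\<lambda>p. FD f p (0, snd p)) z w = FD (\<lambda>p. FD f p (0, snd z)) z w + FD f z (0, snd w)" .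
  moreover have "FD (\<lambda>p. FD f p (0, snd p)) z = FD (\<lambda>p. k *\<^sub>R f p) z"
    by (rule FD_cong[OF assms(1,3) hom])
  moreover have "FD (\<lambda>p. k *\<^sub>R f p) z = (\<lambda>w. k *\<^sub>R FD f z w)"
    by (intro FD_eqI has_derivative_scaleR_right smooth_on_has_derivative[OF assms(2,3)])
  ultimately show ?thesis
    using FD_FD_commute[OF assms(1-3), of w "(0, snd z)"] by (simp add: algebra_simps)
qed

text \<open>For the energy \<open>F = L\<^sup>2 / 2\<close> this is the fundamental tensor \<open>g\<^sub>i\<^sub>j\<close> of Finsler geometry, and the equation that
  defines \<open>spray\<close> is the Euler-Lagrange equation of \<open>F\<close>: geodesics solve \<open>x'' = - spray F (x, x')\<close>. In the
  usual notation \<open>spray\<close> is \<open>2 G\<^sup>i\<close>, and \<open>berwald\<close> consists of the second derivatives of \<open>G\<^sup>i\<close> in the fibre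
  coordinates.\<close>
definition fundamental_tensor :: "('e::euclidean_space \<times> 'e \<Rightarrow> real) \<Rightarrow> 'e \<times> 'e \<Rightarrow> 'e \<Rightarrow> 'e \<Rightarrow> real"
  where "fundamental_tensor F z v w = FD (\<lambda>p. FD F p (0, w)) z (0, v)"

definition euler_lagrange :: "('e::euclidean_space \<times> 'e \<Rightarrow> real) \<Rightarrow> 'e \<times> 'e \<Rightarrow> 'e \<Rightarrow> real"
  where "euler_lagrange F z w = FD (\<lambda>p. FD F p (0, w)) z (snd z, 0) - FD F z (w, 0)"

definition spray :: "('e::euclidean_space \<times> 'e \<Rightarrow> real) \<Rightarrow> 'e \<times> 'e \<Rightarrow> 'e"
  where "spray F z = (THE s. \<forall>w. fundamental_tensor F z s w = euler_lagrange F z w)"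

definition berwald :: "('e::euclidean_space \<times> 'e \<Rightarrow> real) \<Rightarrow> 'e \<times> 'e \<Rightarrow> 'e \<Rightarrow> 'e \<Rightarrow> 'e"
  where "berwald F z \<xi> \<eta> = (1/2) *\<^sub>R FD (\<lambda>p. FD (spray F) p (0, \<xi>)) z (0, \<eta>)"

abbreviation slit :: "'e::euclidean_space set \<Rightarrow> ('e \<times> 'e) set"
  where "slit U \<equiv> U \<times> (- {0})"

lemma open_slit [simp]: "open U \<Longrightarrow> open (slit U)"
  by (intro open_Times) auto

text \<open>Homogeneity of degree two in the fibre is stated as Euler's identity, a form that can be differentiated.\<close>
locale finsler_energy =
  fixes U :: "'e::euclidean_space set" and F :: "'e \<times> 'e \<Rightarrow> real"
  assumes open_U: "open U" and smooth_F: "smooth_on (slit U) F"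
    and hom_F: "\<And>z. z \<in> slit U \<Longrightarrow> FD F z (0, snd z) = 2 * F z"
    and pos_F: "\<And>z v. z \<in> slit U \<Longrightarrow> v \<noteq> 0 \<Longrightarrow> fundamental_tensor F z v v > 0"
begin

abbreviation "g \<equiv> fundamental_tensor F"

lemma open_\<Omega>: "open (slit U)" using open_U by simp

lemma commute: "z \<in> slit U \<Longrightarrow> FD (\<lambda>p. FD F p v) z w = FD (\<lambda>p. FD F p w) z v"
  by (rule FD_FD_commute[OF open_\<Omega> smooth_F])

lemma smooth_g: "smooth_on (slit U) (\<lambda>z. g z v w)"
  unfolding fundamental_tensor_def by (intro smooth_on_FD smooth_F)

lemma g_commute: "z \<in> slit U \<Longrightarrow> g z v w = g z w v"
  unfolding fundamental_tensor_def by (rule commute)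

lemma linear_g: assumes "z \<in> slit U" shows "linear (\<lambda>v. g z v w)"
proof -
  interpret linear "FD (\<lambda>p. FD F p (0, w)) z"
    by (rule linear_FD[OF smooth_on_FD[OF smooth_F] assms])
  have "(0, a + b) = (0::'e, a) + (0, b)" "(0, c *\<^sub>R a) = c *\<^sub>R (0::'e, a)" for a b :: 'e and c by auto
  then show ?thesis unfolding fundamental_tensor_def
    by (intro linearI) (simp_all add: add scale del: add_Pair scaleR_Pair)
qed

lemma linear_g2: assumes "z \<in> slit U" shows "linear (g z v)"
  using linear_g[OF assms, of v] unfolding g_commute[OF assms, of _ v] .

lemma g_eq_imp_eq:
  assumes "z \<in> slit U" "\<And>w. g z a w = g z b w"
  shows "a = b"
proof -
  interpret linear "\<lambda>v. g z v (a - b)" by (rule linear_g[OF assms(1)])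
  have "g z (a - b) (a - b) = 0" using assms(2) by (simp add: diff)
  then show ?thesis using pos_F[OF assms(1), of "a - b"] by fastforce
qed

text \<open>The bilinear form \<open>g\<close> and the linear form \<open>euler_lagrange F z\<close> are turned into a linear map and a vector by
  the inner product, so that \<open>spray\<close> becomes the solution of a linear system in the above sense.\<close>
definition lower :: "'e \<times> 'e \<Rightarrow> 'e \<Rightarrow> 'e"
  where "lower z v = (\<Sum>b\<in>Basis. g z v b *\<^sub>R b)"

lemma lower_inner: assumes "z \<in> slit U" shows "lower z v \<bullet> w = g z v w"
proof -
  interpret linear "g z v" by (rule linear_g2[OF assms])
  have "g z v w = g z v (\<Sum>b\<in>Basis. (w \<bullet> b) *\<^sub>R b)" by (simp add: euclidean_representation)
  then show ?thesis
    by (simp add: lower_def sum scale inner_sum_left mult.commute inner_commute[of w])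
qed

lemma linear_system: "linear_system (slit U) lower"
proof (rule linear_system.intro)
  show "open (slit U)" by (rule open_\<Omega>)
  show lin: "linear (lower z)" if "z \<in> slit U" for z
  proof -
    have "lower z (a + b) \<bullet> w = (lower z a + lower z b) \<bullet> w" for a b w
      using linear_add[OF linear_g[OF that]] by (simp add: lower_inner[OF that] inner_add_left)
    moreover have "lower z (c *\<^sub>R a) \<bullet> w = (c *\<^sub>R lower z a) \<bullet> w" for a c w
      using linear_scale[OF linear_g[OF that]] by (simp add: lower_inner[OF that])
    ultimately show ?thesis by (intro linearI) (metis vector_eq_rdot)+
  qed
  show "inj (lower z)" if "z \<in> slit U" for z
    using g_eq_imp_eq[OF that] by (intro injI) (metis lower_inner[OF that])
  show "smooth_on (slit U) (\<lambda>z. lower z v)" for v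
    unfolding lower_def by (intro smooth_on_sum open_\<Omega> smooth_on_scaleR smooth_g smooth_on_const)
qed

sublocale linear_system "slit U" lower by (rule linear_system)

lemma linear_el: assumes "z \<in> slit U" shows "linear (euler_lagrange F z)"
proof -
  interpret a: linear "FD (\<lambda>p. FD F p (snd z, 0)) z"
    by (rule linear_FD[OF smooth_on_FD[OF smooth_F] assms])
  interpret b: linear "FD F z" by (rule linear_FD[OF smooth_F assms])
  have e: "(0, a + b) = (0::'e, a) + (0, b)" "(0, c *\<^sub>R a) = c *\<^sub>R (0::'e, a)"
    "(a + b, 0) = (a, 0::'e) + (b, 0)" "(c *\<^sub>R a, 0) = c *\<^sub>R (a, 0::'e)" for a b :: 'e and c by auto
  show ?thesis unfolding euler_lagrange_def commute[OF assms, of _ "(snd z, 0)"]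
    by (intro linearI) (simp_all only: e a.add b.add a.scale b.scale, simp_all add: algebra_simps)
qed

definition raised :: "'e \<times> 'e \<Rightarrow> 'e"
  where "raised z = (\<Sum>b\<in>Basis. euler_lagrange F z b *\<^sub>R b)"

lemma raised_inner: assumes "z \<in> slit U" shows "raised z \<bullet> w = euler_lagrange F z w"
proof -
  interpret linear "euler_lagrange F z" by (rule linear_el[OF assms])
  have "euler_lagrange F z w = euler_lagrange F z (\<Sum>b\<in>Basis. (w \<bullet> b) *\<^sub>R b)"
    by (simp add: euclidean_representation)
  then show ?thesis
    by (simp add: raised_def sum scale inner_sum_left mult.commute inner_commute[of w])
qed

lemma spray_unique:
  assumes "z \<in> slit U" "\<And>w. g z s w = euler_lagrange F z w"
  shows "spray F z = s"
  unfolding spray_def using assms g_eq_imp_eq[OF assms(1)] by (intro the_equality) auto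

lemma lower_spray: assumes "z \<in> slit U" shows "lower z (spray F z) = raised z"
proof -
  have "surj (lower z)" using linear_injective_imp_surjective lin inj assms by blast
  then obtain s where s: "lower z s = raised z" by (metis surjD)
  have "spray F z = s"
    by (rule spray_unique[OF assms]) (metis s lower_inner raised_inner assms)
  with s show ?thesis by simp
qed

lemma g_spray: "z \<in> slit U \<Longrightarrow> g z (spray F z) w = euler_lagrange F z w"
  using lower_spray lower_inner raised_inner by metis

lemma smooth_el: "smooth_on (slit U) (\<lambda>z. euler_lagrange F z w)"
proof -
  have "smooth_on (slit U) (\<lambda>z. FD (\<lambda>p. FD F p (0, w)) z (snd z, 0))"
    using open_\<Omega> by (intro smooth_on_FD_moving[OF _ smooth_on_FD[OF smooth_F]] smooth_on_Pair smooth_on_snd) auto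
  then show ?thesis unfolding euler_lagrange_def
    by (intro smooth_on_diff open_\<Omega> smooth_on_FD smooth_F)
qed

lemma smooth_spray: "smooth_on (slit U) (spray F)"
proof (rule smooth_on_solution[of raised])
  show "smooth_on (slit U) raised"
    unfolding raised_def[abs_def] by (intro smooth_on_sum open_\<Omega> smooth_on_scaleR smooth_el smooth_on_const)
qed (rule lower_spray)

lemma has_derivative_horizontal: "((\<lambda>p::'e \<times> 'e. (snd p, 0::'e)) has_derivative (\<lambda>w. (snd w, 0))) (at z)"
  and has_derivative_spray_vertical:
    "z \<in> slit U \<Longrightarrow> ((\<lambda>p. (0::'e, spray F p)) has_derivative (\<lambda>w. (0, FD (spray F) z w))) (at z)"
  using smooth_on_has_derivative[OF smooth_spray, of z] by (auto intro!: derivative_eq_intros)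

lemma hom_dF: "z \<in> slit U \<Longrightarrow> FD (\<lambda>p. FD F p w) z (0, snd z) = 2 * FD F z w - FD F z (0, snd w)"
  using FD_homogeneous[OF open_\<Omega> smooth_F, of z 2 w] hom_F by simp

lemma g_fundamental: "z \<in> slit U \<Longrightarrow> g z v (snd z) = FD F z (0, v)"
  unfolding fundamental_tensor_def using commute hom_dF[of z "(0, v)"] by simp

lemma FD_zero: "z \<in> slit U \<Longrightarrow> FD F z 0 = 0"
  using linear_0[OF linear_FD[OF smooth_F]] .

text \<open>The Euler-Lagrange equation evaluated on \<open>y\<close>, with Euler's identities for the derivatives of \<open>F\<close>.\<close>
lemma spray_energy: assumes "z \<in> slit U" shows "FD F z (0, spray F z) = FD F z (snd z, 0)"
  using g_fundamental[OF assms, of "spray F z"] g_spray[OF assms, of "snd z"]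
    commute[OF assms, of "(0, snd z)"] hom_dF[OF assms, of "(snd z, 0)"] FD_zero[OF assms]
  by (simp add: euler_lagrange_def zero_prod_def)

text \<open>Differentiate the preceding identity along the fibre in the direction \<open>\<xi>\<close> and subtract the
  Euler-Lagrange equation evaluated on \<open>\<xi>\<close>.\<close>
lemma horizontal_energy:
  assumes "z \<in> slit U"
  shows "FD F z (\<xi>, 0) = FD F z (0, (1/2) *\<^sub>R FD (spray F) z (0, \<xi>))"
proof -
  interpret linear "FD F z" by (rule linear_FD[OF smooth_F assms])
  have "FD (\<lambda>p. FD F p (0, spray F p)) z (0, \<xi>) = FD (\<lambda>p. FD F p (snd p, 0)) z (0, \<xi>)"
    using FD_cong[OF open_\<Omega> assms spray_energy] by simp
  moreover have "FD (\<lambda>p. FD F p (0, spray F p)) z (0, \<xi>) =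
     g z \<xi> (spray F z) + FD F z (0, FD (spray F) z (0, \<xi>))"
    using FD_moving_direction[OF open_\<Omega> smooth_F assms has_derivative_spray_vertical[OF assms]]
    by (simp add: fundamental_tensor_def)
  moreover have "FD (\<lambda>p. FD F p (snd p, 0)) z (0, \<xi>) =
     FD (\<lambda>p. FD F p (0, \<xi>)) z (snd z, 0) + FD F z (\<xi>, 0)"
    using FD_moving_direction[OF open_\<Omega> smooth_F assms has_derivative_horizontal] commute[OF assms]
    by simp
  moreover have "g z \<xi> (spray F z) = FD (\<lambda>p. FD F p (0, \<xi>)) z (snd z, 0) - FD F z (\<xi>, 0)"
    using g_commute g_spray assms by (simp add: euler_lagrange_def)
  ultimately have "FD F z (0, FD (spray F) z (0, \<xi>)) = 2 * FD F z (\<xi>, 0)" by simp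
  moreover have "(0, (1/2) *\<^sub>R FD (spray F) z (0, \<xi>)) = (1/2) *\<^sub>R (0::'e, FD (spray F) z (0, \<xi>))" by simp
  ultimately show ?thesis by (simp only: scale) simp
qed

text \<open>Both sides of the Euler-Lagrange equation are differentiated along \<open>(0, y)\<close>. As \<open>g\<close> is homogeneous of
  degree zero and the right-hand side of degree two, \<open>g\<close> can be cancelled.\<close>
lemma hom_spray: assumes "z \<in> slit U" shows "FD (spray F) z (0, snd z) = 2 *\<^sub>R spray F z"
proof (rule g_eq_imp_eq[OF assms])
  fix w
  let ?Fw = "\<lambda>p. FD F p (0, w)" and ?C = "(0, snd z)"
  have Fw: "smooth_on (slit U) ?Fw" by (rule smooth_on_FD[OF smooth_F])
  have hom_Fw: "FD ?Fw p (0, snd p) = 1 *\<^sub>R ?Fw p" if "p \<in> slit U" for p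
    using hom_dF[OF that, of "(0, w)"] by simp
  note hom = FD_homogeneous[OF open_\<Omega> Fw assms hom_Fw]
  have gw: "g p s w = FD ?Fw p (0, s)" for p s by (simp add: fundamental_tensor_def)
  interpret linear "\<lambda>s. g z s w" by (rule linear_g[OF assms])
  have "FD (\<lambda>p. FD ?Fw p (0, spray F p)) z ?C = FD (\<lambda>p. euler_lagrange F p w) z ?C"
    using FD_cong[OF open_\<Omega> assms, of "\<lambda>p. FD ?Fw p (0, spray F p)"] g_spray
    by (metis (no_types, lifting) gw)
  moreover have "FD (\<lambda>p. FD ?Fw p (0, spray F p)) z ?C = g z (FD (spray F) z ?C) w"
    using FD_moving_direction[OF open_\<Omega> Fw assms has_derivative_spray_vertical[OF assms]]
      hom[of "(0, spray F z)"] by (simp add: fundamental_tensor_def)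
  moreover have "FD (\<lambda>p. euler_lagrange F p w) z ?C = 2 * euler_lagrange F z w"
  proof -
    have "((\<lambda>p. FD ?Fw p (snd p, 0)) has_derivative
        (\<lambda>u. FD (\<lambda>p. FD ?Fw p (snd z, 0)) z u + FD ?Fw z (snd u, 0))) (at z)"
      using has_derivative_FD_moving[OF open_\<Omega> Fw _ has_derivative_ident has_derivative_horizontal] assms
      by simp
    moreover have "((\<lambda>p. FD F p (w, 0)) has_derivative FD (\<lambda>p. FD F p (w, 0)) z) (at z)"
      by (rule smooth_on_has_derivative[OF smooth_on_FD[OF smooth_F] assms])
    ultimately have "FD (\<lambda>p. euler_lagrange F p w) z = (\<lambda>u. FD (\<lambda>p. FD ?Fw p (snd z, 0)) z u +
       FD ?Fw z (snd u, 0) - FD (\<lambda>p. FD F p (w, 0)) z u)"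
      unfolding euler_lagrange_def by (intro FD_eqI has_derivative_diff)
    moreover have "FD ?Fw z 0 = 0" using linear_0[OF linear_FD[OF Fw assms]] .
    ultimately show ?thesis
      using hom[of "(snd z, 0)"] hom_dF[OF assms, of "(w, 0)"] FD_zero[OF assms]
      by (simp add: euler_lagrange_def zero_prod_def)
  qed
  ultimately show "g z (FD (spray F) z ?C) w = g z (2 *\<^sub>R spray F z) w"
    using g_spray[OF assms] by (simp add: scale)
qed

lemma smooth_berwald: "smooth_on (slit U) (\<lambda>z. berwald F z \<xi> \<eta>)"
  unfolding berwald_def by (intro smooth_on_scaleR open_\<Omega> smooth_on_FD smooth_spray smooth_on_const)

lemma berwald_commute: "z \<in> slit U \<Longrightarrow> berwald F z \<xi> \<eta> = berwald F z \<eta> \<xi>"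
  unfolding berwald_def using FD_FD_commute[OF open_\<Omega> smooth_spray] by metis

lemma linear_berwald: assumes "z \<in> slit U" shows "linear (berwald F z \<xi>)"
proof -
  interpret linear "FD (\<lambda>p. FD (spray F) p (0, \<xi>)) z"
    by (rule linear_FD[OF smooth_on_FD[OF smooth_spray] assms])
  have "(0, a + b) = (0::'e, a) + (0, b)" "(0, c *\<^sub>R a) = c *\<^sub>R (0::'e, a)" for a b :: 'e and c by auto
  then show ?thesis unfolding berwald_def
    by (intro linearI) (simp_all add: add scale algebra_simps del: add_Pair scaleR_Pair)
qed

lemma berwald_fundamental:
  assumes "z \<in> slit U"
  shows "berwald F z \<xi> (snd z) = (1/2) *\<^sub>R FD (spray F) z (0, \<xi>)"
  unfolding berwald_def
  using FD_homogeneous[OF open_\<Omega> smooth_spray assms hom_spray, of "(0, \<xi>)"] by (simp add: algebra_simps scaleR_2)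

lemma horizontal_energy_berwald:
  "z \<in> slit U \<Longrightarrow> FD F z (\<xi>, 0) = FD F z (0, berwald F z \<xi> (snd z))"
  by (simp only: berwald_fundamental horizontal_energy[symmetric])

lemma FD_berwald_fundamental:
  assumes "z \<in> slit U"
  shows "FD (\<lambda>p. berwald F p \<xi> (snd p)) z (0, \<eta>) = berwald F z \<xi> \<eta>"
proof -
  have "FD (\<lambda>p. berwald F p \<xi> (snd p)) z = FD (\<lambda>p. (1/2) *\<^sub>R FD (spray F) p (0, \<xi>)) z"
    by (rule FD_cong[OF open_\<Omega> assms berwald_fundamental])
  also have "\<dots> = (\<lambda>w. (1/2) *\<^sub>R FD (\<lambda>p. FD (spray F) p (0, \<xi>)) z w)"
    by (intro FD_eqI has_derivative_scaleR_right smooth_on_has_derivative[OF smooth_on_FD[OF smooth_spray] assms])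
  finally show ?thesis by (simp add: berwald_def)
qed

text \<open>The hypotheses \<open>vert\<close> and \<open>energy\<close> are the coordinate forms of the conditions on the (v)hv-torsion and on
  the horizontal derivative of \<open>L\<close>.\<close>
lemma berwald_unique:
  fixes \<Gamma> :: "'e \<times> 'e \<Rightarrow> 'e \<Rightarrow> 'e \<Rightarrow> 'e"
  assumes lin: "\<And>z \<xi>. z \<in> slit U \<Longrightarrow> linear (\<Gamma> z \<xi>)"
    and sym: "\<And>z \<xi> \<eta>. z \<in> slit U \<Longrightarrow> \<Gamma> z \<xi> \<eta> = \<Gamma> z \<eta> \<xi>"
    and diff: "\<And>z \<xi>. z \<in> slit U \<Longrightarrow> (\<lambda>p. \<Gamma> p \<xi> (snd p)) differentiable at z"
    and vert: "\<And>z \<xi> \<eta>. z \<in> slit U \<Longrightarrow> FD (\<lambda>p. \<Gamma> p \<xi> (snd p)) z (0, \<eta>) = \<Gamma> z \<xi> \<eta>"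
    and energy: "\<And>z \<xi>. z \<in> slit U \<Longrightarrow> FD F z (\<xi>, 0) = FD F z (0, \<Gamma> z \<xi> (snd z))"
    and z: "z \<in> slit U"
  shows "\<Gamma> z \<xi> \<eta> = berwald F z \<xi> \<eta>"
proof -
  let ?N = "\<lambda>\<xi> p. \<Gamma> p \<xi> (snd p)"
  \<comment> \<open>derivative of \<open>energy\<close> along the fibre\<close>
  have deriv: "FD (\<lambda>p. FD F p (\<xi>, 0)) z (0, \<eta>) = g z \<eta> (?N \<xi> z) + FD F z (0, \<Gamma> z \<xi> \<eta>)"
    if z: "z \<in> slit U" for z \<xi> \<eta>
  proof -
    have "((\<lambda>p. (0::'e, ?N \<xi> p)) has_derivative (\<lambda>w. (0, FD (?N \<xi>) z w))) (at z)"
      using FD_works[OF diff[OF z]] by (auto intro!: derivative_eq_intros)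
    from FD_moving_direction[OF open_\<Omega> smooth_F z this, of "(0, \<eta>)"]
    have "FD (\<lambda>p. FD F p (0, ?N \<xi> p)) z (0, \<eta>) =
        g z \<eta> (?N \<xi> z) + FD F z (0, FD (?N \<xi>) z (0, \<eta>))"
      by (simp add: fundamental_tensor_def)
    moreover have "FD (\<lambda>p. FD F p (\<xi>, 0)) z = FD (\<lambda>p. FD F p (0, ?N \<xi> p)) z"
      by (rule FD_cong[OF open_\<Omega> z energy])
    ultimately show ?thesis using vert[OF z] by (simp add: fundamental_tensor_def)
  qed
  \<comment> \<open>the difference of \<open>deriv\<close> for \<open>(y, \<eta>)\<close> and \<open>(\<eta>, y)\<close>: the terms with \<open>\<Gamma>\<close> cancel by symmetry\<close>
  have spray: "spray F z = \<Gamma> z (snd z) (snd z)" if z: "z \<in> slit U" for z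
  proof (rule spray_unique[OF z])
    fix \<eta>
    let ?y = "snd z"
    have "g z ?y (?N \<eta> z) = FD F z (\<eta>, 0)"
      using g_commute[OF z, of ?y] g_fundamental[OF z] energy[OF z] by simp
    moreover have "FD (\<lambda>p. FD F p (\<eta>, 0)) z (0, ?y) = 2 * FD F z (\<eta>, 0)"
      using hom_dF[OF z, of "(\<eta>, 0)"] FD_zero[OF z] by (simp add: zero_prod_def)
    ultimately show "g z (?N ?y z) \<eta> = euler_lagrange F z \<eta>"
      using deriv[OF z, of ?y \<eta>] deriv[OF z, of \<eta> ?y] sym[OF z, of ?y \<eta>]
        g_commute[OF z, of \<eta>] commute[OF z, of "(?y, 0)"] by (simp add: euler_lagrange_def)
  qed
  \<comment> \<open>product rule for \<open>\<Gamma> p y y\<close>, bilinear in the two occurrences of \<open>y\<close>\<close>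
  have N: "?N \<xi> z = (1/2) *\<^sub>R FD (spray F) z (0, \<xi>)" if z: "z \<in> slit U" for z \<xi>
  proof -
    have lin1: "\<Gamma> p v w = (\<Sum>b\<in>Basis. (v \<bullet> b) *\<^sub>R \<Gamma> p b w)" if "p \<in> slit U" for p v w
    proof -
      interpret linear "\<Gamma> p w" by (rule lin[OF that])
      have "\<Gamma> p w v = \<Gamma> p w (\<Sum>b\<in>Basis. (v \<bullet> b) *\<^sub>R b)" by (simp add: euclidean_representation)
      then show ?thesis by (simp add: sum scale sym[OF that, of _ w])
    qed
    have "((\<lambda>p. \<Sum>b\<in>Basis. (snd p \<bullet> b) *\<^sub>R ?N b p) has_derivative
       (\<lambda>w. \<Sum>b\<in>Basis. (snd z \<bullet> b) *\<^sub>R FD (?N b) z w + (snd w \<bullet> b) *\<^sub>R ?N b z)) (at z)"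
      by (intro has_derivative_sum has_derivative_scaleR has_derivative_inner_left FD_works diff z
          has_derivative_snd has_derivative_ident)
    then have "(spray F has_derivative
       (\<lambda>w. \<Sum>b\<in>Basis. (snd z \<bullet> b) *\<^sub>R FD (?N b) z w + (snd w \<bullet> b) *\<^sub>R ?N b z)) (at z)"
      by (rule has_derivative_transform_within_open[OF _ open_\<Omega> z]) (metis spray lin1)
    from FD_eqI[OF this] have "FD (spray F) z (0, \<xi>) = \<Gamma> z (snd z) \<xi> + \<Gamma> z \<xi> (snd z)"
      using lin1[OF z, of "snd z" \<xi>] lin1[OF z, of \<xi> "snd z"] by (simp add: vert[OF z] sum.distrib)
    then show ?thesis using sym[OF z] by (simp add: scaleR_2[symmetric])
  qed
  have "FD (?N \<xi>) z = FD (\<lambda>p. berwald F p \<xi> (snd p)) z"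
    by (rule FD_cong[OF open_\<Omega> z]) (simp add: N berwald_fundamental)
  then show ?thesis
    using vert[OF z, of \<xi> \<eta>] FD_berwald_fundamental[OF z, of \<xi> \<eta>] by simp
qed

end

subsection \<open>Change of coordinates\<close>
definition tangent_map :: "('a::real_normed_vector \<Rightarrow> 'b::real_normed_vector) \<Rightarrow> 'a \<times> 'a \<Rightarrow> 'b \<times> 'b"
  where "tangent_map \<psi> z = (\<psi> (fst z), FD \<psi> (fst z) (snd z))"

lemma tangent_map_has_derivative:
  fixes \<psi> :: "'a::euclidean_space \<Rightarrow> 'b::euclidean_space"
  assumes "open V" "smooth_on V \<psi>" "fst z \<in> V"
  shows "(tangent_map \<psi> has_derivative (\<lambda>w. (FD \<psi> (fst z) (fst w),
    FD (\<lambda>p. FD \<psi> p (snd z)) (fst z) (fst w) + FD \<psi> (fst z) (snd w)))) (at z)"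
proof -
  have "((\<lambda>z. \<psi> (fst z)) has_derivative (\<lambda>w. FD \<psi> (fst z) (fst w))) (at z)"
    using diff_chain_at[OF has_derivative_fst[OF has_derivative_ident] smooth_on_has_derivative[OF assms(2,3)]]
    by (simp add: o_def)
  then show ?thesis unfolding tangent_map_def[abs_def]
    by (intro has_derivative_Pair has_derivative_FD_moving[where \<phi>=fst, OF assms] has_derivative_fst
        has_derivative_snd has_derivative_ident)
qed

lemma FD_tangent_map:
  fixes \<psi> :: "'a::euclidean_space \<Rightarrow> 'b::euclidean_space"
  assumes "open V" "smooth_on V \<psi>" "fst z \<in> V"
  shows "FD (tangent_map \<psi>) z w = (FD \<psi> (fst z) (fst w),
    FD (\<lambda>p. FD \<psi> p (snd z)) (fst z) (fst w) + FD \<psi> (fst z) (snd w))"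
  by (simp only: FD_eqI[OF tangent_map_has_derivative[OF assms]])

lemma smooth_on_tangent_map:
  fixes \<psi> :: "'a::euclidean_space \<Rightarrow> 'b::euclidean_space"
  assumes "open V" "smooth_on V \<psi>"
  shows "smooth_on (V \<times> UNIV) (tangent_map \<psi>)"
proof -
  have o: "open (V \<times> (UNIV :: 'a set))" using assms by (intro open_Times) auto
  have "smooth_on (V \<times> (UNIV :: 'a set)) (\<lambda>z. \<psi> (fst z))"
    by (rule smooth_on_compose[OF o assms(2)]) (auto intro!: smooth_on_fst smooth_on_id o)
  moreover have "smooth_on (V \<times> UNIV) (\<lambda>z. FD \<psi> (fst z) (snd z))"
    by (rule smooth_on_FD_moving[OF o assms(2)]) (auto intro!: smooth_on_fst smooth_on_snd smooth_on_id o)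
  ultimately show ?thesis unfolding tangent_map_def[abs_def] by (rule smooth_on_Pair[OF o])
qed

lemma has_derivative_along_fibre:
  assumes "open S" "smooth_on S f" "(x, y) \<in> S"
  shows "((\<lambda>y. f (x, y)) has_derivative (\<lambda>\<eta>. FD f (x, y) (0, \<eta>))) (at y)"
proof -
  have "((\<lambda>y. (x, y)) has_derivative (\<lambda>\<eta>. (0, \<eta>))) (at y)" by (auto intro!: derivative_eq_intros)
  from diff_chain_at[OF this smooth_on_has_derivative[OF assms(2,3)]] show ?thesis by (simp add: o_def)
qed

text \<open>One Finsler structure in two charts with transition map \<open>\<psi>\<close>.\<close>
locale finsler_energy_change =
  F1: finsler_energy U1 F1 + F2: finsler_energy U2 F2
  for U1 U2 :: "'e::euclidean_space set" and F1 F2 +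
  fixes V and \<psi> :: "'e \<Rightarrow> 'e"
  assumes V: "open V" "V \<subseteq> U1" and smooth_\<psi>: "smooth_on V \<psi>" and \<psi>V: "\<psi> ` V \<subseteq> U2"
    and inj_\<psi>: "\<And>x. x \<in> V \<Longrightarrow> inj (FD \<psi> x)"
    and energy: "\<And>z. z \<in> slit V \<Longrightarrow> F1 z = F2 (tangent_map \<psi> z)"
begin

abbreviation "\<psi>2 x v w \<equiv> FD (\<lambda>p. FD \<psi> p v) x w"

lemma linear_\<psi>: "x \<in> V \<Longrightarrow> linear (FD \<psi> x)"
  by (rule linear_FD[OF smooth_\<psi>])

lemma surj_\<psi>: "x \<in> V \<Longrightarrow> surj (FD \<psi> x)"
  using linear_injective_imp_surjective linear_\<psi> inj_\<psi> by blast

lemma \<psi>2_commute: "x \<in> V \<Longrightarrow> \<psi>2 x v w = \<psi>2 x w v"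
  by (rule FD_FD_commute[OF V(1) smooth_\<psi>])

lemma tangent_map_slit: assumes "z \<in> slit V" shows "tangent_map \<psi> z \<in> slit U2"
proof -
  interpret linear "FD \<psi> (fst z)" using assms linear_\<psi> by auto
  have "FD \<psi> (fst z) (snd z) \<noteq> 0"
    using assms inj_\<psi>[of "fst z"] zero unfolding inj_def by (metis ComplD SigmaE fst_conv singletonI snd_conv)
  then show ?thesis using assms \<psi>V by (auto simp: tangent_map_def)
qed

lemma slit_V: "z \<in> slit V \<Longrightarrow> z \<in> slit U1" "z \<in> slit V \<Longrightarrow> fst z \<in> V" "open (slit V)"
  using V by auto

lemma FD_energy:
  assumes "z \<in> slit V"
  shows "FD F1 z w = FD F2 (tangent_map \<psi> z)
    (FD \<psi> (fst z) (fst w), \<psi>2 (fst z) (snd z) (fst w) + FD \<psi> (fst z) (snd w))"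
proof -
  have "FD F1 z = FD (\<lambda>z. F2 (tangent_map \<psi> z)) z"
    by (rule FD_cong[OF slit_V(3) assms energy])
  also have "\<dots> = (\<lambda>w. FD F2 (tangent_map \<psi> z) (FD (tangent_map \<psi>) z w))"
    using diff_chain_at[OF tangent_map_has_derivative[OF V(1) smooth_\<psi> slit_V(2)[OF assms]]
        smooth_on_has_derivative[OF F2.smooth_F tangent_map_slit[OF assms]]]
      FD_tangent_map[OF V(1) smooth_\<psi> slit_V(2)[OF assms]]
    by (intro FD_eqI) (simp add: o_def)
  finally show ?thesis by (simp only: FD_tangent_map[OF V(1) smooth_\<psi> slit_V(2)[OF assms]])
qed

lemma FD_FD_energy:
  assumes z: "z \<in> slit V"
  shows "FD (\<lambda>p. FD F1 p (0, w)) z d =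
    FD (\<lambda>q. FD F2 q (0, FD \<psi> (fst z) w)) (tangent_map \<psi> z)
      (FD \<psi> (fst z) (fst d), \<psi>2 (fst z) (snd z) (fst d) + FD \<psi> (fst z) (snd d))
    + FD F2 (tangent_map \<psi> z) (0, \<psi>2 (fst z) w (fst d))"
proof -
  have "FD (\<lambda>p. FD F1 p (0, w)) z = FD (\<lambda>p. FD F2 (tangent_map \<psi> p) (0, FD \<psi> (fst p) w)) z"
  proof (rule FD_cong[OF slit_V(3) z])
    fix p assume "p \<in> slit V"
    then show "FD F1 p (0, w) = FD F2 (tangent_map \<psi> p) (0, FD \<psi> (fst p) w)"
      using FD_energy[of p "(0, w)"] linear_0[OF linear_\<psi>[OF slit_V(2)]]
        linear_0[OF linear_FD[OF smooth_on_FD[OF smooth_\<psi>] slit_V(2)]] by simp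
  qed
  moreover have "((\<lambda>p. (0, FD \<psi> (fst p) w)) has_derivative (\<lambda>d. (0, \<psi>2 (fst z) w (fst d)))) (at z)"
    using diff_chain_at[OF has_derivative_fst[OF has_derivative_ident]
        smooth_on_has_derivative[OF smooth_on_FD[OF smooth_\<psi>] slit_V(2)[OF z]]]
    by (intro has_derivative_Pair has_derivative_const) (simp add: o_def)
  from has_derivative_FD_moving[OF F2.open_\<Omega> F2.smooth_F tangent_map_slit[OF z]
      tangent_map_has_derivative[OF V(1) smooth_\<psi> slit_V(2)[OF z]] this]
  have "FD (\<lambda>p. FD F2 (tangent_map \<psi> p) (0, FD \<psi> (fst p) w)) z = (\<lambda>d.
    FD (\<lambda>q. FD F2 q (0, FD \<psi> (fst z) w)) (tangent_map \<psi> z)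
      (FD \<psi> (fst z) (fst d), \<psi>2 (fst z) (snd z) (fst d) + FD \<psi> (fst z) (snd d))
    + FD F2 (tangent_map \<psi> z) (0, \<psi>2 (fst z) w (fst d)))"
    by (rule FD_eqI)
  ultimately show ?thesis by simp
qed

text \<open>By the chain rule the Euler-Lagrange form of \<open>F1\<close> is that of \<open>F2\<close> plus the term \<open>g(\<psi>''(y, y), -)\<close>, which
  comes from differentiating the fibre coordinate \<open>\<psi>'(x) y\<close> along the base. The two terms that contain only
  first derivatives of \<open>F2\<close> and second derivatives of \<open>\<psi>\<close> cancel, since \<open>\<psi>''\<close> is symmetric.\<close>
lemma spray_change:
  assumes z: "z \<in> slit V"
  shows "spray F2 (tangent_map \<psi> z) = FD \<psi> (fst z) (spray F1 z) - \<psi>2 (fst z) (snd z) (snd z)"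
proof (rule F2.spray_unique[OF tangent_map_slit[OF z]])
  fix u
  let ?z = "tangent_map \<psi> z" and ?x = "fst z" and ?y = "snd z"
  have x: "?x \<in> V" and z1: "z \<in> slit U1" and z2: "?z \<in> slit U2"
    using slit_V z tangent_map_slit by auto
  obtain w where u: "u = FD \<psi> ?x w" using surj_\<psi>[OF x] by (metis surjD)
  have z0: "FD \<psi> ?x 0 = 0" "\<psi>2 ?x v 0 = 0" for v
    using linear_0[OF linear_\<psi>[OF x]] linear_0[OF linear_FD[OF smooth_on_FD[OF smooth_\<psi>] x]] by auto
  interpret a: linear "FD (\<lambda>q. FD F2 q (0, u)) ?z"
    by (rule linear_FD[OF smooth_on_FD[OF F2.smooth_F] z2])
  interpret b: linear "FD F2 ?z" by (rule linear_FD[OF F2.smooth_F z2])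
  have s: "(a, b) = (a, 0::'e) + (0::'e, b)" for a b by simp
  have "F2.g ?z (FD \<psi> ?x (spray F1 z)) u = F1.g z (spray F1 z) w"
    using FD_FD_energy[OF z, of w "(0, spray F1 z)"] z0 b.zero
    by (simp add: fundamental_tensor_def u zero_prod_def)
  also have "\<dots> = euler_lagrange F1 z w" by (rule F1.g_spray[OF z1])
  also have "\<dots> = FD (\<lambda>q. FD F2 q (0, u)) ?z (FD \<psi> ?x ?y, \<psi>2 ?x ?y ?y)
      + FD F2 ?z (0, \<psi>2 ?x w ?y) - FD F2 ?z (u, \<psi>2 ?x ?y w)"
    using FD_FD_energy[OF z, of w "(?y, 0)"] FD_energy[OF z, of "(w, 0)"] z0
    by (simp add: euler_lagrange_def u)
  also have "\<dots> = FD (\<lambda>q. FD F2 q (0, u)) ?z (FD \<psi> ?x ?y, 0) + F2.g ?z (\<psi>2 ?x ?y ?y) u - FD F2 ?z (u, 0)"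
    unfolding \<psi>2_commute[OF x, of w] s[of "FD \<psi> ?x ?y" "\<psi>2 ?x ?y ?y"] s[of u "\<psi>2 ?x ?y w"] a.add b.add
    by (simp add: fundamental_tensor_def)
  finally have "F2.g ?z (FD \<psi> ?x (spray F1 z)) u - F2.g ?z (\<psi>2 ?x ?y ?y) u = euler_lagrange F2 ?z u"
    by (simp add: euler_lagrange_def tangent_map_def)
  then show "F2.g ?z (FD \<psi> ?x (spray F1 z) - \<psi>2 ?x ?y ?y) u = euler_lagrange F2 ?z u"
    using linear_diff[OF F2.linear_g[OF z2]] by simp
qed

text \<open>Two derivatives of \<open>spray_change\<close> in \<open>y\<close> at fixed \<open>x\<close>. There the fibre coordinate changes by the fixed
  linear map \<open>\<psi>'(x)\<close>, and the correction is a quadratic form in \<open>y\<close>.\<close>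
lemma berwald_change:
  assumes z: "z \<in> slit V"
  shows "berwald F2 (tangent_map \<psi> z) (FD \<psi> (fst z) \<xi>) (FD \<psi> (fst z) \<eta>) =
    FD \<psi> (fst z) (berwald F1 z \<xi> \<eta>) - \<psi>2 (fst z) \<xi> \<eta>"
proof -
  obtain x y where zxy: "z = (x, y)" by (cases z)
  have x: "x \<in> V" and y: "y \<in> - {0}" using z zxy by auto
  let ?A = "FD \<psi> x"
  interpret A: bounded_linear ?A using linear_\<psi>[OF x] linear_conv_bounded_linear by blast
  have "bilinear (\<psi>2 x)"
  proof -
    have "linear (\<psi>2 x v)" for v by (rule linear_FD[OF smooth_on_FD[OF smooth_\<psi>] x])
    moreover from this have "linear (\<lambda>v. \<psi>2 x v w)" for w
      unfolding \<psi>2_commute[OF x, of _ w] .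
    ultimately show ?thesis by (simp add: bilinear_def)
  qed
  then interpret H: bounded_bilinear "\<psi>2 x" using bilinear_conv_bounded_bilinear by blast
  have sl: "(x, y) \<in> slit V" "(\<psi> x, ?A y) \<in> slit U2" "(x, y) \<in> slit U1" if "y \<in> - {0}" for y
    using tangent_map_slit[of "(x, y)"] x that V by (auto simp: tangent_map_def)
  have chain: "((\<lambda>y. f (\<psi> x, ?A y)) has_derivative (\<lambda>\<eta>. FD f (\<psi> x, ?A y) (0, ?A \<eta>))) (at y)"
    if "smooth_on (slit U2) f" "y \<in> - {0}" for f :: "'e \<times> 'e \<Rightarrow> 'e" and y
    using diff_chain_at[OF A.has_derivative[OF has_derivative_ident]
        has_derivative_along_fibre[OF F2.open_\<Omega> that(1) sl(2)[OF that(2)]]] by (simp add: o_def)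
  have first: "FD (spray F2) (\<psi> x, ?A y) (0, ?A \<xi>) = ?A (FD (spray F1) (x, y) (0, \<xi>)) - 2 *\<^sub>R \<psi>2 x y \<xi>"
    if y: "y \<in> - {0}" for y \<xi>
  proof -
    have "((\<lambda>y. ?A (spray F1 (x, y)) - \<psi>2 x y y) has_derivative
       (\<lambda>\<eta>. ?A (FD (spray F1) (x, y) (0, \<eta>)) - (\<psi>2 x y \<eta> + \<psi>2 x \<eta> y))) (at y)"
      by (intro has_derivative_diff A.has_derivative H.FDERIV has_derivative_ident
          has_derivative_along_fibre[OF F1.open_\<Omega> F1.smooth_spray sl(3)[OF y]])
    moreover have "FD (\<lambda>y. spray F2 (\<psi> x, ?A y)) y = FD (\<lambda>y. ?A (spray F1 (x, y)) - \<psi>2 x y y) y"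
      using spray_change[OF sl(1)] by (intro FD_cong[of "- {0}"] y) (auto simp: tangent_map_def)
    ultimately show ?thesis
      using FD_eqI[OF chain[OF F2.smooth_spray y]] \<psi>2_commute[OF x, of \<xi> y]
      by (simp add: FD_eqI scaleR_2 fun_eq_iff)
  qed
  have "((\<lambda>y. ?A (FD (spray F1) (x, y) (0, \<xi>)) - 2 *\<^sub>R \<psi>2 x y \<xi>) has_derivative
     (\<lambda>\<eta>. ?A (FD (\<lambda>p. FD (spray F1) p (0, \<xi>)) (x, y) (0, \<eta>)) - 2 *\<^sub>R (\<psi>2 x y 0 + \<psi>2 x \<eta> \<xi>))) (at y)"
    by (intro has_derivative_diff A.has_derivative H.FDERIV has_derivative_ident has_derivative_scaleR_right
        has_derivative_const has_derivative_along_fibre[OF F1.open_\<Omega> smooth_on_FD[OF F1.smooth_spray] sl(3)[OF y]])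
  from FD_eqI[OF this]
  have "FD (\<lambda>y. ?A (FD (spray F1) (x, y) (0, \<xi>)) - 2 *\<^sub>R \<psi>2 x y \<xi>) y \<eta> =
     ?A (FD (\<lambda>p. FD (spray F1) p (0, \<xi>)) (x, y) (0, \<eta>)) - 2 *\<^sub>R \<psi>2 x \<xi> \<eta>"
    using \<psi>2_commute[OF x, of \<xi> \<eta>] by (simp add: H.zero_right)
  moreover have "FD (\<lambda>y. FD (spray F2) (\<psi> x, ?A y) (0, ?A \<xi>)) y =
      FD (\<lambda>y. ?A (FD (spray F1) (x, y) (0, \<xi>)) - 2 *\<^sub>R \<psi>2 x y \<xi>) y"
    by (rule FD_cong[of "- {0}"]) (use first y in auto)
  ultimately have "FD (\<lambda>p. FD (spray F2) p (0, ?A \<xi>)) (\<psi> x, ?A y) (0, ?A \<eta>) =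
      ?A (FD (\<lambda>p. FD (spray F1) p (0, \<xi>)) (x, y) (0, \<eta>)) - 2 *\<^sub>R \<psi>2 x \<xi> \<eta>"
    using fun_cong[OF FD_eqI[OF chain[OF smooth_on_FD[OF F2.smooth_spray, of "(0, ?A \<xi>)"] y]], of \<eta>] by simp
  then show ?thesis
    by (simp add: zxy tangent_map_def berwald_def A.scaleR scaleR_diff_right)
qed

end

section \<open>Tangent vectors and vector fields in charts\<close>

definition trans_map :: "('i, 'p, 'e) atlas \<Rightarrow> 'i \<Rightarrow> 'i \<Rightarrow> 'e \<Rightarrow> 'e"
  where "trans_map A i j = chart_map A j \<circ> chart_inv A i"

definition chart_im :: "('i, 'p, 'e) atlas \<Rightarrow> 'i \<Rightarrow> 'e set"
  where "chart_im A i = chart_map A i ` chart_dom A i"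

definition overlap :: "('i, 'p, 'e) atlas \<Rightarrow> 'i \<Rightarrow> 'i \<Rightarrow> 'e set"
  where "overlap A i j = chart_map A i ` (chart_dom A i \<inter> chart_dom A j)"

text \<open>The tangent vector at \<open>p\<close> with prescribed component in one chart.\<close>
definition tvec :: "('i, 'p, 'e::euclidean_space) atlas \<Rightarrow> 'p \<Rightarrow> 'i \<Rightarrow> 'e \<Rightarrow> 'i \<Rightarrow> 'e"
  where "tvec A p i v = (\<lambda>j. if j \<in> charts_at A p then FD (trans_map A i j) (chart_map A i p) v else 0)"

text \<open>A vector field or section in the coordinates of one chart.\<close>
definition rep :: "('i, 'p, 'e) atlas \<Rightarrow> ('p \<Rightarrow> 'i \<Rightarrow> 'b) \<Rightarrow> 'i \<Rightarrow> 'e \<Rightarrow> 'b"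
  where "rep A Y i = (\<lambda>z. Y (chart_inv A i z) i)"

lemma charts_atD: "i \<in> charts_at A p \<Longrightarrow> i \<in> indices A" "i \<in> charts_at A p \<Longrightarrow> p \<in> chart_dom A i"
  by (auto simp: charts_at_def)

lemma points_iff: "p \<in> points A \<longleftrightarrow> (\<exists>i. i \<in> charts_at A p)"
  by (auto simp: points_def charts_at_def)

locale atlas =
  fixes A :: "('i, 'p, 'e::euclidean_space) atlas"
  assumes atlas: "smooth_atlas A"
begin

lemma inj_chart: "i \<in> indices A \<Longrightarrow> inj_on (chart_map A i) (chart_dom A i)"
  and open_im: "i \<in> indices A \<Longrightarrow> open (chart_im A i)"
  and open_overlap: "i \<in> indices A \<Longrightarrow> j \<in> indices A \<Longrightarrow> open (overlap A i j)"
  and smooth_trans: "i \<in> indices A \<Longrightarrow> j \<in> indices A \<Longrightarrow> smooth_on (overlap A i j) (trans_map A i j)"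
  using atlas unfolding smooth_atlas_def chart_im_def overlap_def trans_map_def by blast+

lemma chart_inv_chart: "i \<in> indices A \<Longrightarrow> p \<in> chart_dom A i \<Longrightarrow> chart_inv A i (chart_map A i p) = p"
  unfolding chart_inv_def using inj_chart by (rule inv_into_f_f)

lemma chart_chart_inv: "x \<in> chart_im A i \<Longrightarrow> chart_map A i (chart_inv A i x) = x"
  unfolding chart_inv_def chart_im_def by (rule f_inv_into_f)

lemma chart_inv_dom: "x \<in> chart_im A i \<Longrightarrow> chart_inv A i x \<in> chart_dom A i"
  unfolding chart_inv_def chart_im_def by (rule inv_into_into)

lemma chart_in_im: "p \<in> chart_dom A i \<Longrightarrow> chart_map A i p \<in> chart_im A i"
  by (simp add: chart_im_def)

lemma chart_in_overlap: "p \<in> chart_dom A i \<Longrightarrow> p \<in> chart_dom A j \<Longrightarrow> chart_map A i p \<in> overlap A i j"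
  by (simp add: overlap_def)

lemma overlap_iff: "i \<in> indices A \<Longrightarrow> x \<in> overlap A i j \<longleftrightarrow> x \<in> chart_im A i \<and> chart_inv A i x \<in> chart_dom A j"
  unfolding overlap_def chart_im_def using chart_inv_chart by (auto simp: image_iff)

lemma trans_chart: "i \<in> indices A \<Longrightarrow> p \<in> chart_dom A i \<Longrightarrow> trans_map A i j (chart_map A i p) = chart_map A j p"
  by (simp add: trans_map_def chart_inv_chart)

lemma trans_overlap: "i \<in> indices A \<Longrightarrow> x \<in> overlap A i j \<Longrightarrow> trans_map A i j x \<in> overlap A j i"
  unfolding overlap_def by (auto simp: trans_chart)

lemma chart_inv_trans:
  "i \<in> indices A \<Longrightarrow> j \<in> indices A \<Longrightarrow> x \<in> overlap A i j \<Longrightarrow> chart_inv A j (trans_map A i j x) = chart_inv A i x"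
  unfolding overlap_def by (auto simp: trans_chart chart_inv_chart)

lemma FD_trans_self:
  assumes "i \<in> indices A" "x \<in> chart_im A i"
  shows "FD (trans_map A i i) x = (\<lambda>v. v)"
proof -
  have "FD (trans_map A i i) x = FD (\<lambda>x. x) x"
    by (rule FD_cong[OF open_im[OF assms(1)] assms(2)]) (simp add: trans_map_def chart_chart_inv)
  then show ?thesis by simp
qed

lemma FD_trans_trans:
  assumes "i \<in> charts_at A p" "j \<in> charts_at A p" "k \<in> charts_at A p"
  shows "FD (trans_map A j k) (chart_map A j p) (FD (trans_map A i j) (chart_map A i p) v) =
    FD (trans_map A i k) (chart_map A i p) v"
proof -
  note ijk = assms[THEN charts_atD(1)] assms[THEN charts_atD(2)]
  let ?x = "chart_map A i p"
  have "FD (trans_map A i k) ?x = FD (\<lambda>x. trans_map A j k (trans_map A i j x)) ?x"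
  proof (rule FD_cong)
    show "open (overlap A i j \<inter> overlap A i k)" using open_overlap ijk by blast
    show "?x \<in> overlap A i j \<inter> overlap A i k" using chart_in_overlap ijk by blast
    show "trans_map A i k x = trans_map A j k (trans_map A i j x)" if "x \<in> overlap A i j \<inter> overlap A i k" for x
      using that chart_inv_trans[of i j x] ijk by (simp add: trans_map_def)
  qed
  also have "\<dots> = (\<lambda>v. FD (trans_map A j k) (trans_map A i j ?x) (FD (trans_map A i j) ?x v))"
  proof (rule FD_eqI)
    have "(trans_map A i j has_derivative FD (trans_map A i j) ?x) (at ?x)"
      using smooth_on_has_derivative smooth_trans chart_in_overlap ijk by blast
    moreover have "(trans_map A j k has_derivative FD (trans_map A j k) (trans_map A i j ?x)) (at (trans_map A i j ?x))"
      using smooth_on_has_derivative[OF smooth_trans[of j k]] chart_in_overlap ijk by (simp add: trans_chart)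
    ultimately show "((\<lambda>x. trans_map A j k (trans_map A i j x)) has_derivative
       (\<lambda>v. FD (trans_map A j k) (trans_map A i j ?x) (FD (trans_map A i j) ?x v))) (at ?x)"
      using diff_chain_at by (fastforce simp: o_def)
  qed
  finally show ?thesis using ijk by (simp add: trans_chart)
qed

lemma linear_FD_trans:
  "i \<in> indices A \<Longrightarrow> j \<in> indices A \<Longrightarrow> x \<in> overlap A i j \<Longrightarrow> linear (FD (trans_map A i j) x)"
  using linear_FD smooth_trans by blast

lemma inj_FD_trans:
  assumes "i \<in> indices A" "j \<in> indices A" "x \<in> overlap A i j"
  shows "inj (FD (trans_map A i j) x)"
proof -
  obtain p where p: "p \<in> chart_dom A i" "p \<in> chart_dom A j" "x = chart_map A i p"
    using assms(3) by (auto simp: overlap_def)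
  have c: "i \<in> charts_at A p" "j \<in> charts_at A p" using p assms by (auto simp: charts_at_def)
  show ?thesis
    unfolding p(3) using FD_trans_trans[OF c c(1)] FD_trans_self[OF assms(1) chart_in_im[OF p(1)]]
    by (metis injI)
qed

lemma tangent_change:
  "v \<in> tangent_space A p \<Longrightarrow> i \<in> charts_at A p \<Longrightarrow> j \<in> charts_at A p \<Longrightarrow>
    v j = FD (trans_map A i j) (chart_map A i p) (v i)"
  unfolding tangent_space_def trans_map_def by blast

lemma tangent_outside: "v \<in> tangent_space A p \<Longrightarrow> i \<notin> charts_at A p \<Longrightarrow> v i = 0"
  unfolding tangent_space_def by blast

lemma tangent_eqI:
  assumes "v \<in> tangent_space A p" "w \<in> tangent_space A p" "i \<in> charts_at A p" "v i = w i"
  shows "v = w"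
proof
  fix j show "v j = w j"
  proof (cases "j \<in> charts_at A p")
    case True
    show ?thesis
      unfolding tangent_change[OF assms(1,3) True] tangent_change[OF assms(2,3) True] assms(4) ..
  next
    case False
    show ?thesis
      unfolding tangent_outside[OF assms(1) False] tangent_outside[OF assms(2) False] ..
  qed
qed

text \<open>By the cocycle rule it suffices to compare all components with one of them.\<close>
lemma tangentI:
  assumes "i \<in> charts_at A p" "\<And>j. j \<notin> charts_at A p \<Longrightarrow> v j = 0"
    "\<And>j. j \<in> charts_at A p \<Longrightarrow> v j = FD (trans_map A i j) (chart_map A i p) (v i)"
  shows "v \<in> tangent_space A p"
  unfolding tangent_space_def trans_map_def[symmetric]
proof (intro CollectI conjI allI impI ballI assms(2))
  fix j k assume "j \<in> charts_at A p" "k \<in> charts_at A p"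
  then show "v k = FD (trans_map A j k) (chart_map A j p) (v j)"
    by (simp only: assms(3)[of j] assms(3)[of k] FD_trans_trans[OF assms(1)])
qed

lemma tvec_self: assumes "i \<in> charts_at A p" shows "tvec A p i v i = v"
  unfolding tvec_def if_P[OF assms] FD_trans_self[OF charts_atD(1)[OF assms] chart_in_im[OF charts_atD(2)[OF assms]]] ..

lemma tvec_tangent: assumes i: "i \<in> charts_at A p" shows "tvec A p i v \<in> tangent_space A p"
  by (rule tangentI[OF i]) (simp_all add: tvec_self[OF i], simp_all add: tvec_def)

lemma tangent_eq_tvec: "v \<in> tangent_space A p \<Longrightarrow> i \<in> charts_at A p \<Longrightarrow> v = tvec A p i (v i)"
  by (rule tangent_eqI) (auto simp: tvec_tangent tvec_self)

lemma tangent_zero: "0 \<in> tangent_space A p"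
  and tangent_add: "v \<in> tangent_space A p \<Longrightarrow> w \<in> tangent_space A p \<Longrightarrow> v + w \<in> tangent_space A p"
  and tangent_scaleR: "v \<in> tangent_space A p \<Longrightarrow> c *\<^sub>R v \<in> tangent_space A p"
proof -
  have lin: "linear (FD (trans_map A i j) (chart_map A i p))"
    if "i \<in> charts_at A p" "j \<in> charts_at A p" for i j
    using that linear_FD_trans chart_in_overlap charts_atD by metis
  show "0 \<in> tangent_space A p"
    unfolding tangent_space_def trans_map_def[symmetric] using linear_0[OF lin] by auto
  show "v + w \<in> tangent_space A p" if v: "v \<in> tangent_space A p" and w: "w \<in> tangent_space A p"
    unfolding tangent_space_def trans_map_def[symmetric]
  proof (intro CollectI conjI allI impI ballI)
    show "(v + w) i = 0" if "i \<notin> charts_at A p" for i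
      using tangent_outside[OF v that] tangent_outside[OF w that] by simp
    show "(v + w) j = FD (trans_map A i j) (chart_map A i p) ((v + w) i)"
      if "i \<in> charts_at A p" "j \<in> charts_at A p" for i j
      by (simp only: plus_fun_apply linear_add[OF lin[OF that]] tangent_change[OF v that, symmetric]
          tangent_change[OF w that, symmetric])
  qed
  show "c *\<^sub>R v \<in> tangent_space A p" if v: "v \<in> tangent_space A p"
    unfolding tangent_space_def trans_map_def[symmetric]
  proof (intro CollectI conjI allI impI ballI)
    show "(c *\<^sub>R v) i = 0" if "i \<notin> charts_at A p" for i
      using tangent_outside[OF v that] by (simp add: scaleR_fun_def)
    show "(c *\<^sub>R v) j = FD (trans_map A i j) (chart_map A i p) ((c *\<^sub>R v) i)"
      if "i \<in> charts_at A p" "j \<in> charts_at A p" for i j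
      by (simp only: scaleR_fun_def linear_scale[OF lin[OF that]] tangent_change[OF v that, symmetric])
  qed
qed

lemma tangent_diff:
  "v \<in> tangent_space A p \<Longrightarrow> w \<in> tangent_space A p \<Longrightarrow> v - w \<in> tangent_space A p"
  using tangent_add[of v p "(-1) *\<^sub>R w"] tangent_scaleR[of w p "-1"] by simp

lemma tangent_sum: "(\<And>a. a \<in> I \<Longrightarrow> v a \<in> tangent_space A p) \<Longrightarrow> (\<Sum>a\<in>I. v a) \<in> tangent_space A p"
  by (induction I rule: infinite_finite_induct) (auto intro: tangent_zero tangent_add)

lemma rep_chart: "i \<in> indices A \<Longrightarrow> p \<in> chart_dom A i \<Longrightarrow> rep A Y i (chart_map A i p) = Y p i"
  by (simp add: rep_def chart_inv_chart)

lemma fun_deriv_chart: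
  assumes f: "smooth_fun A f" and i: "i \<in> charts_at A p" and w: "w \<in> tangent_space A p"
  shows "fun_deriv A f p w = FD (f \<circ> chart_inv A i) (chart_map A i p) (w i)"
proof -
  define j where "j = (SOME i. i \<in> charts_at A p)"
  have j: "j \<in> charts_at A p" unfolding j_def using i by (rule someI)
  note ij = i[THEN charts_atD(1)] i[THEN charts_atD(2)] j[THEN charts_atD(1)] j[THEN charts_atD(2)]
  have sm: "smooth_on (chart_im A k) (f \<circ> chart_inv A k)" if "k \<in> indices A" for k
    using f that by (simp add: smooth_fun_def chart_im_def)
  let ?x = "chart_map A i p"
  have "FD (f \<circ> chart_inv A i) ?x = FD ((f \<circ> chart_inv A j) \<circ> trans_map A i j) ?x"
  proof (rule FD_cong[OF open_overlap[OF ij(1,3)]])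
    show "?x \<in> overlap A i j" using chart_in_overlap ij by blast
    show "(f \<circ> chart_inv A i) x = (f \<circ> chart_inv A j \<circ> trans_map A i j) x" if "x \<in> overlap A i j" for x
      using chart_inv_trans[OF ij(1,3) that] by simp
  qed
  also have "\<dots> = FD (f \<circ> chart_inv A j) (chart_map A j p) \<circ> FD (trans_map A i j) ?x"
    using smooth_on_has_derivative[OF smooth_trans[OF ij(1,3)], of ?x]
      smooth_on_has_derivative[OF sm[OF ij(3)], of "chart_map A j p"] chart_in_overlap chart_in_im ij
    by (intro FD_eqI diff_chain_at) (auto simp: trans_chart)
  finally show ?thesis
    using tangent_change[OF w i j] by (simp add: fun_deriv_def j_def[symmetric] Let_def)
qed

lemma smooth_rep: "X \<in> vector_fields A \<Longrightarrow> i \<in> indices A \<Longrightarrow> smooth_on (chart_im A i) (rep A X i)"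
  by (simp add: vector_fields_def chart_im_def rep_def)

lemma vector_field_tangent: "X \<in> vector_fields A \<Longrightarrow> X p \<in> tangent_space A p"
  using tangent_zero by (cases "p \<in> points A") (auto simp: vector_fields_def)

lemma rep_change:
  assumes "X \<in> vector_fields A" "i \<in> indices A" "j \<in> indices A" "z \<in> overlap A i j"
  shows "rep A X j (trans_map A i j z) = FD (trans_map A i j) z (rep A X i z)"
proof -
  have z: "z \<in> chart_im A i" "chart_inv A i z \<in> chart_dom A j" using assms overlap_iff by auto
  then have c: "i \<in> charts_at A (chart_inv A i z)" "j \<in> charts_at A (chart_inv A i z)"
    using assms chart_inv_dom by (auto simp: charts_at_def)
  show ?thesis
    using tangent_change[OF vector_field_tangent[OF assms(1)] c] assms
    by (simp add: rep_def chart_inv_trans chart_chart_inv z)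
qed

text \<open>The components of a vector field in two charts are related by \<open>Y\<^sub>j(\<psi> z) = \<psi>'(z) Y\<^sub>i(z)\<close>. Differentiation
  produces second derivatives of \<open>\<psi>\<close>, which drop out of the bracket by symmetry.\<close>
lemma lie_bracket_tangent:
  assumes X: "X \<in> vector_fields A" and Y: "Y \<in> vector_fields A" and p: "p \<in> points A"
  shows "lie_bracket A X Y p \<in> tangent_space A p"
proof -
  obtain i where i: "i \<in> charts_at A p" using p points_iff by metis
  show ?thesis
  proof (rule tangentI[OF i])
    show "lie_bracket A X Y p j = 0" if "j \<notin> charts_at A p" for j
      using that by (simp add: lie_bracket_def)
    fix j assume j: "j \<in> charts_at A p"
    note ij = i[THEN charts_atD(1)] i[THEN charts_atD(2)] j[THEN charts_atD(1)] j[THEN charts_atD(2)]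
    let ?z = "chart_map A i p" and ?\<psi> = "trans_map A i j"
    have z: "?z \<in> overlap A i j" using chart_in_overlap ij by blast
    have main: "FD (rep A Y j) (chart_map A j p) (FD ?\<psi> ?z a) =
      FD (\<lambda>x. FD ?\<psi> x (Y p i)) ?z a + FD ?\<psi> ?z (FD (rep A Y i) ?z a)"
      if Y: "Y \<in> vector_fields A" for Y a
    proof -
      have "FD (\<lambda>z. rep A Y j (?\<psi> z)) ?z = FD (\<lambda>z. FD ?\<psi> z (rep A Y i z)) ?z"
        by (rule FD_cong[OF open_overlap[OF ij(1,3)] z rep_change[OF Y ij(1,3)]])
      moreover have "FD (\<lambda>z. rep A Y j (?\<psi> z)) ?z = (\<lambda>a. FD (rep A Y j) (chart_map A j p) (FD ?\<psi> ?z a))"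
        using diff_chain_at[OF smooth_on_has_derivative[OF smooth_trans[OF ij(1,3)] z],
            of "rep A Y j" "FD (rep A Y j) (chart_map A j p)"]
          smooth_on_has_derivative[OF smooth_rep[OF Y ij(3)] chart_in_im[OF ij(4)]]
        by (intro FD_eqI) (simp add: trans_chart[OF ij(1,2)] o_def)
      moreover have "FD (\<lambda>z. FD ?\<psi> z (rep A Y i z)) ?z a =
          FD (\<lambda>p. FD ?\<psi> p (rep A Y i ?z)) ?z a + FD ?\<psi> ?z (FD (rep A Y i) ?z a)"
        by (rule FD_moving_direction[OF open_overlap[OF ij(1,3)] smooth_trans[OF ij(1,3)] z
            smooth_on_has_derivative[OF smooth_rep[OF Y ij(1)] chart_in_im[OF ij(2)]]])
      ultimately show ?thesis by (simp add: rep_chart[OF ij(1,2)] fun_eq_iff)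
    qed
    have b: "lie_bracket A X Y p k = FD (rep A Y k) (chart_map A k p) (X p k) - FD (rep A X k) (chart_map A k p) (Y p k)"
      if "k \<in> charts_at A p" for k using that by (simp add: lie_bracket_def rep_def)
    interpret linear "FD ?\<psi> ?z" using linear_FD_trans[OF ij(1,3) z] .
    have "lie_bracket A X Y p j = FD (rep A Y j) (chart_map A j p) (FD ?\<psi> ?z (X p i)) -
        FD (rep A X j) (chart_map A j p) (FD ?\<psi> ?z (Y p i))"
      using tangent_change[OF vector_field_tangent[OF X] i j] tangent_change[OF vector_field_tangent[OF Y] i j]
      by (simp add: b[OF j])
    also have "\<dots> = FD ?\<psi> ?z (FD (rep A Y i) ?z (X p i) - FD (rep A X i) ?z (Y p i))"
      unfolding main[OF X] main[OF Y] diff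
      using FD_FD_commute[OF open_overlap[OF ij(1,3)] smooth_trans[OF ij(1,3)] z] by simp
    finally show "lie_bracket A X Y p j = FD ?\<psi> ?z (lie_bracket A X Y p i)" by (simp add: b[OF i])
  qed
qed

end

section \<open>The slit tangent bundle\<close>

text \<open>This locale is an extension without new hypotheses. It interprets the preceding one for the slit
  tangent bundle, which is an atlas on a different type; inside \<open>atlas\<close> itself that would repeat forever.\<close>
locale base_atlas = atlas A for A :: "('i, 'p, 'e::euclidean_space) atlas"
begin

abbreviation "P \<equiv> slit_bundle A"

lemma slit_indices [simp]: "indices P = indices A"
  and slit_dom: "u \<in> chart_dom P i \<longleftrightarrow> fst u \<in> chart_dom A i \<and> snd u \<in> tangent_space A (fst u) \<and> snd u \<noteq> 0"
  and slit_map: "chart_map P i u = (chart_map A i (fst u), snd u i)"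
  by (auto simp: slit_bundle_def tangent_bundle_def)

lemma slit_points: "u \<in> points P \<longleftrightarrow> fst u \<in> points A \<and> snd u \<in> tangent_space A (fst u) \<and> snd u \<noteq> 0"
  by (auto simp: points_def slit_dom)

lemma slit_charts: "u \<in> points P \<Longrightarrow> charts_at P u = charts_at A (fst u)"
  by (auto simp: charts_at_def slit_dom slit_points)

lemma tangent_nonzero:
  assumes "v \<in> tangent_space A p" "i \<in> charts_at A p"
  shows "v i = 0 \<longleftrightarrow> v = 0"
  using tangent_eqI[OF assms(1) tangent_zero assms(2)] by auto

text \<open>The fibre component of a tangent vector can be prescribed freely in one chart, and it vanishes only for
  the zero vector.\<close>
lemma slit_im: assumes i: "i \<in> indices A" shows "chart_im P i = slit (chart_im A i)"
  and slit_overlap: "overlap P i j = slit (overlap A i j)"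
proof -
  have 1: "chart_map P i u \<in> slit (overlap A i j)" if "u \<in> chart_dom P i" "fst u \<in> chart_dom A j" for u j
    using that tangent_nonzero[of "snd u" "fst u" i] i
    by (auto simp: slit_dom slit_map charts_at_def overlap_def)
  have 2: "\<exists>u\<in>chart_dom P i. fst u \<in> chart_dom A j \<and> z = chart_map P i u" if zo: "z \<in> slit (overlap A i j)" for z j
  proof -
    obtain p y where z: "z = (chart_map A i p, y)" "p \<in> chart_dom A i" "p \<in> chart_dom A j" "y \<noteq> 0"
      using zo by (cases z) (auto simp: overlap_def)
    have c: "i \<in> charts_at A p" using z i by (simp add: charts_at_def)
    have "(p, tvec A p i y) \<in> chart_dom P i"
      using z tvec_tangent[OF c] tvec_self[OF c, of y] by (auto simp: slit_dom)
    then show ?thesis using z tvec_self[OF c, of y] by (intro bexI[of _ "(p, tvec A p i y)"]) (auto simp: slit_map)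
  qed
  have "overlap A i i = chart_im A i" by (simp add: overlap_def chart_im_def)
  note ii = this
  show "chart_im P i = slit (chart_im A i)"
  proof
    show "chart_im P i \<subseteq> slit (chart_im A i)"
      unfolding chart_im_def[of P]
    proof (rule image_subsetI)
      fix u assume u: "u \<in> chart_dom P i"
      then show "chart_map P i u \<in> slit (chart_im A i)"
        using 1[OF u, of i] unfolding ii slit_dom by blast
    qed
    show "slit (chart_im A i) \<subseteq> chart_im P i"
      using 2[of _ i] unfolding ii chart_im_def[of P] by blast
  qed
  show "overlap P i j = slit (overlap A i j)"
  proof
    show "overlap P i j \<subseteq> slit (overlap A i j)"
      unfolding overlap_def[of P]
    proof (rule image_subsetI)
      fix u assume u: "u \<in> chart_dom P i \<inter> chart_dom P j"
      then show "chart_map P i u \<in> slit (overlap A i j)"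
        by (intro 1) (use u in \<open>auto simp: slit_dom\<close>)
    qed
    show "slit (overlap A i j) \<subseteq> overlap P i j"
    proof
      fix z assume "z \<in> slit (overlap A i j)"
      from 2[OF this] obtain u where u: "u \<in> chart_dom P i" "fst u \<in> chart_dom A j" "z = chart_map P i u"
        by (elim bexE conjE)
      then have "u \<in> chart_dom P i \<inter> chart_dom P j" by (simp add: slit_dom)
      then show "z \<in> overlap P i j" unfolding overlap_def u(3) by (rule imageI)
    qed
  qed
qed

lemma inj_slit: assumes i: "i \<in> indices A" shows "inj_on (chart_map P i) (chart_dom P i)"
proof (rule inj_onI)
  fix u v assume u: "u \<in> chart_dom P i" and v: "v \<in> chart_dom P i" and eq: "chart_map P i u = chart_map P i v"
  have 1: "fst u = fst v" using inj_onD[OF inj_chart[OF i]] u v eq by (auto simp: slit_dom slit_map)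
  moreover have "snd u = snd v"
    by (rule tangent_eqI[of _ "fst v" _ i]) (use u v eq 1 i in \<open>auto simp: slit_dom slit_map charts_at_def\<close>)
  ultimately show "u = v" by (rule prod_eqI)
qed

lemma slit_inv:
  assumes i: "i \<in> indices A" and x: "x \<in> chart_im A i" and y: "y \<noteq> 0"
  shows "chart_inv P i (x, y) = (chart_inv A i x, tvec A (chart_inv A i x) i y)"
proof -
  let ?p = "chart_inv A i x"
  have c: "i \<in> charts_at A ?p" using i x chart_inv_dom by (simp add: charts_at_def)
  have "(?p, tvec A ?p i y) \<in> chart_dom P i"
    using tvec_tangent[OF c] tvec_self[OF c, of y] y charts_atD[OF c] by (auto simp: slit_dom)
  moreover have "chart_map P i (?p, tvec A ?p i y) = (x, y)"
    using x tvec_self[OF c] by (simp add: slit_map chart_chart_inv)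
  ultimately show ?thesis unfolding chart_inv_def[of P] using inv_into_f_f[OF inj_slit[OF i]] by metis
qed

lemma fst_slit_inv: "i \<in> indices A \<Longrightarrow> z \<in> slit (chart_im A i) \<Longrightarrow> fst (chart_inv P i z) = chart_inv A i (fst z)"
  by (cases z) (simp add: slit_inv)

lemma overlap_im: "overlap A i j \<subseteq> chart_im A i"
  by (auto simp: overlap_def chart_im_def)

lemma slit_trans:
  assumes i: "i \<in> indices A" and j: "j \<in> indices A" and z: "z \<in> slit (overlap A i j)"
  shows "trans_map P i j z = tangent_map (trans_map A i j) z"
proof -
  obtain x y where xy: "z = (x, y)" "x \<in> overlap A i j" "y \<noteq> 0" using z by auto
  have x: "x \<in> chart_im A i" "chart_inv A i x \<in> chart_dom A j" using overlap_iff[OF i] xy by auto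
  then have c: "j \<in> charts_at A (chart_inv A i x)" using j by (simp add: charts_at_def)
  show ?thesis
    using c x xy by (simp add: trans_map_def[of P] slit_inv[OF i] slit_map tvec_def tangent_map_def chart_chart_inv)
      (simp add: trans_map_def)
qed

lemma slit_atlas: "smooth_atlas P"
  unfolding smooth_atlas_def
proof (intro conjI ballI)
  fix i assume "i \<in> indices P" then have i: "i \<in> indices A" by simp
  show "inj_on (chart_map P i) (chart_dom P i)" by (rule inj_slit[OF i])
  show "open (chart_map P i ` chart_dom P i)"
    unfolding chart_im_def[symmetric] slit_im[OF i] using open_im[OF i] by simp
  fix j assume "j \<in> indices P" then have j: "j \<in> indices A" by simp
  note o = open_overlap[OF i j]
  show "open (chart_map P i ` (chart_dom P i \<inter> chart_dom P j))"
    unfolding overlap_def[symmetric] slit_overlap[OF i] using o by simp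
  have "smooth_on (slit (overlap A i j)) (trans_map P i j)"
  proof (rule smooth_on_cong)
    show "smooth_on (slit (overlap A i j)) (tangent_map (trans_map A i j))"
      by (rule smooth_on_subset[OF smooth_on_tangent_map[OF o smooth_trans[OF i j]]]) auto
  qed (use o slit_trans[OF i j] in auto)
  then show "smooth_on (chart_map P i ` (chart_dom P i \<inter> chart_dom P j)) (chart_map P j \<circ> chart_inv P i)"
    unfolding overlap_def[symmetric] slit_overlap[OF i] trans_map_def .
qed

sublocale P: atlas P by (rule atlas.intro) (rule slit_atlas)

lemma chart_slit: "u \<in> chart_dom P i \<Longrightarrow> i \<in> indices A \<Longrightarrow> chart_map P i u \<in> slit (chart_im A i)"
  using P.chart_in_im[of u i] slit_im[of i] by simp

lemma slit_tangent_change: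
  assumes w: "w \<in> tangent_space P u" and i: "i \<in> charts_at P u" and j: "j \<in> charts_at P u"
  shows "w j = FD (tangent_map (trans_map A i j)) (chart_map P i u) (w i)"
proof -
  note ij = i[THEN charts_atD(1)] i[THEN charts_atD(2)] j[THEN charts_atD(1)] j[THEN charts_atD(2)]
  have z: "chart_map P i u \<in> slit (overlap A i j)"
    using P.chart_in_overlap[OF ij(2,4)] slit_overlap[of i j] ij by simp
  have "FD (trans_map P i j) (chart_map P i u) = FD (tangent_map (trans_map A i j)) (chart_map P i u)"
    by (rule FD_cong[OF _ z slit_trans]) (use ij open_overlap in auto)
  then show ?thesis using P.tangent_change[OF w i j] by simp
qed

text \<open>The transition maps of the slit tangent bundle are the tangent maps of those of the base, hence the
  second derivative in the vertical component.\<close>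
lemma slit_tangent_change':
  assumes w: "w \<in> tangent_space P u" and i: "i \<in> charts_at P u" and j: "j \<in> charts_at P u"
  shows "fst (w j) = FD (trans_map A i j) (chart_map A i (fst u)) (fst (w i))"
    "snd (w j) = FD (\<lambda>x. FD (trans_map A i j) x (snd u i)) (chart_map A i (fst u)) (fst (w i)) +
      FD (trans_map A i j) (chart_map A i (fst u)) (snd (w i))"
proof -
  note ij = i[THEN charts_atD(1)] i[THEN charts_atD(2)] j[THEN charts_atD(1)] j[THEN charts_atD(2)]
  have x: "chart_map A i (fst u) \<in> overlap A i j" using ij by (intro chart_in_overlap) (auto simp: slit_dom)
  show "fst (w j) = FD (trans_map A i j) (chart_map A i (fst u)) (fst (w i))"
    "snd (w j) = FD (\<lambda>x. FD (trans_map A i j) x (snd u i)) (chart_map A i (fst u)) (fst (w i)) +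
      FD (trans_map A i j) (chart_map A i (fst u)) (snd (w i))"
    unfolding slit_tangent_change[OF w i j]
    using FD_tangent_map[OF open_overlap smooth_trans, of i j "chart_map P i u" "w i"] ij x by (simp_all add: slit_map)
qed

lemma rho_apply:
  assumes u: "u \<in> points P" and w: "w \<in> tangent_space P u"
  shows "rho A u w j = fst (w j)"
proof (cases "j \<in> charts_at P u")
  case True
  define i where "i = (SOME i. i \<in> charts_at P u)"
  have i: "i \<in> charts_at P u" unfolding i_def using True by (rule someI)
  note ij = i[THEN charts_atD(1), simplified] i[THEN charts_atD(2)] True[THEN charts_atD(1), simplified] True[THEN charts_atD(2)]
  have z: "chart_map P i u \<in> slit (overlap A i j)"
    using P.chart_in_overlap[OF ij(2,4)] slit_overlap[of i j] ij by simp
  have "FD (chart_map A j \<circ> fst \<circ> chart_inv P i) (chart_map P i u) = FD (\<lambda>z. trans_map A i j (fst z)) (chart_map P i u)"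
  proof (rule FD_cong[OF _ z])
    show "open (slit (overlap A i j))" using open_overlap ij by simp
    show "(chart_map A j \<circ> fst \<circ> chart_inv P i) z = trans_map A i j (fst z)" if "z \<in> slit (overlap A i j)" for z
    proof -
      have "z \<in> slit (chart_im A i)" using that overlap_im by blast
      from fst_slit_inv[OF ij(1) this] show ?thesis by (simp add: trans_map_def)
    qed
  qed
  also have "\<dots> = (\<lambda>w. FD (trans_map A i j) (fst (chart_map P i u)) (fst w))"
    using diff_chain_at[OF has_derivative_fst[OF has_derivative_ident] smooth_on_has_derivative[OF smooth_trans[OF ij(1,3)]],
       of "chart_map P i u"] z
    by (intro FD_eqI) (auto simp: o_def)
  finally show ?thesis
    using True slit_tangent_change'(1)[OF w i True] unfolding slit_charts[OF u, symmetric]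
      rho_def differential_def i_def[symmetric] Let_def by (simp add: slit_map)
next
  case False
  then show ?thesis using P.tangent_outside[OF w False] slit_charts[OF u]
    by (simp add: rho_def differential_def)
qed

lemma rho_tangent:
  assumes u: "u \<in> points P" and w: "w \<in> tangent_space P u"
  shows "rho A u w \<in> tangent_space A (fst u)"
proof -
  obtain i where i: "i \<in> charts_at P u" using u points_iff by metis
  show ?thesis
  proof (rule tangentI)
    show "i \<in> charts_at A (fst u)" using i slit_charts[OF u] by simp
    show "rho A u w j = 0" if "j \<notin> charts_at A (fst u)" for j
      using P.tangent_outside[OF w, of j] that slit_charts[OF u] by (simp add: rho_apply[OF u w])
    show "rho A u w j = FD (trans_map A i j) (chart_map A i (fst u)) (rho A u w i)" if "j \<in> charts_at A (fst u)" for j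
      unfolding rho_apply[OF u w] using slit_tangent_change'(1)[OF w i] that slit_charts[OF u] by blast
  qed
qed

lemma gamma_apply:
  assumes u: "u \<in> points P" and v: "v \<in> tangent_space A (fst u)"
  shows "gamma A u v = (\<lambda>i. (0, v i))"
proof
  fix i
  show "gamma A u v i = (0, v i)"
  proof (cases "i \<in> charts_at P u")
    case True
    have "((\<lambda>t. (chart_map A i (fst u), snd u i + t *\<^sub>R v i)) has_vector_derivative (0, v i)) (at 0)"
      unfolding has_vector_derivative_def by (auto intro!: derivative_eq_intros)
    moreover have "chart_map P i \<circ> (\<lambda>t. (fst u, snd u + t *\<^sub>R v)) =
        (\<lambda>t. (chart_map A i (fst u), snd u i + t *\<^sub>R v i))"
      by (simp add: fun_eq_iff slit_map scaleR_fun_def)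
    moreover have "(fst u, snd u + 0 *\<^sub>R v) = u" by simp
    ultimately show ?thesis using True
      unfolding gamma_def velocity_def by (simp only: if_True vector_derivative_at)
  next
    case False
    moreover have "(fst u, snd u + 0 *\<^sub>R v) = u" by simp
    ultimately have "gamma A u v i = 0" unfolding gamma_def velocity_def by (simp only: if_False)
    then show ?thesis using False tangent_outside[OF v, of i] slit_charts[OF u]
      by (simp add: zero_prod_def)
  qed
qed

lemma gamma_tangent:
  assumes u: "u \<in> points P" and v: "v \<in> tangent_space A (fst u)"
  shows "gamma A u v \<in> tangent_space P u"
proof -
  obtain i where i: "i \<in> charts_at P u" using u points_iff by metis
  show ?thesis unfolding gamma_apply[OF u v]
  proof (rule P.tangentI[OF i])
    show "(0, v j) = (0::'e \<times> 'e)" if "j \<notin> charts_at P u" for j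
      using tangent_outside[OF v, of j] that slit_charts[OF u] by (simp add: zero_prod_def)
    fix j assume j: "j \<in> charts_at P u"
    note ij = i[THEN charts_atD(1), simplified] i[THEN charts_atD(2)] j[THEN charts_atD(1), simplified] j[THEN charts_atD(2)]
    let ?x = "chart_map A i (fst u)"
    have x: "?x \<in> overlap A i j" using ij by (intro chart_in_overlap) (auto simp: slit_dom)
    have z: "chart_map P i u \<in> slit (overlap A i j)"
      using P.chart_in_overlap[OF ij(2,4)] slit_overlap[of i j] ij by simp
    have "FD (trans_map P i j) (chart_map P i u) (0, v i) = FD (tangent_map (trans_map A i j)) (chart_map P i u) (0, v i)"
      using FD_cong[OF _ z slit_trans[of i j]] ij open_overlap by simp
    also have "\<dots> = (0, FD (trans_map A i j) ?x (v i))"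
      using FD_tangent_map[OF open_overlap smooth_trans, of i j "chart_map P i u" "(0, v i)"] ij x
        linear_0[OF linear_FD_trans[OF ij(1,3) x]] linear_0[OF linear_FD[OF smooth_on_FD[OF smooth_trans[OF ij(1,3)]] x]]
      by (simp add: slit_map)
    also have "\<dots> = (0, v j)"
      using tangent_change[OF v, of i j] i j slit_charts[OF u] by simp
    finally show "(0, v j) = FD (trans_map P i j) (chart_map P i u) (0, v i)" by simp
  qed
qed

subsection \<open>Sections\<close>

lemma pb_outside: "Y \<in> pb_sections A \<Longrightarrow> u \<notin> points P \<Longrightarrow> Y u = 0"
  unfolding pb_sections_def by blast

lemma pb_tangent: assumes "Y \<in> pb_sections A" shows "Y u \<in> tangent_space A (fst u)"
proof (cases "u \<in> points P")
  case True
  then show ?thesis using assms unfolding pb_sections_def by blast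
next
  case False
  then show ?thesis using pb_outside[OF assms] tangent_zero by simp
qed

lemma pb_smooth: "Y \<in> pb_sections A \<Longrightarrow> i \<in> indices A \<Longrightarrow> smooth_on (slit (chart_im A i)) (rep P Y i)"
  unfolding slit_im[symmetric] by (simp add: pb_sections_def chart_im_def rep_def)

lemma pbI:
  assumes "\<And>u. u \<in> points P \<Longrightarrow> Y u \<in> tangent_space A (fst u)" "\<And>u. u \<notin> points P \<Longrightarrow> Y u = 0"
    "\<And>i. i \<in> indices A \<Longrightarrow> smooth_on (slit (chart_im A i)) (rep P Y i)"
  shows "Y \<in> pb_sections A"
  using assms slit_im unfolding pb_sections_def by (simp add: chart_im_def rep_def)

lemma vf_smooth: "X \<in> vector_fields P \<Longrightarrow> i \<in> indices A \<Longrightarrow> smooth_on (slit (chart_im A i)) (rep P X i)"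
  using P.smooth_rep[of X i] slit_im[of i] by simp

lemma vfI:
  assumes "\<And>u. u \<in> points P \<Longrightarrow> X u \<in> tangent_space P u" "\<And>u. u \<notin> points P \<Longrightarrow> X u = 0"
    "\<And>i. i \<in> indices A \<Longrightarrow> smooth_on (slit (chart_im A i)) (rep P X i)"
  shows "X \<in> vector_fields P"
  using assms slit_im unfolding vector_fields_def by (simp add: chart_im_def rep_def)

lemma smooth_fun_slit:
  "smooth_fun P f \<longleftrightarrow> (\<forall>i\<in>indices A. smooth_on (slit (chart_im A i)) (f \<circ> chart_inv P i))"
  unfolding smooth_fun_def chart_im_def[symmetric] using slit_im by simp

lemma open_slit_im: "i \<in> indices A \<Longrightarrow> open (slit (chart_im A i))"
  using open_im by simp

lemma rep_slit: "u \<in> chart_dom P i \<Longrightarrow> i \<in> indices A \<Longrightarrow> rep P Y i (chart_map P i u) = Y u i"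
  using P.rep_chart by simp

lemma pb_change:
  assumes Y: "Y \<in> pb_sections A" and i: "i \<in> indices A" and j: "j \<in> indices A" and z: "z \<in> slit (overlap A i j)"
  shows "rep P Y j (trans_map P i j z) = FD (trans_map A i j) (fst z) (rep P Y i z)"
proof -
  have z': "z \<in> overlap P i j" using z slit_overlap[OF i] by simp
  have zi: "z \<in> slit (chart_im A i)" using z overlap_im by auto
  have d: "chart_inv A i (fst z) \<in> chart_dom A i" "chart_inv A i (fst z) \<in> chart_dom A j"
    "chart_map A i (chart_inv A i (fst z)) = fst z"
    using z overlap_iff[OF i, of "fst z"] chart_inv_dom chart_chart_inv by auto
  show ?thesis
    using tangent_change[OF pb_tangent[OF Y, of "chart_inv P i z"], of i j] d i j
    by (simp add: rep_def P.chart_inv_trans[of i j z] z' fst_slit_inv[OF i zi] charts_at_def)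
qed

lemma pb_zero: "0 \<in> pb_sections A"
  by (rule pbI) (auto simp: tangent_zero rep_def)

lemma pb_add: assumes "Y \<in> pb_sections A" "Z \<in> pb_sections A" shows "Y + Z \<in> pb_sections A"
proof (rule pbI)
  have "rep P (Y + Z) i = (\<lambda>z. rep P Y i z + rep P Z i z)" for i by (simp add: rep_def)
  then show "smooth_on (slit (chart_im A i)) (rep P (Y + Z) i)" if "i \<in> indices A" for i
    using smooth_on_add[OF open_slit_im[OF that] pb_smooth[OF assms(1) that] pb_smooth[OF assms(2) that]] by simp
qed (use assms in \<open>auto intro: tangent_add pb_tangent simp: pb_outside\<close>)

lemma pb_sum: "(\<And>a. a \<in> I \<Longrightarrow> Y a \<in> pb_sections A) \<Longrightarrow> (\<Sum>a\<in>I. Y a) \<in> pb_sections A"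
  by (induction I rule: infinite_finite_induct) (auto intro: pb_zero pb_add)

lemma pb_scale: assumes "smooth_fun P f" "Y \<in> pb_sections A" shows "(\<lambda>u. f u *\<^sub>R Y u) \<in> pb_sections A"
proof (rule pbI)
  have "rep P (\<lambda>u. f u *\<^sub>R Y u) i = (\<lambda>z. (f \<circ> chart_inv P i) z *\<^sub>R rep P Y i z)" for i
    by (simp add: rep_def scaleR_fun_def)
  then show "smooth_on (slit (chart_im A i)) (rep P (\<lambda>u. f u *\<^sub>R Y u) i)" if "i \<in> indices A" for i
    using smooth_on_scaleR[OF open_slit_im[OF that] _ pb_smooth[OF assms(2) that]] assms(1) that smooth_fun_slit by (simp add: o_def)
qed (use assms in \<open>auto intro: tangent_scaleR pb_tangent simp: pb_outside\<close>)

lemma rep_eta: "i \<in> indices A \<Longrightarrow> z \<in> slit (chart_im A i) \<Longrightarrow> rep P (eta A) i z = snd z"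
proof -
  assume i: "i \<in> indices A" and z: "z \<in> slit (chart_im A i)"
  have u: "chart_inv P i z \<in> chart_dom P i" using P.chart_inv_dom[of z i] z slit_im[OF i] by simp
  then have "chart_inv P i z \<in> points P" using i by (auto simp: points_def)
  moreover have "snd (chart_inv P i z) i = snd z"
    using P.chart_chart_inv[of z i] z slit_im[OF i] by (simp add: slit_map prod_eq_iff)
  ultimately show ?thesis by (simp add: rep_def eta_def)
qed

lemma eta_section: "eta A \<in> pb_sections A"
proof (rule pbI)
  show "smooth_on (slit (chart_im A i)) (rep P (eta A) i)" if i: "i \<in> indices A" for i
    by (rule smooth_on_cong[OF open_slit_im[OF i], of snd])
       (use rep_eta[OF i] smooth_on_snd[OF open_slit_im[OF i] smooth_on_id[OF open_slit_im[OF i]]] in auto)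
qed (auto simp: eta_def slit_points)

subsection \<open>Cutoff functions\<close>

text \<open>Cutoff functions live on the base manifold and are pulled back to the slit tangent bundle, whose
  charts lie over those of the base. The last clause says that \<open>\<phi>\<close> vanishes near every point outside the
  domain of the chart \<open>i\<close>, in any other chart.\<close>
definition cutoff :: "'i \<Rightarrow> 'p \<Rightarrow> 'e set \<Rightarrow> ('p \<Rightarrow> real) \<Rightarrow> bool" where
  "cutoff i p W \<phi> \<longleftrightarrow> open W \<and> chart_map A i p \<in> W \<and> W \<subseteq> chart_im A i \<and>
    (\<forall>x\<in>W. \<phi> (chart_inv A i x) = 1) \<and>
    (\<forall>j\<in>indices A. smooth_on (chart_im A j) (\<lambda>x. \<phi> (chart_inv A j x))) \<and>
    (\<forall>j\<in>indices A. \<forall>q\<in>chart_dom A j. q \<notin> chart_dom A i \<longrightarrow>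
      (\<exists>V. open V \<and> chart_map A j q \<in> V \<and> V \<subseteq> chart_im A j \<and> (\<forall>x\<in>V. \<phi> (chart_inv A j x) = 0)))"

text \<open>A bump function in the chart is extended by zero. The support is compact, hence closed because the
  manifold is Hausdorff, and this makes the extension smooth at points outside the chart.\<close>
lemma exists_cutoff:
  assumes H: "Hausdorff_space (atlas_topology A)" and i: "i \<in> charts_at A p"
  shows "\<exists>W \<phi>. cutoff i p W \<phi>"
proof -
  have ii: "i \<in> indices A" "p \<in> chart_dom A i" using charts_atD[OF i] by auto
  let ?x = "chart_map A i p" and ?T = "atlas_topology A"
  have top: "openin ?T S \<longleftrightarrow> S \<subseteq> points A \<and> (\<forall>i\<in>indices A. open (chart_map A i ` (S \<inter> chart_dom A i)))" for S
    by (rule openin_atlas_topology[OF atlas])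
  have topspace: "topspace ?T = points A"
  proof -
    have "openin ?T (points A)"
      unfolding top using open_im by (auto simp: chart_im_def points_def Int_absorb1 UN_upper inf.absorb2)
    then show ?thesis using openin_subset[of ?T] top openin_topspace by blast
  qed
  obtain e where e: "e > 0" "cball ?x e \<subseteq> chart_im A i"
    using open_contains_cball[of "chart_im A i"] open_im[OF ii(1)] chart_in_im[OF ii(2)] by blast
  define r where "r = e / 2"
  have r: "r > 0" "cball ?x (2 * r) \<subseteq> chart_im A i" using e by (auto simp: r_def)
  obtain b :: "'e \<Rightarrow> real" where b: "smooth_on UNIV b" "\<And>x. x \<in> ball ?x r \<Longrightarrow> b x = 1"
    "\<And>x. x \<notin> cball ?x (2 * r) \<Longrightarrow> b x = 0"
    using exists_bump[OF r(1)] by metis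
  define K where "K = chart_inv A i ` cball ?x (2 * r)"
  have cont: "continuous_map (top_of_set (chart_im A i)) ?T (chart_inv A i)"
    unfolding continuous_map_def
  proof (intro conjI allI impI)
    show "chart_inv A i \<in> topspace (top_of_set (chart_im A i)) \<rightarrow> topspace ?T"
      using chart_inv_dom ii(1) by (auto simp: topspace points_def)
    fix S assume S: "openin ?T S"
    have "{x \<in> topspace (top_of_set (chart_im A i)). chart_inv A i x \<in> S} = chart_map A i ` (S \<inter> chart_dom A i)"
    proof (intro set_eqI iffI)
      fix x assume "x \<in> {x \<in> topspace (top_of_set (chart_im A i)). chart_inv A i x \<in> S}"
      then show "x \<in> chart_map A i ` (S \<inter> chart_dom A i)"
        using chart_chart_inv[of x i] chart_inv_dom[of x i] by (intro image_eqI[of _ _ "chart_inv A i x"]) auto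
    qed (use ii in \<open>auto simp: chart_inv_chart chart_in_im\<close>)
    moreover have "open (chart_map A i ` (S \<inter> chart_dom A i))" using S top ii(1) by blast
    ultimately show "openin (top_of_set (chart_im A i)) {x \<in> topspace (top_of_set (chart_im A i)). chart_inv A i x \<in> S}"
      by (auto intro!: open_subset simp: chart_im_def)
  qed
  have "compactin (top_of_set (chart_im A i)) (cball ?x (2 * r))"
    using r(2) by (simp add: compactin_subtopology)
  then have "compactin ?T K" unfolding K_def using cont by (rule image_compactin)
  then have "closedin ?T K" using H compactin_imp_closedin by blast
  then have oK: "openin ?T (points A - K)" by (simp add: closedin_def topspace)
  define \<phi> where "\<phi> q = (if q \<in> chart_dom A i then b (chart_map A i q) else 0)" for q
  have \<phi>0: "\<phi> q = 0" if "q \<notin> K" for q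
    using that b(3)[of "chart_map A i q"] chart_inv_chart[OF ii(1)] unfolding \<phi>_def K_def by (metis imageI)
  have van: "\<exists>V. open V \<and> chart_map A j q \<in> V \<and> V \<subseteq> chart_im A j \<and> (\<forall>x\<in>V. \<phi> (chart_inv A j x) = 0)"
    if j: "j \<in> indices A" and q: "q \<in> chart_dom A j" "q \<notin> chart_dom A i" for j q
  proof (intro exI conjI)
    let ?V = "chart_map A j ` ((points A - K) \<inter> chart_dom A j)"
    show "open ?V" using oK top j by blast
    have "q \<notin> K" using q(2) r(2) chart_inv_dom unfolding K_def by auto
    then show "chart_map A j q \<in> ?V" using q j by (auto simp: points_def)
    show "?V \<subseteq> chart_im A j" by (auto simp: chart_im_def)
    show "\<forall>x\<in>?V. \<phi> (chart_inv A j x) = 0" using \<phi>0 chart_inv_chart[OF j] by auto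
  qed
  have sm: "smooth_on (chart_im A j) (\<lambda>x. \<phi> (chart_inv A j x))" if j: "j \<in> indices A" for j
  proof (rule smooth_on_local)
    fix x assume x: "x \<in> chart_im A j"
    let ?q = "chart_inv A j x"
    show "\<exists>T. open T \<and> x \<in> T \<and> smooth_on T (\<lambda>x. \<phi> (chart_inv A j x))"
    proof (cases "?q \<in> chart_dom A i")
      case True
      have "smooth_on (overlap A j i) (\<lambda>x. b (trans_map A j i x))"
        by (rule smooth_on_compose[OF open_overlap[OF j ii(1)] b(1) smooth_trans[OF j ii(1)]]) auto
      then have "smooth_on (overlap A j i) (\<lambda>x. \<phi> (chart_inv A j x))"
        by (rule smooth_on_cong[rotated -1])
           (use open_overlap[OF j ii(1)] overlap_iff[OF j] in \<open>auto simp: \<phi>_def trans_map_def\<close>)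
      then show ?thesis using open_overlap[OF j ii(1)] x True overlap_iff[OF j] by blast
    next
      case False
      from van[OF j chart_inv_dom[OF x] this] obtain V where V: "open V" "chart_map A j ?q \<in> V"
        "\<forall>x\<in>V. \<phi> (chart_inv A j x) = 0" by blast
      have "smooth_on V (\<lambda>x. \<phi> (chart_inv A j x))"
        by (rule smooth_on_cong[OF V(1), of "\<lambda>_. 0"]) (use V(3) in auto)
      with V show ?thesis using chart_chart_inv[OF x] by auto
    qed
  qed
  have "cutoff i p (ball ?x r) \<phi>"
    unfolding cutoff_def
  proof (intro conjI)
    show sub: "ball ?x r \<subseteq> chart_im A i" using r by (auto simp: subset_iff dist_commute)
    show "\<forall>x\<in>ball ?x r. \<phi> (chart_inv A i x) = 1"
      using b(2) sub chart_inv_dom chart_chart_inv by (auto simp: \<phi>_def subset_iff)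
  qed (use r sm van in auto)
  then show ?thesis by blast
qed

text \<open>A function that is smooth where two charts overlap extends by zero to the whole second chart after
  multiplication by a cutoff function for the first.\<close>
lemma cutoff_extension_smooth:
  fixes G :: "'e \<times> 'e \<Rightarrow> 'b::real_normed_vector"
  assumes \<phi>: "cutoff i p W \<phi>" and i: "i \<in> indices A" and j: "j \<in> indices A"
    and G: "smooth_on (slit (overlap A j i)) G"
  shows "smooth_on (slit (chart_im A j))
    (\<lambda>z. if fst (chart_inv P j z) \<in> chart_dom A i then \<phi> (fst (chart_inv P j z)) *\<^sub>R G z else 0)" (is "smooth_on _ ?f")
proof (rule smooth_on_local)
  fix z assume z: "z \<in> slit (chart_im A j)"
  let ?q = "chart_inv A j (fst z)"
  have f: "?f z = (if chart_inv A j (fst z) \<in> chart_dom A i then \<phi> (chart_inv A j (fst z)) *\<^sub>R G z else 0)"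
    if "z \<in> slit (chart_im A j)" for z using fst_slit_inv[OF j that] by simp
  show "\<exists>T. open T \<and> z \<in> T \<and> smooth_on T ?f"
  proof (cases "?q \<in> chart_dom A i")
    case True
    let ?T = "slit (overlap A j i)"
    have o: "open ?T" using open_overlap[OF j i] by simp
    have sub: "?T \<subseteq> slit (chart_im A j)" using overlap_im by auto
    have "smooth_on ?T (\<lambda>z. \<phi> (chart_inv A j (fst z)))"
      by (rule smooth_on_compose[OF o, of "chart_im A j" "\<lambda>x. \<phi> (chart_inv A j x)" fst])
         (use \<phi> j overlap_im smooth_on_fst[OF o smooth_on_id[OF o]] in \<open>auto simp: cutoff_def\<close>)
    then have G': "smooth_on ?T (\<lambda>z. \<phi> (chart_inv A j (fst z)) *\<^sub>R G z)"
      by (rule smooth_on_scaleR[OF o _ G])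
    have "smooth_on ?T ?f"
    proof (rule smooth_on_cong[OF o _ G'])
      fix z assume z: "z \<in> ?T"
      have "chart_inv A j (fst z) \<in> chart_dom A i" using z overlap_iff[OF j] by auto
      then show "\<phi> (chart_inv A j (fst z)) *\<^sub>R G z = ?f z" using f[OF subsetD[OF sub z]] by simp
    qed
    moreover have "z \<in> ?T" using z True overlap_iff[OF j] by auto
    ultimately show ?thesis using o by blast
  next
    case False
    have "?q \<in> chart_dom A j" "chart_map A j ?q = fst z" using z chart_inv_dom chart_chart_inv by auto
    then obtain V where V: "open V" "fst z \<in> V" "V \<subseteq> chart_im A j" "\<forall>x\<in>V. \<phi> (chart_inv A j x) = 0"
      using \<phi> j False unfolding cutoff_def by metis
    have "smooth_on (slit V) ?f"
    proof (rule smooth_on_cong[of _ "\<lambda>_. 0"])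
      fix z assume z: "z \<in> slit V"
      then have "z \<in> slit (chart_im A j)" "fst z \<in> V" using V(3) by auto
      then show "0 = ?f z" using f[of z] V(4) by simp
    qed (use V in auto)
    then show ?thesis using V z by (intro exI[of _ "slit V"]) auto
  qed
qed

end

section \<open>Symmetric connections on the pullback bundle\<close>

locale base_manifold = base_atlas A for A :: "('i, 'p, 'e::euclidean_space) atlas" +
  assumes hausdorff: "Hausdorff_space (atlas_topology A)"
begin

lemma slit_invD:
  assumes j: "j \<in> indices A" and z: "z \<in> slit (chart_im A j)"
  shows "chart_inv P j z \<in> chart_dom P j" "chart_inv P j z \<in> points P" "chart_map P j (chart_inv P j z) = z"
    "j \<in> charts_at P (chart_inv P j z)" "j \<in> charts_at A (fst (chart_inv P j z))"
    "snd (chart_inv P j z) j = snd z" "fst (chart_inv P j z) = chart_inv A j (fst z)"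
    "chart_map A j (fst (chart_inv P j z)) = fst z"
proof -
  have z': "z \<in> chart_im P j" using z slit_im[OF j] by simp
  show d: "chart_inv P j z \<in> chart_dom P j" by (rule P.chart_inv_dom[OF z'])
  show m: "chart_map P j (chart_inv P j z) = z" by (rule P.chart_chart_inv[OF z'])
  show p: "chart_inv P j z \<in> points P" using d j by (auto simp: points_def)
  show c: "j \<in> charts_at P (chart_inv P j z)" using d j by (simp add: charts_at_def)
  show "j \<in> charts_at A (fst (chart_inv P j z))" using c slit_charts[OF p] by simp
  show "snd (chart_inv P j z) j = snd z" "chart_map A j (fst (chart_inv P j z)) = fst z"
    using m unfolding slit_map by (metis snd_conv, metis fst_conv)
  show "fst (chart_inv P j z) = chart_inv A j (fst z)" by (rule fst_slit_inv[OF j z])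
qed

lemma slit_chartD:
  assumes u: "i \<in> charts_at P u"
  shows "i \<in> indices A" "u \<in> chart_dom P i" "u \<in> points P" "i \<in> charts_at A (fst u)"
    "chart_map P i u \<in> slit (chart_im A i)" "chart_map P i u = (chart_map A i (fst u), snd u i)"
    "\<And>Y. rep P Y i (chart_map P i u) = Y u i" "snd u \<in> tangent_space A (fst u)"
proof -
  show 1: "i \<in> indices A" "u \<in> chart_dom P i" using u by (auto simp: charts_at_def)
  show 2: "u \<in> points P" using u points_iff by metis
  show "i \<in> charts_at A (fst u)" using u slit_charts[OF 2] by simp
  show "chart_map P i u \<in> slit (chart_im A i)" by (rule chart_slit[OF 1(2,1)])
  show "chart_map P i u = (chart_map A i (fst u), snd u i)" by (rule slit_map)
  show "rep P Y i (chart_map P i u) = Y u i" for Y :: "_ \<Rightarrow> 'i \<Rightarrow> 'b" by (rule rep_slit[OF 1(2,1)])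
  show "snd u \<in> tangent_space A (fst u)" using 1(2) by (simp add: slit_dom)
qed

subsection \<open>Extending vectors to fields\<close>

text \<open>Global fields that have constant components in the chart \<open>i\<close> wherever \<open>\<phi> = 1\<close>.\<close>
definition ext_section :: "'i \<Rightarrow> ('p \<Rightarrow> real) \<Rightarrow> 'e \<Rightarrow> ('i, 'p, 'e) pb_section" where
  "ext_section i \<phi> e = (\<lambda>u. if u \<in> points P \<and> fst u \<in> chart_dom A i
     then \<phi> (fst u) *\<^sub>R tvec A (fst u) i e else 0)"

definition ext_field :: "'i \<Rightarrow> ('p \<Rightarrow> real) \<Rightarrow> 'e \<times> 'e \<Rightarrow> ('i, 'p, 'e) tangent_point \<Rightarrow> 'i \<Rightarrow> 'e \<times> 'e" where
  "ext_field i \<phi> c = (\<lambda>u. if u \<in> points P \<and> fst u \<in> chart_dom A i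
     then \<phi> (fst u) *\<^sub>R tvec P u i c else 0)"

lemma smooth_FD_trans_back:
  assumes "i \<in> indices A" "j \<in> indices A"
  shows "smooth_on (slit (overlap A j i)) (\<lambda>z. FD (trans_map A i j) (trans_map A j i (fst z)) e)"
    "smooth_on (slit (overlap A j i)) (\<lambda>z. FD (trans_map P i j) (trans_map P j i z) c)"
proof -
  have o: "open (slit (overlap A j i))" using assms open_overlap by simp
  have "smooth_on (slit (overlap A j i)) (\<lambda>z. trans_map A j i (fst z))"
    by (rule smooth_on_compose[OF o smooth_trans[OF assms(2,1)] smooth_on_fst[OF o smooth_on_id[OF o]]]) auto
  then show "smooth_on (slit (overlap A j i)) (\<lambda>z. FD (trans_map A i j) (trans_map A j i (fst z)) e)"
    by (rule smooth_on_compose[OF o smooth_on_FD[OF smooth_trans[OF assms]]])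
       (use trans_overlap[OF assms(2)] in auto)
  have o': "open (overlap P j i)" using P.open_overlap assms by simp
  have "smooth_on (overlap P j i) (\<lambda>z. FD (trans_map P i j) (trans_map P j i z) c)"
    by (rule smooth_on_compose[OF o' smooth_on_FD[OF P.smooth_trans] P.smooth_trans])
       (use P.trans_overlap[of j _ i] assms in auto)
  then show "smooth_on (slit (overlap A j i)) (\<lambda>z. FD (trans_map P i j) (trans_map P j i z) c)"
    unfolding slit_overlap[OF assms(2)] .
qed

lemma ext_section:
  assumes \<phi>: "cutoff i p W \<phi>" and i: "i \<in> indices A"
  shows "ext_section i \<phi> e \<in> pb_sections A"
proof (rule pbI)
  show "ext_section i \<phi> e u \<in> tangent_space A (fst u)" for u
    using tvec_tangent[of i "fst u" e] tangent_scaleR tangent_zero i by (auto simp: ext_section_def charts_at_def)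
  show "ext_section i \<phi> e u = 0" if "u \<notin> points P" for u using that by (simp add: ext_section_def)
  fix j assume j: "j \<in> indices A"
  show "smooth_on (slit (chart_im A j)) (rep P (ext_section i \<phi> e) j)"
  proof (rule smooth_on_cong[OF open_slit_im[OF j] _ cutoff_extension_smooth[OF \<phi> i j smooth_FD_trans_back(1)[OF i j]]])
    fix z assume z: "z \<in> slit (chart_im A j)"
    show "(if fst (chart_inv P j z) \<in> chart_dom A i then \<phi> (fst (chart_inv P j z)) *\<^sub>R
        FD (trans_map A i j) (trans_map A j i (fst z)) e else 0) = rep P (ext_section i \<phi> e) j z"
      using slit_invD[OF j z] by (simp add: rep_def ext_section_def tvec_def scaleR_fun_def trans_map_def[of A j i])
  qed
qed

lemma ext_field:
  assumes \<phi>: "cutoff i p W \<phi>" and i: "i \<in> indices A"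
  shows "ext_field i \<phi> c \<in> vector_fields P"
proof (rule vfI)
  show "ext_field i \<phi> c u \<in> tangent_space P u" if u: "u \<in> points P" for u
  proof (cases "fst u \<in> chart_dom A i")
    case True
    then have "i \<in> charts_at P u" using i unfolding slit_charts[OF u] by (simp add: charts_at_def)
    from P.tangent_scaleR[OF P.tvec_tangent[OF this]] show ?thesis using u True by (simp add: ext_field_def)
  next
    case False
    then show ?thesis using P.tangent_zero by (simp add: ext_field_def)
  qed
  show "ext_field i \<phi> c u = 0" if "u \<notin> points P" for u using that by (simp add: ext_field_def)
  fix j assume j: "j \<in> indices A"
  show "smooth_on (slit (chart_im A j)) (rep P (ext_field i \<phi> c) j)"
  proof (rule smooth_on_cong[OF open_slit_im[OF j] _ cutoff_extension_smooth[OF \<phi> i j smooth_FD_trans_back(2)[OF i j]]])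
    fix z assume z: "z \<in> slit (chart_im A j)"
    show "(if fst (chart_inv P j z) \<in> chart_dom A i then \<phi> (fst (chart_inv P j z)) *\<^sub>R
        FD (trans_map P i j) (trans_map P j i z) c else 0) = rep P (ext_field i \<phi> c) j z"
      using slit_invD[OF j z] by (simp add: rep_def ext_field_def tvec_def scaleR_fun_def trans_map_def[of P j i])
  qed
qed

lemma cutoff_one:
  assumes "cutoff i p W \<phi>" "i \<in> charts_at P u" "chart_map A i (fst u) \<in> W"
  shows "\<phi> (fst u) = 1"
proof -
  have "\<phi> (chart_inv A i (chart_map A i (fst u))) = 1" using assms by (simp add: cutoff_def)
  then show ?thesis using slit_chartD[OF assms(2)] by (simp add: chart_inv_chart slit_dom)
qed

lemma ext_at:
  assumes "cutoff i p W \<phi>" "i \<in> charts_at P u" "chart_map A i (fst u) \<in> W"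
  shows "ext_section i \<phi> e u i = e" "ext_field i \<phi> c u i = c"
  using cutoff_one[OF assms] slit_chartD[OF assms(2)] tvec_self[of i "fst u"] P.tvec_self[OF assms(2)]
  by (simp_all add: ext_section_def ext_field_def slit_dom)

lemma rep_ext:
  assumes "cutoff i p W \<phi>" and i: "i \<in> indices A" and z: "z \<in> slit W"
  shows "rep P (ext_section i \<phi> e) i z = e" "rep P (ext_field i \<phi> c) i z = c"
proof -
  have z': "z \<in> slit (chart_im A i)" using assms unfolding cutoff_def by auto
  have "chart_map A i (fst (chart_inv P i z)) \<in> W" unfolding slit_invD(8)[OF i z'] using z by auto
  from ext_at[OF assms(1) slit_invD(4)[OF i z'] this]
  show "rep P (ext_section i \<phi> e) i z = e" "rep P (ext_field i \<phi> c) i z = c"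
    unfolding rep_def by blast+
qed

lemma cutoff_slit: "cutoff i p W \<phi> \<Longrightarrow> open (slit W)" "cutoff i p W \<phi> \<Longrightarrow> slit W \<subseteq> slit (chart_im A i)"
  by (auto simp: cutoff_def)

lemma FD_rep_ext:
  assumes "cutoff i p W \<phi>" and i: "i \<in> indices A" and z: "z \<in> slit W"
  shows "FD (rep P (ext_section i \<phi> e) i) z = (\<lambda>_. 0)" "FD (rep P (ext_field i \<phi> c) i) z = (\<lambda>_. 0)"
  using FD_cong[OF cutoff_slit(1)[OF assms(1)] z rep_ext(1)[OF assms(1,2)]]
    FD_cong[OF cutoff_slit(1)[OF assms(1)] z rep_ext(2)[OF assms(1,2)]] by simp_all

lemma obtain_cutoff:
  assumes "i \<in> charts_at P u"
  obtains W \<phi> where "cutoff i (fst u) W \<phi>" "chart_map P i u \<in> slit W" "chart_map A i (fst u) \<in> W"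
proof -
  obtain W \<phi> where c: "cutoff i (fst u) W \<phi>"
    using exists_cutoff[OF hausdorff slit_chartD(4)[OF assms]] by blast
  then have "chart_map A i (fst u) \<in> W" by (simp add: cutoff_def)
  then show ?thesis using that[OF c] slit_chartD(5,6)[OF assms] by auto
qed

lemma vector_field_through:
  assumes u: "u \<in> points P" and w: "w \<in> tangent_space P u"
  obtains X where "X \<in> vector_fields P" "X u = w"
proof -
  obtain i where i: "i \<in> charts_at P u" using u points_iff by metis
  obtain W \<phi> where c: "cutoff i (fst u) W \<phi>" "chart_map A i (fst u) \<in> W" using obtain_cutoff[OF i] by metis
  have X: "ext_field i \<phi> (w i) \<in> vector_fields P" by (rule ext_field[OF c(1) slit_chartD(1)[OF i]])
  have "ext_field i \<phi> (w i) u = w"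
    by (rule P.tangent_eqI[OF P.vector_field_tangent[OF X] w i]) (rule ext_at(2)[OF c(1) i c(2)])
  with X show ?thesis by (rule that)
qed

subsection \<open>Bundle morphisms on sections\<close>

lemma rep_on_sections: "j \<in> indices A \<Longrightarrow> z \<in> slit (chart_im A j) \<Longrightarrow>
    rep P (on_sections A F X) j z = F (chart_inv P j z) (X (chart_inv P j z)) j"
  using slit_invD(2) by (simp add: rep_def on_sections_def)

lemma rep_rho: "X \<in> vector_fields P \<Longrightarrow> j \<in> indices A \<Longrightarrow> z \<in> slit (chart_im A j) \<Longrightarrow>
    rep P (on_sections A (rho A) X) j z = fst (rep P X j z)"
  using rho_apply[OF slit_invD(2) P.vector_field_tangent] by (simp add: rep_on_sections) (simp add: rep_def)

lemma rho_section: assumes X: "X \<in> vector_fields P" shows "on_sections A (rho A) X \<in> pb_sections A"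
proof (rule pbI)
  show "on_sections A (rho A) X u \<in> tangent_space A (fst u)" if "u \<in> points P" for u
    using that rho_tangent[OF that P.vector_field_tangent[OF X]] by (simp add: on_sections_def)
  show "on_sections A (rho A) X u = 0" if "u \<notin> points P" for u using that by (simp add: on_sections_def)
  show "smooth_on (slit (chart_im A j)) (rep P (on_sections A (rho A) X) j)" if j: "j \<in> indices A" for j
    by (rule smooth_on_cong[OF open_slit_im[OF j] rep_rho[OF X j, symmetric]])
       (auto intro!: smooth_on_fst open_slit_im j vf_smooth X)
qed

lemma rep_gamma: "Y \<in> pb_sections A \<Longrightarrow> j \<in> indices A \<Longrightarrow> z \<in> slit (chart_im A j) \<Longrightarrow>
    rep P (on_sections A (gamma A) Y) j z = (0, rep P Y j z)"
  using gamma_apply[OF slit_invD(2) pb_tangent] by (simp add: rep_on_sections) (simp add: rep_def)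

lemma gamma_field: assumes Y: "Y \<in> pb_sections A" shows "on_sections A (gamma A) Y \<in> vector_fields P"
proof (rule vfI)
  show "on_sections A (gamma A) Y u \<in> tangent_space P u" if "u \<in> points P" for u
    using that gamma_tangent[OF that pb_tangent[OF Y]] by (simp add: on_sections_def)
  show "on_sections A (gamma A) Y u = 0" if "u \<notin> points P" for u using that by (simp add: on_sections_def)
  show "smooth_on (slit (chart_im A j)) (rep P (on_sections A (gamma A) Y) j)" if j: "j \<in> indices A" for j
    by (rule smooth_on_cong[OF open_slit_im[OF j] rep_gamma[OF Y j, symmetric]])
       (auto intro!: smooth_on_Pair open_slit_im j pb_smooth Y)
qed

lemma connection_outside: "linear_connection A D \<Longrightarrow> u \<notin> points P \<Longrightarrow> D u w Y = 0"
  unfolding linear_connection_def by blast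

text \<open>Linear connections are required to map fields to sections. The value at a single vector is tangent
  because the vector extends to a field.\<close>
lemma connection_tangent:
  assumes D: "linear_connection A D"
  shows "D u w Y \<in> tangent_space A (fst u)"
proof (cases "u \<in> points P \<and> w \<in> tangent_space P u \<and> Y \<in> pb_sections A")
  case True
  then obtain X where X: "X \<in> vector_fields P" "X u = w" using vector_field_through by metis
  have "cov_deriv D X Y \<in> pb_sections A" using D X(1) True unfolding linear_connection_def by blast
  from pb_tangent[OF this, of u] show ?thesis by (simp add: cov_deriv_def X(2))
next
  case False
  then have "D u w Y = 0" using D unfolding linear_connection_def by blast
  then show ?thesis using tangent_zero by simp
qed

end

text \<open>Coefficients of a connection in one chart.\<close>
locale smooth_symmetric_family =
  fixes \<Omega> :: "'z::euclidean_space set" and \<Gamma> :: "'z \<Rightarrow> 'e::euclidean_space \<Rightarrow> 'e \<Rightarrow> 'e"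
  assumes open_\<Omega>: "open \<Omega>" and lin: "\<And>z \<xi>. z \<in> \<Omega> \<Longrightarrow> linear (\<Gamma> z \<xi>)"
    and sym: "\<And>z \<xi> \<eta>. z \<in> \<Omega> \<Longrightarrow> \<Gamma> z \<xi> \<eta> = \<Gamma> z \<eta> \<xi>"
    and smooth: "\<And>\<xi> \<eta>. smooth_on \<Omega> (\<lambda>z. \<Gamma> z \<xi> \<eta>)"
begin

lemma lin1: assumes "z \<in> \<Omega>" shows "linear (\<lambda>\<xi>. \<Gamma> z \<xi> \<eta>)"
  using lin[OF assms, of \<eta>] unfolding sym[OF assms, of \<eta>] .

lemma zero1: "z \<in> \<Omega> \<Longrightarrow> \<Gamma> z 0 \<eta> = 0" and zero2: "z \<in> \<Omega> \<Longrightarrow> \<Gamma> z \<xi> 0 = 0"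
  using linear_0[OF lin1] linear_0[OF lin] by auto

lemma minus1: "z \<in> \<Omega> \<Longrightarrow> \<Gamma> z (- \<xi>) \<eta> = - \<Gamma> z \<xi> \<eta>"
  using linear_neg[OF lin1] .

lemma expand1: assumes "z \<in> \<Omega>" shows "\<Gamma> z \<xi> \<eta> = (\<Sum>b\<in>Basis. (\<xi> \<bullet> b) *\<^sub>R \<Gamma> z b \<eta>)"
proof -
  interpret linear "\<lambda>\<xi>. \<Gamma> z \<xi> \<eta>" by (rule lin1[OF assms])
  have "\<Gamma> z \<xi> \<eta> = \<Gamma> z (\<Sum>b\<in>Basis. (\<xi> \<bullet> b) *\<^sub>R b) \<eta>" by (simp add: euclidean_representation)
  then show ?thesis by (simp add: sum scale)
qed

lemma smooth_right: assumes "smooth_on \<Omega> b" shows "smooth_on \<Omega> (\<lambda>z. \<Gamma> z \<xi> (b z))"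
proof (rule smooth_on_cong[OF open_\<Omega>])
  show "(\<Sum>c\<in>Basis. (b z \<bullet> c) *\<^sub>R \<Gamma> z c \<xi>) = \<Gamma> z \<xi> (b z)" if "z \<in> \<Omega>" for z
    using expand1[OF that, of "b z" \<xi>] sym[OF that] by metis
  show "smooth_on \<Omega> (\<lambda>z. \<Sum>c\<in>Basis. (b z \<bullet> c) *\<^sub>R \<Gamma> z c \<xi>)"
    using assms by (intro smooth_on_sum smooth_on_scaleR smooth_on_inner open_\<Omega> smooth smooth_on_const)
qed

lemma smooth_both: assumes "smooth_on \<Omega> a" "smooth_on \<Omega> b" shows "smooth_on \<Omega> (\<lambda>z. \<Gamma> z (a z) (b z))"
proof (rule smooth_on_cong[OF open_\<Omega>])
  show "(\<Sum>c\<in>Basis. (a z \<bullet> c) *\<^sub>R \<Gamma> z c (b z)) = \<Gamma> z (a z) (b z)" if "z \<in> \<Omega>" for z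
    using expand1[OF that, of "a z" "b z"] by simp
  show "smooth_on \<Omega> (\<lambda>z. \<Sum>c\<in>Basis. (a z \<bullet> c) *\<^sub>R \<Gamma> z c (b z))"
    using assms by (intro smooth_on_sum smooth_on_scaleR smooth_on_inner open_\<Omega> smooth_right smooth_on_const)
qed

text \<open>Only the first argument is differentiated separately; the dependence on the second one stays inside the
  derivative, since for \<open>b = snd\<close> that part is the vertical derivative of \<open>N\<close>.\<close>
lemma FD_both:
  assumes a: "smooth_on \<Omega> a" and b: "smooth_on \<Omega> b" and z: "z \<in> \<Omega>"
  shows "FD (\<lambda>p. \<Gamma> p (a p) (b p)) z w = FD (\<lambda>p. \<Gamma> p (a z) (b p)) z w + \<Gamma> z (FD a z w) (b z)"
proof -
  have d: "((\<lambda>p. \<Gamma> p c (b p)) has_derivative FD (\<lambda>p. \<Gamma> p c (b p)) z) (at z)" for c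
    by (rule smooth_on_has_derivative[OF smooth_right[OF b] z])
  have "((\<lambda>p. \<Sum>c\<in>Basis. (a p \<bullet> c) *\<^sub>R \<Gamma> p c (b p)) has_derivative
     (\<lambda>w. \<Sum>c\<in>Basis. (a z \<bullet> c) *\<^sub>R FD (\<lambda>p. \<Gamma> p c (b p)) z w + (FD a z w \<bullet> c) *\<^sub>R \<Gamma> z c (b z))) (at z)"
    by (intro has_derivative_sum has_derivative_scaleR has_derivative_inner_left d smooth_on_has_derivative[OF a z])
  then have "((\<lambda>p. \<Gamma> p (a p) (b p)) has_derivative
     (\<lambda>w. \<Sum>c\<in>Basis. (a z \<bullet> c) *\<^sub>R FD (\<lambda>p. \<Gamma> p c (b p)) z w + (FD a z w \<bullet> c) *\<^sub>R \<Gamma> z c (b z))) (at z)"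
    by (rule has_derivative_transform_within_open[OF _ open_\<Omega> z]) (rule expand1[symmetric])
  from FD_eqI[OF this]
  have 1: "FD (\<lambda>p. \<Gamma> p (a p) (b p)) z w =
    (\<Sum>c\<in>Basis. (a z \<bullet> c) *\<^sub>R FD (\<lambda>p. \<Gamma> p c (b p)) z w) + \<Gamma> z (FD a z w) (b z)"
    unfolding expand1[OF z, of "FD a z w"] by (simp add: sum.distrib)
  have "((\<lambda>p. \<Sum>c\<in>Basis. (a z \<bullet> c) *\<^sub>R \<Gamma> p c (b p)) has_derivative
     (\<lambda>w. \<Sum>c\<in>Basis. (a z \<bullet> c) *\<^sub>R FD (\<lambda>p. \<Gamma> p c (b p)) z w)) (at z)"
    by (intro has_derivative_sum has_derivative_scaleR_right d)
  then have "((\<lambda>p. \<Gamma> p (a z) (b p)) has_derivative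
     (\<lambda>w. \<Sum>c\<in>Basis. (a z \<bullet> c) *\<^sub>R FD (\<lambda>p. \<Gamma> p c (b p)) z w)) (at z)"
    by (rule has_derivative_transform_within_open[OF _ open_\<Omega> z]) (rule expand1[symmetric])
  from FD_eqI[OF this] 1 show ?thesis by simp
qed

end

text \<open>By \<open>torsion_zero\<close> below and \<open>christoffel_form\<close> in the last part, these are exactly the
  torsion-free connections: no derivative term beyond \<open>dY\<close> and a coefficient that sees only the horizontal
  component of the direction.\<close>
locale symmetric_connection = base_manifold A
  for A :: "('i, 'p, 'e::euclidean_space) atlas" +
  fixes D :: "('i, 'p, 'e) pb_connection" and \<Gamma> :: "'i \<Rightarrow> 'e \<times> 'e \<Rightarrow> 'e \<Rightarrow> 'e \<Rightarrow> 'e"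
  assumes conn: "linear_connection A D"
    and family: "\<And>i. i \<in> indices A \<Longrightarrow> smooth_symmetric_family (slit (chart_im A i)) (\<Gamma> i)"
    and local_form: "\<And>i u w Y. i \<in> charts_at P u \<Longrightarrow> w \<in> tangent_space P u \<Longrightarrow> Y \<in> pb_sections A \<Longrightarrow>
      D u w Y i = FD (rep P Y i) (chart_map P i u) (w i) + \<Gamma> i (chart_map P i u) (fst (w i)) (Y u i)"
begin

lemma \<Gamma>_zero:
  assumes i: "i \<in> charts_at P u"
  shows "\<Gamma> i (chart_map P i u) 0 \<eta> = 0" "\<Gamma> i (chart_map P i u) \<xi> 0 = 0"
  by (rule smooth_symmetric_family.zero1[OF family[OF slit_chartD(1)[OF i]] slit_chartD(5)[OF i]],
      rule smooth_symmetric_family.zero2[OF family[OF slit_chartD(1)[OF i]] slit_chartD(5)[OF i]])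

lemma connection_map_apply:
  assumes i: "i \<in> charts_at P u" and w: "w \<in> tangent_space P u"
  shows "connection_map A D u w i = snd (w i) + \<Gamma> i (chart_map P i u) (fst (w i)) (snd u i)"
proof -
  note c = slit_chartD[OF i]
  have "FD (rep P (eta A) i) (chart_map P i u) = FD snd (chart_map P i u)"
    by (rule FD_cong[OF open_slit_im[OF c(1)] c(5) rep_eta[OF c(1)]])
  also have "\<dots> = snd" by (intro FD_eqI has_derivative_snd has_derivative_ident)
  finally show ?thesis
    unfolding connection_map_def local_form[OF i w eta_section] using c(3) by (simp add: eta_def)
qed

lemma horizontal_iff:
  assumes i: "i \<in> charts_at P u" and w: "w \<in> tangent_space P u"
  shows "w \<in> horizontal_space A D u \<longleftrightarrow> snd (w i) = - \<Gamma> i (chart_map P i u) (fst (w i)) (snd u i)"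
proof -
  have "connection_map A D u w \<in> tangent_space A (fst u)"
    unfolding connection_map_def by (rule connection_tangent[OF conn])
  from tangent_nonzero[OF this slit_chartD(4)[OF i]]
  show ?thesis using w by (simp add: horizontal_space_def connection_map_apply[OF i w] eq_neg_iff_add_eq_0)
qed

lemma vertical_iff:
  assumes i: "i \<in> charts_at P u" and w: "w \<in> tangent_space P u"
  shows "w \<in> vertical_space A u \<longleftrightarrow> fst (w i) = 0"
  using w tangent_nonzero[OF rho_tangent[OF slit_chartD(3)[OF i] w] slit_chartD(4)[OF i]]
  by (simp add: vertical_space_def rho_apply[OF slit_chartD(3)[OF i] w])

text \<open>The horizontal lift of \<open>\<xi>\<close>, see \<open>horizontal_iff\<close>.\<close>
definition lift :: "'i \<Rightarrow> ('i, 'p, 'e) tangent_point \<Rightarrow> 'e \<Rightarrow> 'i \<Rightarrow> 'e \<times> 'e"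
  where "lift i u \<xi> = tvec P u i (\<xi>, - \<Gamma> i (chart_map P i u) \<xi> (snd u i))"

lemma lift:
  assumes i: "i \<in> charts_at P u"
  shows "lift i u \<xi> \<in> tangent_space P u" "lift i u \<xi> i = (\<xi>, - \<Gamma> i (chart_map P i u) \<xi> (snd u i))"
    "lift i u \<xi> \<in> horizontal_space A D u"
proof -
  show 1: "lift i u \<xi> \<in> tangent_space P u" unfolding lift_def by (rule P.tvec_tangent[OF i])
  show 2: "lift i u \<xi> i = (\<xi>, - \<Gamma> i (chart_map P i u) \<xi> (snd u i))" unfolding lift_def by (rule P.tvec_self[OF i])
  show "lift i u \<xi> \<in> horizontal_space A D u" unfolding horizontal_iff[OF i 1] 2 by simp
qed

lemma vertical_horizontal_zero:
  assumes i: "i \<in> charts_at P u" and v: "w \<in> vertical_space A u" and h: "w \<in> horizontal_space A D u"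
  shows "w = 0"
proof -
  have w: "w \<in> tangent_space P u" using v by (simp add: vertical_space_def)
  have "w i = 0" using v h \<Gamma>_zero[OF i]
    by (simp add: vertical_iff[OF i w] horizontal_iff[OF i w] prod_eq_iff)
  then show ?thesis using P.tangent_eqI[OF w P.tangent_zero i] by simp
qed

text \<open>The horizontal part of \<open>w\<close> is the lift of its base component, for any choice of coefficients.\<close>
lemma regular: "regular_connection A D"
  unfolding regular_connection_def
proof (intro conjI ballI conn)
  fix u assume u: "u \<in> points P"
  obtain i where i: "i \<in> charts_at P u" using u points_iff by metis
  have V: "0 \<in> vertical_space A u" by (rule vertical_iff[OF i P.tangent_zero, THEN iffD2]) simp
  have H: "0 \<in> horizontal_space A D u"
    by (rule horizontal_iff[OF i P.tangent_zero, THEN iffD2]) (simp add: \<Gamma>_zero(1)[OF i])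
  show "vertical_space A u \<inter> horizontal_space A D u = {0}"
    using V H vertical_horizontal_zero[OF i] by auto
  show "tangent_space P u = {v + w |v w. v \<in> vertical_space A u \<and> w \<in> horizontal_space A D u}"
  proof (intro set_eqI iffI)
    fix w assume w: "w \<in> tangent_space P u"
    let ?h = "lift i u (fst (w i))"
    have d: "w - ?h \<in> tangent_space P u" by (rule P.tangent_diff[OF w lift(1)[OF i]])
    have "w - ?h \<in> vertical_space A u" unfolding vertical_iff[OF i d] by (simp add: lift(2)[OF i])
    moreover have "w = (w - ?h) + ?h" by simp
    ultimately show "w \<in> {v + w |v w. v \<in> vertical_space A u \<and> w \<in> horizontal_space A D u}"
      using lift(3)[OF i] by blast
  next
    fix w assume "w \<in> {v + w |v w. v \<in> vertical_space A u \<and> w \<in> horizontal_space A D u}"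
    then show "w \<in> tangent_space P u"
      by (auto simp: vertical_space_def horizontal_space_def intro: P.tangent_add)
  qed
qed

lemma beta_eq:
  assumes i: "i \<in> charts_at P u" and v: "v \<in> tangent_space A (fst u)"
  shows "beta A D u v = lift i u (v i)"
  unfolding beta_def
proof (rule the_inv_into_f_eq)
  note u = slit_chartD(3)[OF i]
  show "inj_on (rho A u) (horizontal_space A D u)"
  proof (rule inj_onI)
    fix a b assume a: "a \<in> horizontal_space A D u" and b: "b \<in> horizontal_space A D u" and e: "rho A u a = rho A u b"
    have t: "a \<in> tangent_space P u" "b \<in> tangent_space P u" using a b by (auto simp: horizontal_space_def)
    have f: "fst (a i) = fst (b i)" using e rho_apply[OF u] t by metis
    have "a i = b i"
      using a b f by (simp add: horizontal_iff[OF i t(1)] horizontal_iff[OF i t(2)] prod_eq_iff)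
    then show "a = b" by (rule P.tangent_eqI[OF t i])
  qed
  show "lift i u (v i) \<in> horizontal_space A D u" by (rule lift(3)[OF i])
  show "rho A u (lift i u (v i)) = v"
    by (rule tangent_eqI[OF rho_tangent[OF u lift(1)[OF i]] v slit_chartD(4)[OF i]])
       (simp add: rho_apply[OF u lift(1)[OF i]] lift(2)[OF i])
qed

lemma projector_eq:
  assumes i: "i \<in> charts_at P u" and w: "w \<in> tangent_space P u"
  shows "horizontal_projector A D u w = lift i u (fst (w i))"
  using beta_eq[OF i rho_tangent[OF slit_chartD(3)[OF i] w]] rho_apply[OF slit_chartD(3)[OF i] w]
  by (simp add: horizontal_projector_def)

lemma rep_beta:
  assumes X: "X \<in> pb_sections A" and j: "j \<in> indices A" and z: "z \<in> slit (chart_im A j)"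
  shows "rep P (on_sections A (beta A D) X) j z = (rep P X j z, - \<Gamma> j z (rep P X j z) (snd z))"
  using beta_eq[OF slit_invD(4)[OF j z] pb_tangent[OF X]] lift(2)[OF slit_invD(4)[OF j z]] slit_invD[OF j z]
  unfolding rep_on_sections[OF j z] by (simp add: rep_def)

lemma beta_field: assumes X: "X \<in> pb_sections A" shows "on_sections A (beta A D) X \<in> vector_fields P"
proof (rule vfI)
  fix u assume u: "u \<in> points P"
  then obtain i where i: "i \<in> charts_at P u" using points_iff by metis
  show "on_sections A (beta A D) X u \<in> tangent_space P u"
    using u beta_eq[OF i pb_tangent[OF X]] lift(1)[OF i] by (simp add: on_sections_def)
next
  show "on_sections A (beta A D) X u = 0" if "u \<notin> points P" for u using that by (simp add: on_sections_def)
  fix j assume j: "j \<in> indices A"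
  interpret smooth_symmetric_family "slit (chart_im A j)" "\<Gamma> j" by (rule family[OF j])
  note o = open_slit_im[OF j]
  show "smooth_on (slit (chart_im A j)) (rep P (on_sections A (beta A D) X) j)"
    by (rule smooth_on_cong[OF o rep_beta[OF X j, symmetric]])
       (auto intro!: smooth_on_Pair o pb_smooth X j smooth_on_minus smooth_both smooth_on_snd smooth_on_id)
qed

text \<open>In a chart the terms \<open>dY(X) - dX(Y)\<close> of the base components cancel against the bracket, and the terms with
  \<open>\<Gamma>\<close> cancel by symmetry.\<close>
lemma torsion_zero:
  assumes X: "X \<in> vector_fields P" and Y: "Y \<in> vector_fields P"
  shows "torsion A D X Y = 0"
proof
  fix u
  show "torsion A D X Y u = 0 u"
  proof (cases "u \<in> points P")
    case False
    then show ?thesis using connection_outside[OF conn]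
      by (simp add: torsion_def cov_deriv_def on_sections_def)
  next
    case u: True
    then obtain i where i: "i \<in> charts_at P u" using points_iff by metis
    note c = slit_chartD[OF i]
    let ?z = "chart_map P i u" and ?B = "lie_bracket P X Y"
    have tX: "X u \<in> tangent_space P u" and tY: "Y u \<in> tangent_space P u" and tB: "?B u \<in> tangent_space P u"
      using P.vector_field_tangent X Y P.lie_bracket_tangent[OF X Y u] by auto
    have F: "FD (rep P (on_sections A (rho A) V) i) ?z w = fst (FD (rep P V i) ?z w)"
      if V: "V \<in> vector_fields P" for V w
    proof -
      have "FD (rep P (on_sections A (rho A) V) i) ?z = FD (\<lambda>z. fst (rep P V i z)) ?z"
        by (rule FD_cong[OF open_slit_im[OF c(1)] c(5) rep_rho[OF V c(1)]])
      also have "\<dots> = (\<lambda>w. fst (FD (rep P V i) ?z w))"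
        by (intro FD_eqI has_derivative_fst smooth_on_has_derivative[OF vf_smooth[OF V c(1)] c(5)])
      finally show ?thesis by simp
    qed
    have r: "on_sections A (rho A) V u i = fst (V u i)" if "V u \<in> tangent_space P u" for V
      using u rho_apply[OF u that] by (simp add: on_sections_def)
    have br: "?B u i = FD (rep P Y i) ?z (X u i) - FD (rep P X i) ?z (Y u i)"
      using i by (simp add: lie_bracket_def rep_def)
    have sym: "\<Gamma> i ?z \<xi> \<eta> = \<Gamma> i ?z \<eta> \<xi>" for \<xi> \<eta>
      using smooth_symmetric_family.sym[OF family[OF c(1)] c(5)] .
    have "torsion A D X Y u i = 0"
      using sym[of "fst (X u i)"]
      by (simp add: torsion_def cov_deriv_def local_form[OF i tX rho_section[OF Y]]
          local_form[OF i tY rho_section[OF X]] F[OF X] F[OF Y] r[of X, OF tX] r[of Y, OF tY] r[of ?B, OF tB] br)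
    moreover have "torsion A D X Y u \<in> tangent_space A (fst u)"
      using u rho_tangent[OF u tB] connection_tangent[OF conn]
      by (simp add: torsion_def cov_deriv_def on_sections_def tangent_diff)
    ultimately show ?thesis using tangent_nonzero[OF _ c(4)] by simp
  qed
qed

text \<open>Since \<open>D\<^bsub>\<beta>X\<^esub> \<eta> = 0\<close> and \<open>D\<^bsub>\<gamma>Y\<^esub> \<eta> = Y\<close>, the curvature term is \<open>- D\<^bsub>\<beta>X\<^esub> Y + K [\<beta>X, \<gamma>Y]\<close>, where \<open>K\<close> is the
  connection map. All derivatives of the components of \<open>X\<close> and \<open>Y\<close> cancel.\<close>
lemma vhv_torsion_apply:
  assumes X: "X \<in> pb_sections A" and Y: "Y \<in> pb_sections A" and i: "i \<in> charts_at P u"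
  shows "vhv_torsion A D X Y u i =
    FD (\<lambda>z. \<Gamma> i z (X u i) (snd z)) (chart_map P i u) (0, Y u i) - \<Gamma> i (chart_map P i u) (X u i) (Y u i)"
proof -
  note c = slit_chartD[OF i]
  interpret \<Gamma>: smooth_symmetric_family "slit (chart_im A i)" "\<Gamma> i" by (rule family[OF c(1)])
  let ?z = "chart_map P i u"
  let ?X = "on_sections A (beta A D) X" and ?Y = "on_sections A (gamma A) Y"
  let ?B = "lie_bracket P ?X ?Y"
  have fX: "?X \<in> vector_fields P" and fY: "?Y \<in> vector_fields P" using beta_field[OF X] gamma_field[OF Y] .
  have tX: "?X u \<in> tangent_space P u" and tB: "?B u \<in> tangent_space P u"
    using P.vector_field_tangent[OF fX] P.lie_bracket_tangent[OF fX fY c(3)] .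
  \<comment> \<open>vertical fields: the connection map returns the vertical component\<close>
  have 1: "cov_deriv D ?Y (eta A) = Y"
  proof
    fix v
    show "cov_deriv D ?Y (eta A) v = Y v"
    proof (cases "v \<in> points P")
      case False
      then show ?thesis using connection_outside[OF conn] pb_outside[OF Y] by (simp add: cov_deriv_def)
    next
      case v: True
      then obtain k where k: "k \<in> charts_at P v" using points_iff by metis
      have "?Y v k = (0, Y v k)" using v gamma_apply[OF v pb_tangent[OF Y]] by (simp add: on_sections_def)
      then have "cov_deriv D ?Y (eta A) v k = Y v k"
        using connection_map_apply[OF k P.vector_field_tangent[OF fY]] \<Gamma>_zero[OF k]
        by (simp add: cov_deriv_def connection_map_def)
      then show ?thesis unfolding cov_deriv_def
        by (intro tangent_eqI[OF connection_tangent[OF conn] pb_tangent[OF Y] slit_chartD(4)[OF k]])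
    qed
  qed
  \<comment> \<open>horizontal fields lie in the kernel of the connection map\<close>
  have 2: "cov_deriv D ?X (eta A) = 0"
  proof
    fix v
    show "cov_deriv D ?X (eta A) v = 0 v"
    proof (cases "v \<in> points P")
      case False
      then show ?thesis using connection_outside[OF conn] by (simp add: cov_deriv_def)
    next
      case v: True
      then obtain k where k: "k \<in> charts_at P v" using points_iff by metis
      have "?X v \<in> horizontal_space A D v"
        using v beta_eq[OF k pb_tangent[OF X]] lift(3)[OF k] by (simp add: on_sections_def)
      then show ?thesis by (simp add: cov_deriv_def horizontal_space_def connection_map_def)
    qed
  qed
  have 3: "cov_deriv D ?Y 0 u i = 0"
    unfolding cov_deriv_def local_form[OF i P.vector_field_tangent[OF fY] pb_zero]
    using \<Gamma>_zero[OF i] by (simp add: rep_def)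
  have Xu: "?X u i = (X u i, - \<Gamma> i ?z (X u i) (snd u i))" and Yu: "?Y u i = (0, Y u i)"
    using beta_eq[OF i pb_tangent[OF X]] lift(2)[OF i] gamma_apply[OF c(3) pb_tangent[OF Y]] c(3)
    by (simp_all add: on_sections_def)
  let ?a = "rep P X i" and ?b = "rep P Y i"
  have a: "smooth_on (slit (chart_im A i)) ?a" and b: "smooth_on (slit (chart_im A i)) ?b"
    using pb_smooth X Y c(1) by auto
  have s: "smooth_on (slit (chart_im A i)) snd"
    using smooth_on_snd[OF open_slit_im[OF c(1)] smooth_on_id[OF open_slit_im[OF c(1)]]] .
  have FY: "FD (rep P ?Y i) ?z w = (0, FD ?b ?z w)" for w
  proof -
    have "FD (rep P ?Y i) ?z = FD (\<lambda>z. (0, ?b z)) ?z"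
      by (rule FD_cong[OF open_slit_im[OF c(1)] c(5) rep_gamma[OF Y c(1)]])
    also have "\<dots> = (\<lambda>w. (0, FD ?b ?z w))"
      by (intro FD_eqI has_derivative_Pair has_derivative_const smooth_on_has_derivative[OF b c(5)])
    finally show ?thesis by simp
  qed
  have FX: "FD (rep P ?X i) ?z w = (FD ?a ?z w, - FD (\<lambda>z. \<Gamma> i z (?a z) (snd z)) ?z w)" for w
  proof -
    have "FD (rep P ?X i) ?z = FD (\<lambda>z. (?a z, - \<Gamma> i z (?a z) (snd z))) ?z"
      by (rule FD_cong[OF open_slit_im[OF c(1)] c(5) rep_beta[OF X c(1)]])
    also have "\<dots> = (\<lambda>w. (FD ?a ?z w, - FD (\<lambda>z. \<Gamma> i z (?a z) (snd z)) ?z w))"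
      by (intro FD_eqI has_derivative_Pair has_derivative_minus smooth_on_has_derivative[OF a c(5)]
          smooth_on_has_derivative[OF \<Gamma>.smooth_both[OF a s] c(5)])
    finally show ?thesis by simp
  qed
  have B: "?B u i = (- FD ?a ?z (0, Y u i), FD ?b ?z (?X u i) + FD (\<lambda>z. \<Gamma> i z (?a z) (snd z)) ?z (0, Y u i))"
    using i unfolding lie_bracket_def rep_def[symmetric] FX FY Yu by (simp add: FX FY)
  have "snd ?z = snd u i" unfolding c(6) by simp
  then have FB: "FD (\<lambda>z. \<Gamma> i z (?a z) (snd z)) ?z (0, Y u i) =
      FD (\<lambda>z. \<Gamma> i z (X u i) (snd z)) ?z (0, Y u i) + \<Gamma> i ?z (FD ?a ?z (0, Y u i)) (snd u i)"
    using \<Gamma>.FD_both[OF a s c(5)] c(7)[of X] by simp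
  have "vhv_torsion A D X Y u i = - D u (?X u) Y i + cov_deriv D ?Y 0 u i + connection_map A D u (?B u) i"
    unfolding vhv_torsion_def curvature_def 1 2 by (simp add: cov_deriv_def connection_map_def)
  also have "\<dots> = - (FD ?b ?z (?X u i) + \<Gamma> i ?z (X u i) (Y u i)) +
     (FD ?b ?z (?X u i) + FD (\<lambda>z. \<Gamma> i z (?a z) (snd z)) ?z (0, Y u i)) + \<Gamma> i ?z (- FD ?a ?z (0, Y u i)) (snd u i)"
    unfolding 3 local_form[OF i tX Y] connection_map_apply[OF i tB] B by (simp add: Xu)
  also have "\<dots> = FD (\<lambda>z. \<Gamma> i z (X u i) (snd z)) ?z (0, Y u i) - \<Gamma> i ?z (X u i) (Y u i)"
    unfolding FB \<Gamma>.minus1[OF c(5)] by simp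
  finally show ?thesis .
qed

end

section \<open>Existence of the Berwald connection\<close>

lemma scaleR_fun_apply: "(c *\<^sub>R f) x = c *\<^sub>R f x"
  by (simp add: scaleR_fun_def)

locale finsler_manifold = base_manifold A
  for A :: "('i, 'p, 'e::euclidean_space) atlas" +
  fixes L :: "('i, 'p, 'e) tangent_point \<Rightarrow> real"
  assumes finsler: "finsler A L"
begin

definition local_norm :: "'i \<Rightarrow> 'e \<times> 'e \<Rightarrow> real"
  where "local_norm i = L \<circ> chart_inv P i"

definition energy :: "'i \<Rightarrow> 'e \<times> 'e \<Rightarrow> real"
  where "energy i z = (local_norm i z)\<^sup>2 / 2"

lemma smooth_L: "smooth_fun P L"
  using finsler by (simp add: finsler_def)

lemma smooth_local_norm: "i \<in> indices A \<Longrightarrow> smooth_on (slit (chart_im A i)) (local_norm i)"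
  using smooth_L by (simp add: smooth_fun_slit local_norm_def)

lemma local_norm_pos: "i \<in> indices A \<Longrightarrow> z \<in> slit (chart_im A i) \<Longrightarrow> local_norm i z > 0"
  using finsler slit_invD(2) by (simp add: finsler_def local_norm_def)

lemma smooth_energy: assumes i: "i \<in> indices A" shows "smooth_on (slit (chart_im A i)) (energy i)"
proof -
  have "smooth_on (slit (chart_im A i)) (\<lambda>z. (1/2) * (local_norm i z * local_norm i z))"
    by (intro smooth_on_mult open_slit_im i smooth_local_norm smooth_on_const)
  then show ?thesis by (simp add: energy_def[abs_def] power2_eq_square)
qed

lemma FD_energy:
  assumes i: "i \<in> indices A" and z: "z \<in> slit (chart_im A i)"
  shows "FD (energy i) z w = local_norm i z * FD (local_norm i) z w"
proof -
  have "((\<lambda>z. (1/2) * (local_norm i z * local_norm i z)) has_derivative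
     (\<lambda>w. (1/2) * (local_norm i z * FD (local_norm i) z w + FD (local_norm i) z w * local_norm i z))) (at z)"
    by (intro has_derivative_mult_right has_derivative_mult smooth_on_has_derivative[OF smooth_local_norm[OF i] z])
  from FD_eqI[OF this] show ?thesis by (simp add: energy_def[abs_def] power2_eq_square)
qed

text \<open>Lines in a fibre are lines in the chart. Both homogeneity and the fibre Hessian, which are defined on
  the manifold, are thereby carried to coordinates.\<close>
lemma line_in_fibre:
  assumes i: "i \<in> indices A" and x: "x \<in> chart_im A i" and y: "y \<noteq> 0" "a *\<^sub>R y + b *\<^sub>R v \<noteq> 0"
  shows "chart_inv P i (x, a *\<^sub>R y + b *\<^sub>R v) =
    (fst (chart_inv P i (x, y)), a *\<^sub>R snd (chart_inv P i (x, y)) + b *\<^sub>R tvec A (chart_inv A i x) i v)"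
proof -
  let ?p = "chart_inv A i x"
  have c: "i \<in> charts_at A ?p" using i chart_inv_dom[OF x] by (simp add: charts_at_def)
  have "tvec A ?p i (a *\<^sub>R y + b *\<^sub>R v) = a *\<^sub>R tvec A ?p i y + b *\<^sub>R tvec A ?p i v"
    by (rule tangent_eqI[OF tvec_tangent[OF c] tangent_add[OF tangent_scaleR[OF tvec_tangent[OF c]]
          tangent_scaleR[OF tvec_tangent[OF c]]] c])
       (simp add: tvec_self[OF c] scaleR_fun_apply)
  then show ?thesis by (simp add: slit_inv[OF i x] y)
qed

lemma derivative_along_line:
  assumes i: "i \<in> indices A" and x: "x \<in> chart_im A i" and y: "y + t *\<^sub>R v \<noteq> 0"
    and f: "smooth_on (slit (chart_im A i)) f"
  shows "((\<lambda>t. f (x, y + t *\<^sub>R v)) has_real_derivative FD f (x, y + t *\<^sub>R v) (0, v)) (at t)"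
proof -
  have z: "(x, y + t *\<^sub>R v) \<in> slit (chart_im A i)" using x y by simp
  interpret linear "FD f (x, y + t *\<^sub>R v)" by (rule linear_FD[OF f z])
  have "((\<lambda>t. (x, y + t *\<^sub>R v)) has_derivative (\<lambda>r. r *\<^sub>R (0, v))) (at t)"
    by (auto intro!: derivative_eq_intros)
  from diff_chain_at[OF this smooth_on_has_derivative[OF f z]]
  have "((\<lambda>t. f (x, y + t *\<^sub>R v)) has_derivative (\<lambda>r. r * FD f (x, y + t *\<^sub>R v) (0, v))) (at t)"
    by (simp add: o_def scale del: scaleR_Pair)
  then show ?thesis by (simp add: has_field_derivative_def mult_commute_abs)
qed

lemma open_nonzero_line: "open {t. y + t *\<^sub>R v \<noteq> (0::'e)}"
proof -
  have "open ((\<lambda>t. y + t *\<^sub>R v) -` (- {0}))" by (intro open_vimage continuous_intros)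
  then show ?thesis by (simp add: vimage_def)
qed

text \<open>Euler's identity comes from differentiating \<open>E(x, (1 + t) y) = (1 + t)\<^sup>2 E(x, y)\<close> at \<open>t = 0\<close>, and the fibre
  Hessian is computed along a line in the chart, which avoids the zero section near \<open>t = 0\<close>.\<close>
lemma finsler_energy: assumes i: "i \<in> indices A" shows "finsler_energy (chart_im A i) (energy i)"
proof
  show "open (chart_im A i)" by (rule open_im[OF i])
  show sm: "smooth_on (slit (chart_im A i)) (energy i)" by (rule smooth_energy[OF i])
next
  fix z assume z: "z \<in> slit (chart_im A i)"
  obtain x y where xy: "z = (x, y)" by (cases z)
  have x: "x \<in> chart_im A i" and y: "y \<noteq> 0" using z xy by auto
  let ?u = "chart_inv P i z"
  have u: "?u \<in> points (tangent_bundle A)"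
    using slit_invD(1)[OF i z] i by (auto simp: points_def tangent_bundle_def slit_bundle_def)
  have scale: "energy i (x, y + t *\<^sub>R y) = (1 + t)\<^sup>2 * energy i z" if "t > -1" for t
  proof -
    have n: "(1 + t) *\<^sub>R y + 0 *\<^sub>R y \<noteq> 0" using that y by simp
    have "chart_inv P i (x, y + t *\<^sub>R y) = (fst ?u, (1 + t) *\<^sub>R snd ?u)"
      using line_in_fibre[OF i x y n] xy by (simp add: scaleR_add_left)
    moreover have "L (fst ?u, (1 + t) *\<^sub>R snd ?u) = (1 + t) * L ?u"
      using finsler u that by (simp add: finsler_def)
    ultimately show ?thesis by (simp add: energy_def local_norm_def power_mult_distrib)
  qed
  have "((\<lambda>t. energy i (x, y + t *\<^sub>R y)) has_real_derivative FD (energy i) (x, y + 0 *\<^sub>R y) (0, y)) (at 0)"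
    by (rule derivative_along_line[OF i x _ smooth_energy[OF i]]) (use y in simp)
  moreover have "((\<lambda>t. energy i (x, y + t *\<^sub>R y)) has_real_derivative 2 * energy i z) (at 0)"
  proof -
    have "((\<lambda>t. (1 + t)\<^sup>2 * energy i z) has_real_derivative 2 * energy i z) (at 0)"
      by (auto intro!: derivative_eq_intros)
    then show ?thesis
      by (rule has_field_derivative_transform_within_open[of _ _ _ "{-1<..}"]) (auto simp: scale)
  qed
  ultimately show "FD (energy i) z (0, snd z) = 2 * energy i z"
    using DERIV_unique xy by fastforce
  fix v :: 'e assume v: "v \<noteq> 0"
  let ?v = "tvec A (chart_inv A i x) i v"
  have c: "i \<in> charts_at A (fst ?u)" "fst ?u = chart_inv A i x"
    using slit_invD[OF i z] xy by auto
  have pu: "?u \<in> points P" by (rule slit_invD(2)[OF i z])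
  have tv: "?v \<in> tangent_space A (fst ?u)" "?v \<noteq> 0"
    using tvec_tangent[OF c(1), of v] tvec_self[OF c(1), of v] v c(2) by auto
  let ?E = "\<lambda>u. (L u)\<^sup>2 / 2"
  have line: "?E (fst ?u, snd ?u + s *\<^sub>R ?v + t *\<^sub>R ?v) = energy i (x, (y + s *\<^sub>R v) + t *\<^sub>R v)"
    if "y + s *\<^sub>R v + t *\<^sub>R v \<noteq> 0" for s t
  proof -
    have e: "1 *\<^sub>R y + (s + t) *\<^sub>R v = y + s *\<^sub>R v + t *\<^sub>R v" by (simp add: scaleR_add_left)
    have "1 *\<^sub>R y + (s + t) *\<^sub>R v \<noteq> 0" unfolding e by (rule that)
    from line_in_fibre[OF i x y this] show ?thesis
      unfolding e by (simp add: energy_def local_norm_def xy scaleR_add_left add.assoc)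
  qed
  have inner: "deriv (\<lambda>t. ?E (fst ?u, snd ?u + s *\<^sub>R ?v + t *\<^sub>R ?v)) 0 = FD (energy i) (x, y + s *\<^sub>R v) (0, v)"
    if s: "y + s *\<^sub>R v \<noteq> 0" for s
  proof (rule DERIV_imp_deriv)
    have "((\<lambda>t. energy i (x, (y + s *\<^sub>R v) + t *\<^sub>R v)) has_real_derivative
        FD (energy i) (x, (y + s *\<^sub>R v) + 0 *\<^sub>R v) (0, v)) (at 0)"
      by (rule derivative_along_line[OF i x _ smooth_energy[OF i]]) (use s in simp)
    then have "((\<lambda>t. energy i (x, (y + s *\<^sub>R v) + t *\<^sub>R v)) has_real_derivative
        FD (energy i) (x, y + s *\<^sub>R v) (0, v)) (at 0)" by simp
    then show "((\<lambda>t. ?E (fst ?u, snd ?u + s *\<^sub>R ?v + t *\<^sub>R ?v)) has_real_derivative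
        FD (energy i) (x, y + s *\<^sub>R v) (0, v)) (at 0)"
      by (rule has_field_derivative_transform_within_open[OF _ open_nonzero_line[of "y + s *\<^sub>R v" v]])
         (use s line in auto)
  qed
  have "fibre_hessian ?E ?u ?v ?v = fundamental_tensor (energy i) z v v"
    unfolding fibre_hessian_def
  proof (rule DERIV_imp_deriv)
    have "((\<lambda>s. FD (energy i) (x, y + s *\<^sub>R v) (0, v)) has_real_derivative
        FD (\<lambda>p. FD (energy i) p (0, v)) (x, y + 0 *\<^sub>R v) (0, v)) (at 0)"
      by (rule derivative_along_line[OF i x _ smooth_on_FD[OF smooth_energy[OF i]]]) (use y in simp)
    then have "((\<lambda>s. FD (energy i) (x, y + s *\<^sub>R v) (0, v)) has_real_derivative
        fundamental_tensor (energy i) z v v) (at 0)" by (simp add: fundamental_tensor_def xy)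
    then show "((\<lambda>s. deriv (\<lambda>t. ?E (fst ?u, snd ?u + s *\<^sub>R ?v + t *\<^sub>R ?v)) 0) has_real_derivative
        fundamental_tensor (energy i) z v v) (at 0)"
      by (rule has_field_derivative_transform_within_open[OF _ open_nonzero_line[of y v]])
         (use y inner in auto)
  qed
  moreover have "fibre_hessian ?E ?u ?v ?v > 0" using finsler pu tv unfolding finsler_def by blast
  ultimately show "fundamental_tensor (energy i) z v v > 0" by simp
qed

lemma energy_change:
  assumes i: "i \<in> indices A" and j: "j \<in> indices A"
  shows "finsler_energy_change (chart_im A i) (chart_im A j) (energy i) (energy j) (overlap A i j) (trans_map A i j)"
proof (intro finsler_energy_change.intro finsler_energy i j finsler_energy_change_axioms.intro)
  show "open (overlap A i j)" "smooth_on (overlap A i j) (trans_map A i j)"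
    using open_overlap smooth_trans i j by auto
  show "overlap A i j \<subseteq> chart_im A i" by (rule overlap_im)
  show "trans_map A i j ` overlap A i j \<subseteq> chart_im A j"
    using trans_overlap[OF i] overlap_im by blast
  show "inj (FD (trans_map A i j) x)" if "x \<in> overlap A i j" for x by (rule inj_FD_trans[OF i j that])
  fix z assume z: "z \<in> slit (overlap A i j)"
  have "chart_inv P j (trans_map P i j z) = chart_inv P i z"
    by (rule P.chart_inv_trans) (use i j z slit_overlap[OF i] in auto)
  then show "energy i z = energy j (tangent_map (trans_map A i j) z)"
    by (simp add: energy_def local_norm_def slit_trans[OF i j z])
qed

abbreviation "G i \<equiv> berwald (energy i)"

lemma berwald_family: assumes i: "i \<in> indices A" shows "smooth_symmetric_family (slit (chart_im A i)) (G i)"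
proof -
  interpret F: finsler_energy "chart_im A i" "energy i" by (rule finsler_energy[OF i])
  show ?thesis
    by (rule smooth_symmetric_family.intro)
       (use F.open_\<Omega> F.linear_berwald F.berwald_commute F.smooth_berwald in auto)
qed

definition berwald_connection :: "('i, 'p, 'e) pb_connection" where
  "berwald_connection u w Y = (if u \<in> points P \<and> w \<in> tangent_space P u \<and> Y \<in> pb_sections A
     then (\<lambda>i. if i \<in> charts_at P u
       then FD (rep P Y i) (chart_map P i u) (w i) + G i (chart_map P i u) (fst (w i)) (Y u i) else 0)
     else 0)"

lemma berwald_connection_apply:
  "i \<in> charts_at P u \<Longrightarrow> w \<in> tangent_space P u \<Longrightarrow> Y \<in> pb_sections A \<Longrightarrow>
    berwald_connection u w Y i = FD (rep P Y i) (chart_map P i u) (w i) + G i (chart_map P i u) (fst (w i)) (Y u i)"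
  using slit_chartD(3) by (simp add: berwald_connection_def)

text \<open>Independence of the chart: differentiating \<open>Y\<^sub>j(\<psi>, \<psi>' y) = \<psi>' Y\<^sub>i\<close> adds \<open>\<psi>''(\<xi>, Y\<^sub>i)\<close> to the derivative term,
  and \<open>berwald_change\<close> subtracts it from the coefficient term.\<close>
lemma berwald_connection_tangent: "berwald_connection u w Y \<in> tangent_space A (fst u)"
proof (cases "u \<in> points P \<and> w \<in> tangent_space P u \<and> Y \<in> pb_sections A")
  case False
  then show ?thesis using tangent_zero by (auto simp: berwald_connection_def)
next
  case True
  then have u: "u \<in> points P" and w: "w \<in> tangent_space P u" and Y: "Y \<in> pb_sections A" by auto
  obtain i where i: "i \<in> charts_at P u" using u points_iff by metis
  show ?thesis
  proof (rule tangentI[OF slit_chartD(4)[OF i]])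
    show "berwald_connection u w Y j = 0" if "j \<notin> charts_at A (fst u)" for j
      using that slit_charts[OF u] by (simp add: berwald_connection_def)
    fix j assume "j \<in> charts_at A (fst u)"
    then have j: "j \<in> charts_at P u" using slit_charts[OF u] by simp
    note ci = slit_chartD[OF i] and cj = slit_chartD[OF j]
    interpret finsler_energy_change "chart_im A i" "chart_im A j" "energy i" "energy j" "overlap A i j" "trans_map A i j"
      by (rule energy_change[OF ci(1) cj(1)])
    let ?\<psi> = "trans_map A i j" and ?z = "chart_map P i u" and ?x = "chart_map A i (fst u)"
    have zP: "?z \<in> overlap P i j" using P.chart_in_overlap[OF ci(2) cj(2)] .
    then have z: "?z \<in> slit (overlap A i j)" using slit_overlap[OF ci(1)] by simp
    have x: "?x \<in> overlap A i j" "fst ?z = ?x" using z ci(6) by auto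
    have o: "open (slit (overlap A i j))" using V(1) by simp
    have \<Psi>z: "trans_map P i j ?z = chart_map P j u" using P.trans_chart[OF _ ci(2)] ci(1) by simp
    have m1: "FD (\<lambda>z. rep P Y j (trans_map P i j z)) ?z = FD (\<lambda>z. FD ?\<psi> (fst z) (rep P Y i z)) ?z"
      by (rule FD_cong[OF o z pb_change[OF Y ci(1) cj(1)]])
    have m2: "FD (\<lambda>z. rep P Y j (trans_map P i j z)) ?z =
        (\<lambda>a. FD (rep P Y j) (chart_map P j u) (FD (trans_map P i j) ?z a))"
      using diff_chain_at[OF smooth_on_has_derivative[OF P.smooth_trans[of i j] zP],
          of "rep P Y j" "FD (rep P Y j) (chart_map P j u)"] ci(1) cj(1)
        smooth_on_has_derivative[OF pb_smooth[OF Y cj(1)] cj(5)]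
      by (intro FD_eqI) (simp add: \<Psi>z o_def)
    have m3: "FD (\<lambda>z. FD ?\<psi> (fst z) (rep P Y i z)) ?z a =
        FD (\<lambda>x. FD ?\<psi> x (Y u i)) ?x (fst a) + FD ?\<psi> ?x (FD (rep P Y i) ?z a)" for a
    proof -
      have "((\<lambda>z. FD ?\<psi> (fst z) (rep P Y i z)) has_derivative (\<lambda>a. FD (\<lambda>x. FD ?\<psi> x (rep P Y i ?z)) (fst ?z) (fst a)
           + FD ?\<psi> (fst ?z) (FD (rep P Y i) ?z a))) (at ?z)"
        by (rule has_derivative_FD_moving[where \<phi>=fst, OF V(1) smooth_\<psi>])
           (use x in \<open>auto intro: has_derivative_fst has_derivative_ident smooth_on_has_derivative[OF pb_smooth[OF Y ci(1)] ci(5)]\<close>)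
      from FD_eqI[OF this] show ?thesis unfolding x(2) ci(7) by simp
    qed
    have m4: "w j = FD (trans_map P i j) ?z (w i)" by (rule P.tangent_change[OF w i j])
    have 1: "FD (rep P Y j) (chart_map P j u) (w j) =
        FD (\<lambda>x. FD ?\<psi> x (Y u i)) ?x (fst (w i)) + FD ?\<psi> ?x (FD (rep P Y i) ?z (w i))"
      unfolding m4 m3[symmetric] m1[symmetric] m2 ..
    have "chart_map P j u = tangent_map ?\<psi> ?z" using \<Psi>z slit_trans[OF ci(1) cj(1) z] by simp
    moreover have "fst (w j) = FD ?\<psi> ?x (fst (w i))" by (rule slit_tangent_change'(1)[OF w i j])
    moreover have "Y u j = FD ?\<psi> ?x (Y u i)" by (rule tangent_change[OF pb_tangent[OF Y] ci(4) cj(4)])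
    ultimately have 2: "G j (chart_map P j u) (fst (w j)) (Y u j) =
        FD ?\<psi> ?x (G i ?z (fst (w i)) (Y u i)) - FD (\<lambda>x. FD ?\<psi> x (fst (w i))) ?x (Y u i)"
      using berwald_change[OF z] x(2) by simp
    interpret lin: linear "FD ?\<psi> ?x" by (rule linear_\<psi>[OF x(1)])
    show "berwald_connection u w Y j = FD ?\<psi> ?x (berwald_connection u w Y i)"
      unfolding berwald_connection_apply[OF j w Y] berwald_connection_apply[OF i w Y] 1 2 lin.add
      using \<psi>2_commute[OF x(1), of "Y u i" "fst (w i)"] by simp
  qed
qed

lemma linear_berwald_connection: "linear_connection A berwald_connection"
  unfolding linear_connection_def
proof (intro conjI allI impI ballI)
  show "berwald_connection u w Y = 0"
    if "\<not> (u \<in> points P \<and> w \<in> tangent_space P u \<and> Y \<in> pb_sections A)" for u w Y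
    using that by (auto simp: berwald_connection_def)
next
  fix u Y w w' and a b :: real
  assume u: "u \<in> points P" and Y: "Y \<in> pb_sections A" and w: "w \<in> tangent_space P u" and w': "w' \<in> tangent_space P u"
  obtain i where i: "i \<in> charts_at P u" using u points_iff by metis
  note c = slit_chartD[OF i]
  interpret \<Gamma>: smooth_symmetric_family "slit (chart_im A i)" "G i" by (rule berwald_family[OF c(1)])
  interpret d: linear "FD (rep P Y i) (chart_map P i u)" by (rule linear_FD[OF pb_smooth[OF Y c(1)] c(5)])
  interpret g: linear "\<lambda>\<xi>. G i (chart_map P i u) \<xi> (Y u i)" by (rule \<Gamma>.lin1[OF c(5)])
  have t: "a *\<^sub>R w + b *\<^sub>R w' \<in> tangent_space P u" by (intro P.tangent_add P.tangent_scaleR w w')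
  show "berwald_connection u (a *\<^sub>R w + b *\<^sub>R w') Y = a *\<^sub>R berwald_connection u w Y + b *\<^sub>R berwald_connection u w' Y"
  proof (rule tangent_eqI[OF berwald_connection_tangent _ c(4)])
    show "(a *\<^sub>R berwald_connection u w Y + b *\<^sub>R berwald_connection u w' Y) \<in> tangent_space A (fst u)"
      by (intro tangent_add tangent_scaleR berwald_connection_tangent)
    show "berwald_connection u (a *\<^sub>R w + b *\<^sub>R w') Y i = (a *\<^sub>R berwald_connection u w Y + b *\<^sub>R berwald_connection u w' Y) i"
      by (simp add: berwald_connection_apply[OF i _ Y] t w w' scaleR_fun_apply d.add d.scale g.add g.scale algebra_simps)
  qed
next
  fix u w Y Z
  assume u: "u \<in> points P" and w: "w \<in> tangent_space P u" and Y: "Y \<in> pb_sections A" and Z: "Z \<in> pb_sections A"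
  obtain i where i: "i \<in> charts_at P u" using u points_iff by metis
  note c = slit_chartD[OF i]
  interpret \<Gamma>: smooth_symmetric_family "slit (chart_im A i)" "G i" by (rule berwald_family[OF c(1)])
  interpret g: linear "G i (chart_map P i u) (fst (w i))" by (rule \<Gamma>.lin[OF c(5)])
  have "FD (rep P (Y + Z) i) (chart_map P i u) = (\<lambda>v. FD (rep P Y i) (chart_map P i u) v + FD (rep P Z i) (chart_map P i u) v)"
  proof -
    have "((\<lambda>z. rep P Y i z + rep P Z i z) has_derivative
       (\<lambda>v. FD (rep P Y i) (chart_map P i u) v + FD (rep P Z i) (chart_map P i u) v)) (at (chart_map P i u))"
      by (intro has_derivative_add smooth_on_has_derivative[OF pb_smooth[OF _ c(1)] c(5)] Y Z)
    from FD_eqI[OF this] show ?thesis by (simp add: rep_def[abs_def])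
  qed
  then show "berwald_connection u w (Y + Z) = berwald_connection u w Y + berwald_connection u w Z"
    by (intro tangent_eqI[OF berwald_connection_tangent tangent_add[OF berwald_connection_tangent berwald_connection_tangent] c(4)])
       (simp add: berwald_connection_apply[OF i w] Y Z pb_add g.add)
next
  fix u w f Y
  assume u: "u \<in> points P" and w: "w \<in> tangent_space P u" and Y: "Y \<in> pb_sections A" and f: "smooth_fun P f"
  obtain i where i: "i \<in> charts_at P u" using u points_iff by metis
  note c = slit_chartD[OF i]
  let ?z = "chart_map P i u"
  interpret \<Gamma>: smooth_symmetric_family "slit (chart_im A i)" "G i" by (rule berwald_family[OF c(1)])
  interpret g: linear "G i ?z (fst (w i))" by (rule \<Gamma>.lin[OF c(5)])
  have fz: "(f \<circ> chart_inv P i) ?z = f u" using P.chart_inv_chart[of i u] c by simp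
  have "FD (rep P (\<lambda>u. f u *\<^sub>R Y u) i) ?z = (\<lambda>v. f u *\<^sub>R FD (rep P Y i) ?z v + FD (f \<circ> chart_inv P i) ?z v *\<^sub>R Y u i)"
  proof -
    have "smooth_on (slit (chart_im A i)) (f \<circ> chart_inv P i)" using f c(1) smooth_fun_slit by blast
    then have "((\<lambda>z. (f \<circ> chart_inv P i) z *\<^sub>R rep P Y i z) has_derivative
       (\<lambda>v. (f \<circ> chart_inv P i) ?z *\<^sub>R FD (rep P Y i) ?z v + FD (f \<circ> chart_inv P i) ?z v *\<^sub>R rep P Y i ?z)) (at ?z)"
      by (intro has_derivative_scaleR smooth_on_has_derivative[OF pb_smooth[OF Y c(1)] c(5)] smooth_on_has_derivative[OF _ c(5)])
    from FD_eqI[OF this] show ?thesis unfolding fz c(7) by (simp add: rep_def[abs_def] scaleR_fun_def)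
  qed
  moreover have "fun_deriv P f u w = FD (f \<circ> chart_inv P i) ?z (w i)" by (rule P.fun_deriv_chart[OF f i w])
  ultimately show "berwald_connection u w (\<lambda>u'. f u' *\<^sub>R Y u') = fun_deriv P f u w *\<^sub>R Y u + f u *\<^sub>R berwald_connection u w Y"
    by (intro tangent_eqI[OF berwald_connection_tangent _ c(4)])
       (simp_all add: berwald_connection_apply[OF i w] Y pb_scale[OF f] g.scale scaleR_fun_apply algebra_simps
         tangent_add tangent_scaleR berwald_connection_tangent pb_tangent)
next
  fix X Y assume X: "X \<in> vector_fields P" and Y: "Y \<in> pb_sections A"
  show "cov_deriv berwald_connection X Y \<in> pb_sections A"
  proof (rule pbI)
    show "cov_deriv berwald_connection X Y u \<in> tangent_space A (fst u)" for u
      unfolding cov_deriv_def by (rule berwald_connection_tangent)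
    show "cov_deriv berwald_connection X Y u = 0" if "u \<notin> points P" for u
      using that by (simp add: cov_deriv_def berwald_connection_def)
    fix i assume i: "i \<in> indices A"
    interpret \<Gamma>: smooth_symmetric_family "slit (chart_im A i)" "G i" by (rule berwald_family[OF i])
    note o = open_slit_im[OF i]
    show "smooth_on (slit (chart_im A i)) (rep P (cov_deriv berwald_connection X Y) i)"
    proof (rule smooth_on_cong[OF o])
      show "smooth_on (slit (chart_im A i)) (\<lambda>z. FD (rep P Y i) z (rep P X i z) + G i z (fst (rep P X i z)) (rep P Y i z))"
        by (intro smooth_on_add o smooth_on_FD_moving[OF o pb_smooth[OF Y i]] \<Gamma>.smooth_both smooth_on_fst
            vf_smooth[OF X i] pb_smooth[OF Y i] smooth_on_id) auto
      fix z assume z: "z \<in> slit (chart_im A i)"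
      note d = slit_invD[OF i z]
      show "FD (rep P Y i) z (rep P X i z) + G i z (fst (rep P X i z)) (rep P Y i z) = rep P (cov_deriv berwald_connection X Y) i z"
        using berwald_connection_apply[OF d(4) P.vector_field_tangent[OF X] Y] unfolding d(3)
        by (simp add: rep_def cov_deriv_def)
    qed
  qed
qed

sublocale berwald: symmetric_connection A berwald_connection "\<lambda>i. G i"
  by (intro symmetric_connection.intro symmetric_connection_axioms.intro base_manifold_axioms
      linear_berwald_connection berwald_family berwald_connection_apply)

end

section \<open>Uniqueness of the Berwald connection\<close>

lemma sum_fun_apply: "(\<Sum>a\<in>I. f a) x = (\<Sum>a\<in>I. f a x)"
  by (induction I rule: infinite_finite_induct) auto

context symmetric_connection begin

lemma vhv_torsion_tangent: "vhv_torsion A D X Y u \<in> tangent_space A (fst u)"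
proof -
  have "vhv_torsion A D X Y u = (-1) *\<^sub>R a + b + c"
    if "a = D u (on_sections A (beta A D) X u) (cov_deriv D (on_sections A (gamma A) Y) (eta A))"
      "b = D u (on_sections A (gamma A) Y u) (cov_deriv D (on_sections A (beta A D) X) (eta A))"
      "c = D u (lie_bracket P (on_sections A (beta A D) X) (on_sections A (gamma A) Y) u) (eta A)" for a b c
    unfolding vhv_torsion_def curvature_def that by (simp add: cov_deriv_def)
  then show ?thesis
    by (metis tangent_add tangent_scaleR connection_tangent[OF conn])
qed

lemma vhv_torsion_outside: "u \<notin> points P \<Longrightarrow> vhv_torsion A D X Y u = 0"
  using connection_outside[OF conn] by (simp add: vhv_torsion_def curvature_def cov_deriv_def)

end

context finsler_manifold begin

text \<open>Since \<open>dE = L dL\<close> and \<open>L > 0\<close>, it is equivalent that \<open>dE\<close> vanishes on the horizontal lift \<open>(\<xi>, - N(\<xi>))\<close>.\<close>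
lemma fun_deriv_L_horizontal:
  assumes "symmetric_connection A D \<Gamma>" and i: "i \<in> charts_at P u" and w: "w \<in> tangent_space P u"
  shows "fun_deriv P L u (horizontal_projector A D u w) = 0 \<longleftrightarrow>
    FD (energy i) (chart_map P i u) (fst (w i), 0) =
    FD (energy i) (chart_map P i u) (0, \<Gamma> i (chart_map P i u) (fst (w i)) (snd u i))"
proof -
  interpret S: symmetric_connection A D \<Gamma> by fact
  note c = slit_chartD[OF i]
  let ?z = "chart_map P i u" and ?N = "\<Gamma> i (chart_map P i u) (fst (w i)) (snd u i)"
  interpret e: linear "FD (energy i) ?z" by (rule linear_FD[OF smooth_energy[OF c(1)] c(5)])
  have "horizontal_projector A D u w i = (fst (w i), - ?N)"
    unfolding S.projector_eq[OF i w] S.lift(2)[OF i] ..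
  then have "fun_deriv P L u (horizontal_projector A D u w) = FD (local_norm i) ?z (fst (w i), - ?N)"
    using P.fun_deriv_chart[OF smooth_L i S.lift(1)[OF i]] unfolding S.projector_eq[OF i w] local_norm_def by metis
  moreover have "FD (energy i) ?z (fst (w i), - ?N) = local_norm i ?z * FD (local_norm i) ?z (fst (w i), - ?N)"
    by (rule FD_energy[OF c(1,5)])
  moreover have "FD (energy i) ?z (fst (w i), - ?N) = FD (energy i) ?z (fst (w i), 0) - FD (energy i) ?z (0, ?N)"
    unfolding e.diff[symmetric] by simp
  moreover have "local_norm i ?z > 0" by (rule local_norm_pos[OF c(1,5)])
  ultimately show ?thesis by auto
qed

lemma berwald_connection_preserves_L:
  assumes X: "X \<in> vector_fields P" and u: "u \<in> points P"
  shows "fun_deriv P L u (horizontal_projector A berwald_connection u (X u)) = 0"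
proof -
  obtain i where i: "i \<in> charts_at P u" using u points_iff by metis
  note c = slit_chartD[OF i]
  interpret F: finsler_energy "chart_im A i" "energy i" by (rule finsler_energy[OF c(1)])
  have "snd (chart_map P i u) = snd u i" unfolding c(6) by simp
  with F.horizontal_energy_berwald[OF c(5)] show ?thesis
    unfolding fun_deriv_L_horizontal[OF berwald.symmetric_connection_axioms i P.vector_field_tangent[OF X]] by metis
qed

lemma berwald_connection_vhv_zero:
  assumes X: "X \<in> pb_sections A" and Y: "Y \<in> pb_sections A"
  shows "vhv_torsion A berwald_connection X Y = 0"
proof
  fix u
  show "vhv_torsion A berwald_connection X Y u = 0 u"
  proof (cases "u \<in> points P")
    case True
    then obtain i where i: "i \<in> charts_at P u" using points_iff by metis
    note c = slit_chartD[OF i]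
    interpret F: finsler_energy "chart_im A i" "energy i" by (rule finsler_energy[OF c(1)])
    have "vhv_torsion A berwald_connection X Y u i = 0"
      unfolding berwald.vhv_torsion_apply[OF X Y i] F.FD_berwald_fundamental[OF c(5)] by simp
    then show ?thesis using tangent_nonzero[OF berwald.vhv_torsion_tangent c(4)] by simp
  qed (simp add: berwald.vhv_torsion_outside)
qed

end

locale torsion_free_connection = base_manifold A
  for A :: "('i, 'p, 'e::euclidean_space) atlas" +
  fixes D :: "('i, 'p, 'e) pb_connection"
  assumes conn: "linear_connection A D"
    and torsion_free: "\<And>X Y. X \<in> vector_fields P \<Longrightarrow> Y \<in> vector_fields P \<Longrightarrow> torsion A D X Y = 0"
begin

lemma D_linear: "u \<in> points P \<Longrightarrow> Y \<in> pb_sections A \<Longrightarrow> w \<in> tangent_space P u \<Longrightarrow> w' \<in> tangent_space P u \<Longrightarrow>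
    D u (a *\<^sub>R w + b *\<^sub>R w') Y = a *\<^sub>R D u w Y + b *\<^sub>R D u w' Y"
  and D_add: "u \<in> points P \<Longrightarrow> w \<in> tangent_space P u \<Longrightarrow> Y \<in> pb_sections A \<Longrightarrow> Z \<in> pb_sections A \<Longrightarrow>
    D u w (Y + Z) = D u w Y + D u w Z"
  and D_Leibniz: "u \<in> points P \<Longrightarrow> w \<in> tangent_space P u \<Longrightarrow> smooth_fun P f \<Longrightarrow> Y \<in> pb_sections A \<Longrightarrow>
    D u w (\<lambda>u'. f u' *\<^sub>R Y u') = fun_deriv P f u w *\<^sub>R Y u + f u *\<^sub>R D u w Y"
  and D_section: "X \<in> vector_fields P \<Longrightarrow> Y \<in> pb_sections A \<Longrightarrow> cov_deriv D X Y \<in> pb_sections A"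
  using conn unfolding linear_connection_def by blast+

lemma D_zero: "u \<in> points P \<Longrightarrow> w \<in> tangent_space P u \<Longrightarrow> D u w 0 = 0"
  using D_add[of u w 0 0] pb_zero by simp

lemma D_sum:
  assumes "u \<in> points P" "w \<in> tangent_space P u" "\<And>a. a \<in> I \<Longrightarrow> Z a \<in> pb_sections A"
  shows "D u w (\<Sum>a\<in>I. Z a) = (\<Sum>a\<in>I. D u w (Z a))"
  using assms(3)
  by (induction I rule: infinite_finite_induct) (auto simp: D_zero[OF assms(1,2)] D_add[OF assms(1,2)] pb_sum)

text \<open>The global function \<open>\<phi> Y\<^sup>a\<close>, where \<open>Y\<^sup>a\<close> is a coordinate of \<open>Y\<close> in the chart \<open>i\<close>.\<close>
definition component :: "'i \<Rightarrow> ('p \<Rightarrow> real) \<Rightarrow> ('i, 'p, 'e) pb_section \<Rightarrow> 'e \<Rightarrow> ('i, 'p, 'e) tangent_point \<Rightarrow> real" where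
  "component i \<phi> Y a u = (if fst u \<in> chart_dom A i then \<phi> (fst u) * (Y u i \<bullet> a) else 0)"

lemma smooth_component:
  assumes \<phi>: "cutoff i p W \<phi>" and i: "i \<in> indices A" and Y: "Y \<in> pb_sections A"
  shows "smooth_fun P (component i \<phi> Y a)"
  unfolding smooth_fun_slit
proof
  fix j assume j: "j \<in> indices A"
  have o: "open (slit (overlap A j i))" using open_overlap[OF j i] by simp
  have oP: "overlap P j i = slit (overlap A j i)" by (rule slit_overlap[OF j])
  have "smooth_on (slit (overlap A j i)) (\<lambda>z. rep P Y i (trans_map P j i z))"
    by (rule smooth_on_compose[OF o pb_smooth[OF Y i]])
       (use P.smooth_trans[of j i] P.trans_overlap[of j _ i] slit_overlap[OF i] i j overlap_im in \<open>fastforce simp: oP\<close>)+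
  then have G: "smooth_on (slit (overlap A j i)) (\<lambda>z. rep P Y i (trans_map P j i z) \<bullet> a)"
    by (intro smooth_on_inner o smooth_on_const)
  show "smooth_on (slit (chart_im A j)) (component i \<phi> Y a \<circ> chart_inv P j)"
  proof (rule smooth_on_cong[OF open_slit_im[OF j] _ cutoff_extension_smooth[OF \<phi> i j G]])
    fix z assume z: "z \<in> slit (chart_im A j)"
    note d = slit_invD[OF j z]
    show "(if fst (chart_inv P j z) \<in> chart_dom A i then \<phi> (fst (chart_inv P j z)) *\<^sub>R
        (rep P Y i (trans_map P j i z) \<bullet> a) else 0) = (component i \<phi> Y a \<circ> chart_inv P j) z"
    proof (cases "fst (chart_inv P j z) \<in> chart_dom A i")
      case True
      have zi: "fst z \<in> chart_im A j" "snd z \<noteq> 0" using z by (simp_all add: mem_Times_iff)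
      have "fst z \<in> overlap A j i" unfolding overlap_iff[OF j] using zi(1) True unfolding d(7) by blast
      then have "z \<in> overlap P j i" unfolding oP using zi(2) by (simp add: mem_Times_iff)
      then have "chart_inv P i (trans_map P j i z) = chart_inv P j z" using P.chart_inv_trans[of j i z] i j by simp
      then show ?thesis using True by (simp add: component_def rep_def)
    qed (simp add: component_def)
  qed
qed

lemma cutoff_vanishes:
  assumes \<phi>: "cutoff i p W \<phi>" and q: "q \<in> points A" "q \<notin> chart_dom A i"
  shows "\<phi> q = 0"
proof -
  obtain j where j: "j \<in> indices A" "q \<in> chart_dom A j" using q(1) by (auto simp: points_def)
  then obtain V where "chart_map A j q \<in> V" "\<forall>x\<in>V. \<phi> (chart_inv A j x) = 0"
    using \<phi> q(2) unfolding cutoff_def by metis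
  then show ?thesis using chart_inv_chart[OF j] by metis
qed

lemma smooth_cutoff_square:
  assumes \<phi>: "cutoff i p W \<phi>"
  shows "smooth_fun P (\<lambda>u. \<phi> (fst u) * \<phi> (fst u))"
  unfolding smooth_fun_slit
proof
  fix j assume j: "j \<in> indices A"
  note o = open_slit_im[OF j]
  have "smooth_on (slit (chart_im A j)) (\<lambda>z. \<phi> (chart_inv A j (fst z)))"
    by (rule smooth_on_compose[OF o, of "chart_im A j" "\<lambda>x. \<phi> (chart_inv A j x)" fst])
       (use \<phi> j smooth_on_fst[OF o smooth_on_id[OF o]] in \<open>auto simp: cutoff_def\<close>)
  then have "smooth_on (slit (chart_im A j)) (\<lambda>z. \<phi> (chart_inv A j (fst z)) * \<phi> (chart_inv A j (fst z)))"
    by (intro smooth_on_mult o)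
  then show "smooth_on (slit (chart_im A j)) ((\<lambda>u. \<phi> (fst u) * \<phi> (fst u)) \<circ> chart_inv P j)"
    by (rule smooth_on_cong[OF o, rotated]) (simp add: slit_invD(7)[OF j])
qed

text \<open>The Leibniz rule applied to \<open>\<phi>\<^sup>2 Y = \<Sum>\<^sub>a (\<phi> Y\<^sup>a) (\<phi> e\<^sub>a)\<close>. Two factors \<open>\<phi>\<close> are needed, since both the coefficient
  functions and the basis sections must be global.\<close>
lemma local_expansion:
  assumes \<phi>: "cutoff i p W \<phi>" and i: "i \<in> charts_at P u" and uW: "chart_map A i (fst u) \<in> W"
    and w: "w \<in> tangent_space P u" and Y: "Y \<in> pb_sections A"
  shows "D u w Y i = FD (rep P Y i) (chart_map P i u) (w i) +
    (\<Sum>a\<in>Basis. (Y u i \<bullet> a) *\<^sub>R D u w (ext_section i \<phi> a) i)"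
proof -
  note c = slit_chartD[OF i]
  let ?z = "chart_map P i u" and ?E = "ext_section i \<phi>" and ?f = "component i \<phi> Y"
  have zW: "?z \<in> slit W" using uW c(5,6) by auto
  have oW: "open (slit W)" and sub: "slit W \<subseteq> slit (chart_im A i)" using cutoff_slit[OF \<phi>] by auto
  have \<phi>1: "\<phi> (fst (chart_inv P i z)) = 1" and inv: "z \<in> slit (chart_im A i)" if "z \<in> slit W" for z
  proof -
    show z: "z \<in> slit (chart_im A i)" using that sub by blast
    show "\<phi> (fst (chart_inv P i z)) = 1"
      unfolding slit_invD(7)[OF c(1) z] using \<phi> that by (auto simp: cutoff_def)
  qed
  have \<phi>u: "\<phi> (fst u) = 1" by (rule cutoff_one[OF \<phi> i uW])
  have du: "fst u \<in> chart_dom A i" using c(2) by (simp add: slit_dom)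
  have E: "?E a \<in> pb_sections A" for a by (rule ext_section[OF \<phi> c(1)])
  have f: "smooth_fun P (?f a)" for a by (rule smooth_component[OF \<phi> c(1) Y])
  have split: "(\<lambda>v. (\<phi> (fst v) * \<phi> (fst v)) *\<^sub>R Y v) = (\<Sum>a\<in>Basis. (\<lambda>v. ?f a v *\<^sub>R ?E a v))"
  proof
    fix v
    show "(\<phi> (fst v) * \<phi> (fst v)) *\<^sub>R Y v = (\<Sum>a\<in>Basis. (\<lambda>v. ?f a v *\<^sub>R ?E a v)) v"
    proof (cases "v \<in> points P \<and> fst v \<in> chart_dom A i")
      case True
      then have iv: "i \<in> charts_at A (fst v)" using c(1) by (simp add: charts_at_def)
      show ?thesis
      proof (rule tangent_eqI[OF _ _ iv])
        show "(\<phi> (fst v) * \<phi> (fst v)) *\<^sub>R Y v \<in> tangent_space A (fst v)"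
          by (intro tangent_scaleR pb_tangent[OF Y])
        show "(\<Sum>a\<in>Basis. (\<lambda>v. ?f a v *\<^sub>R ?E a v)) v \<in> tangent_space A (fst v)"
          unfolding sum_fun_apply[where x=v] by (intro tangent_sum tangent_scaleR pb_tangent[OF E])
        have "(\<Sum>a\<in>Basis. (\<lambda>v. ?f a v *\<^sub>R ?E a v)) v i = (\<Sum>a\<in>Basis. (\<phi> (fst v) * \<phi> (fst v)) *\<^sub>R ((Y v i \<bullet> a) *\<^sub>R a))"
          unfolding sum_fun_apply[where x=v] sum_fun_apply[where x=i] using True tvec_self[OF iv]
          by (intro sum.cong) (simp_all add: component_def ext_section_def scaleR_fun_apply ac_simps)
        also have "\<dots> = (\<phi> (fst v) * \<phi> (fst v)) *\<^sub>R Y v i"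
          unfolding scaleR_sum_right[symmetric] by (simp add: euclidean_representation)
        finally show "((\<phi> (fst v) * \<phi> (fst v)) *\<^sub>R Y v) i = (\<Sum>a\<in>Basis. (\<lambda>v. ?f a v *\<^sub>R ?E a v)) v i"
          by (simp only: scaleR_fun_apply)
      qed
    next
      case False
      then have "(\<phi> (fst v) * \<phi> (fst v)) *\<^sub>R Y v = 0"
        using pb_outside[OF Y, of v] cutoff_vanishes[OF \<phi>, of "fst v"] by (auto simp: slit_points)
      moreover have "?E a v = 0" for a using False by (auto simp: ext_section_def)
      ultimately show ?thesis unfolding sum_fun_apply[where x=v] by simp
    qed
  qed
  have "FD ((\<lambda>u. \<phi> (fst u) * \<phi> (fst u)) \<circ> chart_inv P i) ?z = FD (\<lambda>_. 1) ?z"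
    by (rule FD_cong[OF oW zW]) (simp add: \<phi>1)
  then have "fun_deriv P (\<lambda>u. \<phi> (fst u) * \<phi> (fst u)) u w = 0"
    using P.fun_deriv_chart[OF smooth_cutoff_square[OF \<phi>] i w] by simp
  then have "D u w (\<lambda>v. (\<phi> (fst v) * \<phi> (fst v)) *\<^sub>R Y v) = D u w Y"
    using D_Leibniz[OF c(3) w smooth_cutoff_square[OF \<phi>] Y] \<phi>u by simp
  then have e: "D u w Y = (\<Sum>a\<in>Basis. D u w (\<lambda>v. ?f a v *\<^sub>R ?E a v))"
    unfolding split D_sum[OF c(3) w pb_scale[OF f E]] by (rule sym)
  have "D u w Y i = (\<Sum>a\<in>Basis. D u w (\<lambda>v. ?f a v *\<^sub>R ?E a v) i)"
    unfolding e by (rule sum_fun_apply)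
  also have "\<dots> = (\<Sum>a\<in>Basis. (FD (rep P Y i) ?z (w i) \<bullet> a) *\<^sub>R a + (Y u i \<bullet> a) *\<^sub>R D u w (?E a) i)"
  proof (rule sum.cong[OF refl])
    fix a :: 'e
    have "FD (?f a \<circ> chart_inv P i) ?z = FD (\<lambda>z. rep P Y i z \<bullet> a) ?z"
    proof (rule FD_cong[OF oW zW])
      fix z assume z: "z \<in> slit W"
      have "fst (chart_inv P i z) \<in> chart_dom A i" using slit_invD(1)[OF c(1) inv[OF z]] by (simp add: slit_dom)
      then show "(?f a \<circ> chart_inv P i) z = rep P Y i z \<bullet> a" using \<phi>1[OF z] by (simp add: component_def rep_def)
    qed
    also have "\<dots> = (\<lambda>w. FD (rep P Y i) ?z w \<bullet> a)"
      by (intro FD_eqI has_derivative_inner_left smooth_on_has_derivative[OF pb_smooth[OF Y c(1)] c(5)])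
    finally have "fun_deriv P (?f a) u w = FD (rep P Y i) ?z (w i) \<bullet> a"
      using P.fun_deriv_chart[OF f i w] by simp
    moreover have "?E a u i = a" by (rule ext_at(1)[OF \<phi> i uW])
    moreover have "?f a u = Y u i \<bullet> a" using \<phi>u du by (simp add: component_def)
    ultimately show "D u w (\<lambda>v. ?f a v *\<^sub>R ?E a v) i = (FD (rep P Y i) ?z (w i) \<bullet> a) *\<^sub>R a + (Y u i \<bullet> a) *\<^sub>R D u w (?E a) i"
      using D_Leibniz[OF c(3) w f E] by (simp add: scaleR_fun_apply)
  qed
  also have "\<dots> = FD (rep P Y i) ?z (w i) + (\<Sum>a\<in>Basis. (Y u i \<bullet> a) *\<^sub>R D u w (?E a) i)"
    by (simp add: sum.distrib euclidean_representation)
  finally show ?thesis .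
qed

text \<open>Apply \<open>local_expansion\<close> to a section with constant components. The right-hand side does not depend on \<open>\<phi>'\<close>,
  so the coefficients of the connection do not depend on the cutoff function, and they are linear in \<open>e\<close>.\<close>
lemma ext_expansion:
  assumes \<phi>: "cutoff i p W \<phi>" and i: "i \<in> charts_at P u" and uW: "chart_map A i (fst u) \<in> W"
    and \<phi>': "cutoff i p' W' \<phi>'" and uW': "chart_map A i (fst u) \<in> W'"
    and w: "w \<in> tangent_space P u"
  shows "D u w (ext_section i \<phi>' e) i = (\<Sum>a\<in>Basis. (e \<bullet> a) *\<^sub>R D u w (ext_section i \<phi> a) i)"
proof -
  note c = slit_chartD[OF i]
  have "chart_map P i u \<in> slit W'" using uW' c(5,6) by auto
  from FD_rep_ext(1)[OF \<phi>' c(1) this, of e] show ?thesis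
    using local_expansion[OF \<phi> i uW w ext_section[OF \<phi>' c(1), of e]] ext_at(1)[OF \<phi>' i uW', of e] by simp
qed

lemma local_form_cutoff:
  assumes \<phi>: "cutoff i p W \<phi>" and i: "i \<in> charts_at P u" and uW: "chart_map A i (fst u) \<in> W"
    and w: "w \<in> tangent_space P u" and Y: "Y \<in> pb_sections A"
  shows "D u w Y i = FD (rep P Y i) (chart_map P i u) (w i) + D u w (ext_section i \<phi> (Y u i)) i"
  using local_expansion[OF \<phi> i uW w Y] unfolding ext_expansion[OF \<phi> i uW \<phi> uW w, symmetric] .

definition pointed_cutoff :: "'i \<Rightarrow> 'p \<Rightarrow> 'p \<Rightarrow> real"
  where "pointed_cutoff i p = (SOME \<phi>. \<exists>W. cutoff i p W \<phi>)"

lemma pointed_cutoff: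
  assumes "i \<in> charts_at P u"
  obtains W where "cutoff i (fst u) W (pointed_cutoff i (fst u))" "chart_map A i (fst u) \<in> W"
proof -
  have "\<exists>\<phi> W. cutoff i (fst u) W \<phi>" using obtain_cutoff[OF assms] by metis
  then have "\<exists>W. cutoff i (fst u) W (pointed_cutoff i (fst u))" unfolding pointed_cutoff_def by (rule someI_ex)
  then show ?thesis using that by (auto simp: cutoff_def)
qed

text \<open>Each point needs its own cutoff function. By \<open>christoffel_cutoff\<close> any cutoff function that equals one near
  the point gives the same value; this makes the coefficients smooth.\<close>
definition christoffel :: "'i \<Rightarrow> 'e \<times> 'e \<Rightarrow> 'e \<Rightarrow> 'e \<Rightarrow> 'e" where
  "christoffel i z \<xi> \<eta> = (let u = chart_inv P i z in
     D u (tvec P u i (\<xi>, 0)) (ext_section i (pointed_cutoff i (fst u)) \<eta>) i)"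

lemma christoffel_cutoff:
  assumes \<phi>: "cutoff i p W \<phi>" and i: "i \<in> charts_at P u" and uW: "chart_map A i (fst u) \<in> W"
  shows "christoffel i (chart_map P i u) \<xi> \<eta> = D u (tvec P u i (\<xi>, 0)) (ext_section i \<phi> \<eta>) i"
proof -
  obtain W' where W': "cutoff i (fst u) W' (pointed_cutoff i (fst u))" "chart_map A i (fst u) \<in> W'"
    using pointed_cutoff[OF i] by metis
  note t = P.tvec_tangent[OF i]
  have inv: "chart_inv P i (chart_map P i u) = u" using P.chart_inv_chart[of i u] slit_chartD[OF i] by simp
  show ?thesis
    unfolding christoffel_def Let_def inv ext_expansion[OF \<phi> i uW W' t]
    by (rule ext_expansion[OF \<phi> i uW \<phi> uW t, symmetric])
qed

lemma tvec_add_scaleR: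
  assumes i: "i \<in> charts_at P u"
  shows "tvec P u i (a *\<^sub>R c + b *\<^sub>R d) = a *\<^sub>R tvec P u i c + b *\<^sub>R tvec P u i d"
  by (rule P.tangent_eqI[OF P.tvec_tangent[OF i] P.tangent_add[OF P.tangent_scaleR[OF P.tvec_tangent[OF i]]
        P.tangent_scaleR[OF P.tvec_tangent[OF i]]] i])
     (simp only: P.tvec_self[OF i] scaleR_fun_apply plus_fun_apply)

text \<open>The torsion of two fields with constant components, whose bracket vanishes. For a vertical \<open>c\<close> the right-hand
  side is zero, so the coefficients see only the horizontal component of the direction; for horizontal \<open>c\<close> and
  \<open>d\<close> it is their symmetry.\<close>
lemma torsion_symmetry:
  assumes \<phi>: "cutoff i p W \<phi>" and i: "i \<in> charts_at P u" and uW: "chart_map A i (fst u) \<in> W"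
  shows "D u (tvec P u i c) (ext_section i \<phi> (fst d)) i = D u (tvec P u i d) (ext_section i \<phi> (fst c)) i"
proof -
  note ci = slit_chartD[OF i]
  let ?X = "ext_field i \<phi>" and ?z = "chart_map P i u"
  have X: "?X c \<in> vector_fields P" for c by (rule ext_field[OF \<phi> ci(1)])
  have Xu: "?X c u = tvec P u i c" for c
    by (rule P.tangent_eqI[OF P.vector_field_tangent[OF X] P.tvec_tangent[OF i] i])
       (simp add: ext_at(2)[OF \<phi> i uW] P.tvec_self[OF i])
  have zW: "?z \<in> slit W" using uW ci(5,6) by auto
  have oW: "open (slit W)" and sub: "slit W \<subseteq> slit (chart_im A i)" using cutoff_slit[OF \<phi>] by auto
  let ?R = "\<lambda>c. on_sections A (rho A) (?X c)"
  have "FD (rep P (?R c) i) ?z = FD (\<lambda>_. fst c) ?z" for c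
    by (rule FD_cong[OF oW zW]) (simp only: rep_rho[OF X ci(1) subsetD[OF sub]] rep_ext(2)[OF \<phi> ci(1)])
  then have FR: "FD (rep P (?R c) i) ?z = (\<lambda>_. 0)" for c by simp
  have Ru: "?R c u i = fst c" for c
    using rho_apply[OF ci(3) P.tvec_tangent[OF i]] ci(3) P.tvec_self[OF i] by (simp add: on_sections_def Xu)
  have R: "D u (tvec P u i c) (?R d) i = D u (tvec P u i c) (ext_section i \<phi> (fst d)) i" for c d
    using local_form_cutoff[OF \<phi> i uW P.tvec_tangent[OF i] rho_section[OF X]] by (simp add: FR Ru)
  let ?B = "lie_bracket P (?X c) (?X d)"
  have "?B u i = 0"
    using i FD_rep_ext(2)[OF \<phi> ci(1) zW] by (simp add: lie_bracket_def rep_def)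
  then have "on_sections A (rho A) ?B u i = 0"
    using rho_apply[OF ci(3) P.lie_bracket_tangent[OF X X ci(3)]] ci(3) by (simp add: on_sections_def)
  moreover have "torsion A D (?X c) (?X d) u i = 0" using torsion_free[OF X X] by simp
  ultimately show ?thesis by (simp add: torsion_def cov_deriv_def Xu R)
qed

lemma christoffel_form: "symmetric_connection A D christoffel"
proof (intro symmetric_connection.intro symmetric_connection_axioms.intro base_manifold_axioms conn)
  fix i assume i: "i \<in> indices A"
  show "smooth_symmetric_family (slit (chart_im A i)) (christoffel i)"
  proof (rule smooth_symmetric_family.intro[OF open_slit_im[OF i]])
    fix z assume z: "z \<in> slit (chart_im A i)"
    let ?u = "chart_inv P i z"
    note d = slit_invD[OF i z]
    obtain W \<phi> where \<phi>: "cutoff i (fst ?u) W \<phi>" "chart_map A i (fst ?u) \<in> W" using obtain_cutoff[OF d(4)] by metis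
    have \<Gamma>: "christoffel i z \<xi> \<eta> = D ?u (tvec P ?u i (\<xi>, 0)) (ext_section i \<phi> \<eta>) i" for \<xi> \<eta>
      using christoffel_cutoff[OF \<phi>(1) d(4) \<phi>(2)] unfolding d(3) .
    show "linear (christoffel i z \<xi>)" for \<xi>
    proof (rule linearI)
      note e = ext_expansion[OF \<phi>(1) d(4) \<phi>(2) \<phi> P.tvec_tangent[OF d(4)]]
      show "christoffel i z \<xi> (a + b) = christoffel i z \<xi> a + christoffel i z \<xi> b" for a b
        unfolding \<Gamma> e[where e="a + b"] e[where e=a] e[where e=b] by (simp add: inner_add_left scaleR_add_left sum.distrib)
      show "christoffel i z \<xi> (r *\<^sub>R b) = r *\<^sub>R christoffel i z \<xi> b" for r b
        unfolding \<Gamma> e[where e="r *\<^sub>R b"] e[where e=b] by (simp add: scaleR_sum_right)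
    qed
    show "christoffel i z \<xi> \<eta> = christoffel i z \<eta> \<xi>" for \<xi> \<eta>
      unfolding \<Gamma> using torsion_symmetry[OF \<phi>(1) d(4) \<phi>(2), of "(\<xi>, 0)" "(\<eta>, 0)"] by simp
  next
    fix \<xi> \<eta>
    show "smooth_on (slit (chart_im A i)) (\<lambda>z. christoffel i z \<xi> \<eta>)"
    proof (rule smooth_on_local)
      fix z assume z: "z \<in> slit (chart_im A i)"
      let ?u = "chart_inv P i z"
      note d = slit_invD[OF i z]
      obtain W \<phi> where \<phi>: "cutoff i (fst ?u) W \<phi>" "chart_map P i ?u \<in> slit W" using obtain_cutoff[OF d(4)] by metis
      have zW: "z \<in> slit W" using \<phi>(2) unfolding d(3) .
      have oW: "open (slit W)" and sub: "slit W \<subseteq> slit (chart_im A i)" using cutoff_slit[OF \<phi>(1)] by auto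
      have X: "ext_field i \<phi> (\<xi>, 0) \<in> vector_fields P" by (rule ext_field[OF \<phi>(1) i])
      have "cov_deriv D (ext_field i \<phi> (\<xi>, 0)) (ext_section i \<phi> \<eta>) \<in> pb_sections A"
        by (rule D_section[OF X ext_section[OF \<phi>(1) i]])
      from smooth_on_subset[OF pb_smooth[OF this i] sub]
      have "smooth_on (slit W) (\<lambda>z. christoffel i z \<xi> \<eta>)"
      proof (rule smooth_on_cong[OF oW, rotated])
        fix y assume y: "y \<in> slit W"
        have y': "y \<in> slit (chart_im A i)" using y sub by blast
        note dy = slit_invD[OF i y']
        have yW: "chart_map A i (fst (chart_inv P i y)) \<in> W" unfolding dy(8) using y by auto
        have "ext_field i \<phi> (\<xi>, 0) (chart_inv P i y) = tvec P (chart_inv P i y) i (\<xi>, 0)"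
          by (rule P.tangent_eqI[OF P.vector_field_tangent[OF X] P.tvec_tangent[OF dy(4)] dy(4)])
             (simp add: ext_at(2)[OF \<phi>(1) dy(4) yW] P.tvec_self[OF dy(4)])
        then show "rep P (cov_deriv D (ext_field i \<phi> (\<xi>, 0)) (ext_section i \<phi> \<eta>)) i y = christoffel i y \<xi> \<eta>"
          using christoffel_cutoff[OF \<phi>(1) dy(4) yW, of \<xi> \<eta>] unfolding dy(3) by (simp add: rep_def cov_deriv_def)
      qed
      then show "\<exists>T. open T \<and> z \<in> T \<and> smooth_on T (\<lambda>z. christoffel i z \<xi> \<eta>)" using oW zW by blast
    qed
  qed
next
  fix i u w Y assume i: "i \<in> charts_at P u" and w: "w \<in> tangent_space P u" and Y: "Y \<in> pb_sections A"
  note ci = slit_chartD[OF i]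
  obtain W \<phi> where \<phi>: "cutoff i (fst u) W \<phi>" "chart_map A i (fst u) \<in> W" using obtain_cutoff[OF i] by metis
  let ?E = "ext_section i \<phi> (Y u i)" and ?h = "tvec P u i (fst (w i), 0)" and ?v = "tvec P u i (0, snd (w i))"
  have E: "ext_section i \<phi> e \<in> pb_sections A" for e by (rule ext_section[OF \<phi>(1) ci(1)])
  \<comment> \<open>the vertical part of \<open>w\<close> does not contribute, by \<open>torsion_symmetry\<close>\<close>
  have "tvec P u i (1 *\<^sub>R (fst (w i), 0) + 1 *\<^sub>R (0, snd (w i))) = w"
    using P.tangent_eq_tvec[OF w i, symmetric] by simp
  then have split: "1 *\<^sub>R ?h + 1 *\<^sub>R ?v = w" unfolding tvec_add_scaleR[OF i] .
  have "D u w ?E i = D u ?h ?E i + D u ?v ?E i"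
    using D_linear[OF ci(3) E P.tvec_tangent[OF i] P.tvec_tangent[OF i], of 1 "(fst (w i), 0)" 1 "(0, snd (w i))"]
    unfolding split by simp
  moreover have "D u ?v ?E i = D u (tvec P u i (Y u i, 0)) (ext_section i \<phi> 0) i"
    using torsion_symmetry[OF \<phi>(1) i \<phi>(2), of "(0, snd (w i))" "(Y u i, 0)"] by simp
  moreover have "D u (tvec P u i (Y u i, 0)) (ext_section i \<phi> 0) i = 0"
    using ext_expansion[OF \<phi>(1) i \<phi>(2) \<phi> P.tvec_tangent[OF i], of "(Y u i, 0)" 0] by simp
  ultimately have "D u w ?E i = christoffel i (chart_map P i u) (fst (w i)) (Y u i)"
    using christoffel_cutoff[OF \<phi>(1) i \<phi>(2)] by simp
  then show "D u w Y i = FD (rep P Y i) (chart_map P i u) (w i) +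
      christoffel i (chart_map P i u) (fst (w i)) (Y u i)"
    using local_form_cutoff[OF \<phi>(1) i \<phi>(2) w Y] by simp
qed

end

context finsler_manifold begin

text \<open>The connection has Christoffel symbols because it is torsion-free. Evaluating the other two conditions on fields
  with constant components gives the hypotheses of \<open>berwald_unique\<close>.\<close>
lemma berwald_connection_unique:
  assumes D: "linear_connection A D"
    and L: "\<And>X u. X \<in> vector_fields P \<Longrightarrow> u \<in> points P \<Longrightarrow> fun_deriv P L u (horizontal_projector A D u (X u)) = 0"
    and tor: "\<And>X Y. X \<in> vector_fields P \<Longrightarrow> Y \<in> vector_fields P \<Longrightarrow> torsion A D X Y = 0"
    and vhv: "\<And>X Y. X \<in> pb_sections A \<Longrightarrow> Y \<in> pb_sections A \<Longrightarrow> vhv_torsion A D X Y = 0"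
  shows "D = berwald_connection"
proof -
  interpret T: torsion_free_connection A D
    by (intro torsion_free_connection.intro torsion_free_connection_axioms.intro base_manifold_axioms D tor)
  note form = T.christoffel_form
  interpret S: symmetric_connection A D T.christoffel by (rule form)
  have eq: "T.christoffel i z \<xi> \<eta> = G i z \<xi> \<eta>" if i: "i \<in> indices A" and z: "z \<in> slit (chart_im A i)" for i z \<xi> \<eta>
  proof -
    interpret F: finsler_energy "chart_im A i" "energy i" by (rule finsler_energy[OF i])
    interpret \<Gamma>: smooth_symmetric_family "slit (chart_im A i)" "T.christoffel i" by (rule S.family[OF i])
    note o = open_slit_im[OF i]
    show ?thesis
    proof (rule F.berwald_unique[OF \<Gamma>.lin \<Gamma>.sym _ _ _ z])
      fix z \<xi> \<eta> assume z: "z \<in> slit (chart_im A i)"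
      show "(\<lambda>p. T.christoffel i p \<xi> (snd p)) differentiable at z"
        by (rule smooth_onD[OF \<Gamma>.smooth_right[OF smooth_on_snd[OF o smooth_on_id[OF o]]] z])
      let ?u = "chart_inv P i z"
      note d = slit_invD[OF i z]
      obtain W \<phi> where \<phi>: "cutoff i (fst ?u) W \<phi>" "chart_map A i (fst ?u) \<in> W" using obtain_cutoff[OF d(4)] by metis
      let ?X = "ext_section i \<phi>"
      have X: "?X e \<in> pb_sections A" for e by (rule ext_section[OF \<phi>(1) i])
      have "vhv_torsion A D (?X \<xi>) (?X \<eta>) ?u i = 0" using vhv[OF X X] by simp
      then show "FD (\<lambda>p. T.christoffel i p \<xi> (snd p)) z (0, \<eta>) = T.christoffel i z \<xi> \<eta>"
        unfolding S.vhv_torsion_apply[OF X X d(4)] d(3) ext_at(1)[OF \<phi>(1) d(4) \<phi>(2)] by simp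
      let ?H = "ext_field i \<phi> (\<xi>, 0)"
      have H: "?H \<in> vector_fields P" by (rule ext_field[OF \<phi>(1) i])
      show "FD (energy i) z (\<xi>, 0) = FD (energy i) z (0, T.christoffel i z \<xi> (snd z))"
        using L[OF H d(2)] unfolding fun_deriv_L_horizontal[OF form d(4) P.vector_field_tangent[OF H]]
          ext_at(2)[OF \<phi>(1) d(4) \<phi>(2)] d(3,6) by simp
    qed
  qed
  have "D u w Y = berwald_connection u w Y" for u w Y
    proof (cases "u \<in> points P \<and> w \<in> tangent_space P u \<and> Y \<in> pb_sections A")
      case False
      then have "D u w Y = 0" using D unfolding linear_connection_def by blast
      moreover have "berwald_connection u w Y = 0" using False by (auto simp: berwald_connection_def)
      ultimately show ?thesis by simp
    next
      case True
      then obtain i where i: "i \<in> charts_at P u" using points_iff by metis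
      note c = slit_chartD[OF i]
      show ?thesis
        by (rule tangent_eqI[OF connection_tangent[OF D] berwald_connection_tangent c(4)])
           (use True S.local_form[OF i] berwald_connection_apply[OF i] eq[OF c(1,5)] in simp)
    qed
  then show ?thesis by (intro ext) simp
qed

end

theorem theorem4p3:
  fixes M :: "('i, 'p, 'e::euclidean_space) atlas"
    and L :: "('i, 'p, 'e) tangent_point \<Rightarrow> real"
  assumes "smooth_manifold M" and "finsler M L"
  shows "\<exists>!D. regular_connection M D \<and>
    (\<forall>X\<in>vector_fields (slit_bundle M). \<forall>u\<in>points (slit_bundle M).
       fun_deriv (slit_bundle M) L u (horizontal_projector M D u (X u)) = 0) \<and>
    (\<forall>X\<in>vector_fields (slit_bundle M). \<forall>Y\<in>vector_fields (slit_bundle M).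
       torsion M D X Y = 0) \<and>
    (\<forall>X\<in>pb_sections M. \<forall>Y\<in>pb_sections M. vhv_torsion M D X Y = 0)"
proof -
  interpret finsler_manifold M L
    using assms by unfold_locales (auto simp: smooth_manifold_def)
  show ?thesis
  proof (rule ex1I[of _ berwald_connection])
    show "regular_connection M berwald_connection \<and>
      (\<forall>X\<in>vector_fields (slit_bundle M). \<forall>u\<in>points (slit_bundle M).
         fun_deriv (slit_bundle M) L u (horizontal_projector M berwald_connection u (X u)) = 0) \<and>
      (\<forall>X\<in>vector_fields (slit_bundle M). \<forall>Y\<in>vector_fields (slit_bundle M).
         torsion M berwald_connection X Y = 0) \<and>
      (\<forall>X\<in>pb_sections M. \<forall>Y\<in>pb_sections M. vhv_torsion M berwald_connection X Y = 0)"
      using berwald.regular berwald_connection_preserves_L berwald.torsion_zero berwald_connection_vhv_zero by blast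
  next
    fix D
    assume "regular_connection M D \<and>
      (\<forall>X\<in>vector_fields (slit_bundle M). \<forall>u\<in>points (slit_bundle M).
         fun_deriv (slit_bundle M) L u (horizontal_projector M D u (X u)) = 0) \<and>
      (\<forall>X\<in>vector_fields (slit_bundle M). \<forall>Y\<in>vector_fields (slit_bundle M).
         torsion M D X Y = 0) \<and>
      (\<forall>X\<in>pb_sections M. \<forall>Y\<in>pb_sections M. vhv_torsion M D X Y = 0)"
    then show "D = berwald_connection"
      unfolding regular_connection_def by (intro berwald_connection_unique) blast+
  qed
qed

end
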